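(* Let $G$ be a Hausdorff topological group which is precompact and almost metrizable. Then the dual object $\widehat G$, equipped with the Fell topology, is a discrete topological space.
   Context: All topological spaces and groups are assumed to be Hausdorff. A topological group $G$ is precompact if it is isomorphic, as a topological group, to a subgroup of a compact group. A topological group $G$ is almost metrizable if it has a compact subgroup $K$ such that the quotient space $G/K=\{xK : x\in G\}$ (with the quotient topology) is metrizable. For a complex Hilbert space $\mathcal H$, the unitary group $U(\mathcal H)$ of all linear isometries of $\mathcal H$ onto itself carries the strong operator topology (topology of pointwise convergence). A unitary representation of a topological group $G$ is a continuous homomorphism $\rho: G\to U(\mathcal H)$ for some complex Hilbert space $\mathcal H$. It is irreducible if there is no closed linear subspace $E$ with $\{0\}\subsetneq E\subsetneq \mathcal H$ such that $\rho(g)E\subseteq E$ for all $g\in G$. Two unitary representations $\rho:G\to U(\mathcal H_1)$ and $\psi:G\to U(\mathcal H_2)$ are equivalent if there is a Hilbert space isomorphism $M:\mathcal H_1\to\mathcal H_2$ with $\rho(x)=M^{-1}\psi(x)M$ for all $x\in G$. The dual object $\widehat G$ is the set of equivalence classes $[\rho]$ of irreducible unitary representations $\rho$ of $G$. For a unitary representation $\rho:G\to U(\mathcal H)$, let $P'_\rho$ be the set of all functions $f:G\to\mathbb C$ of the form $f(g)=(\rho(g)v,v)$ with $v\in\mathcal H$, where $(\cdot,\cdot)$ is the inner product of $\mathcal H$, and let $P_\rho$ be the convex cone generated by $P'_\rho$, that is, the set of all finite sums of elements of $P'_\rho$. The Fell topology on $\widehat G$ is the topology in which the basic neighborhoods of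 a point $[\rho]\in\widehat G$ are the sets $$W(f_1,\dots,f_n,C,\epsilon)=\{[\sigma]\in\widehat G : \exists\, g_1,\dots,g_n\in P_\sigma\ \ \forall x\in C\ \ |f_i(x)-g_i(x)|<\epsilon \text{ for } i=1,\dots,n\},$$ where $f_1,\dots,f_n\in P_\rho$, $C$ is a compact subset of $G$, and $\epsilon>0$.
   Formalization: Irreducible representations are required to act on a nonzero Hilbert space; if the zero representation were admitted to the dual object, every Fell neighborhood of its class would be the whole dual object, which would then not be discrete. *)

theory Defs
  imports "HOL-Analysis.Analysis" "HOL-Algebra.Module" "HOL-Algebra.Coset" "HOL-Algebra.Bij"
begin

section \<open>Topological groups\<close>

locale topological_group = group G for G (structure) +
  fixes T
  assumes topspace_eq_carrier: "topspace T = carrier G"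
    and Hausdorff: "Hausdorff_space T"
    and continuous_mult: "continuous_map (prod_topology T T) T (\<lambda>(x, y). x \<otimes> y)"
    and continuous_inv: "continuous_map T T (\<lambda>x. inv x)"

text \<open>The type argument is the type of the elements of the ambient compact group. In a
  theorem with precompactness as a premise it is a free type variable, so that the theorem
  covers compact groups of every type.\<close>

definition precompact_group ::
    "'k itself \<Rightarrow> ('g, 'm) monoid_scheme \<Rightarrow> 'g topology \<Rightarrow> bool"
  where "precompact_group _ G T \<longleftrightarrow>
    (\<exists>(K :: 'k monoid) TK S \<phi>. topological_group K TK \<and> compact_space TK \<and> subgroup S K \<and>
       \<phi> \<in> iso G (K\<lparr>carrier := S\<rparr>) \<and> homeomorphic_map T (subtopology TK S) \<phi>)"

text \<open>\<open>Q\<close> below is the space of left cosets with the quotient topology: that the coset map is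
  a quotient map onto \<open>Q\<close> determines both the points and the open sets of \<open>Q\<close>.\<close>

definition almost_metrizable_group :: "('g, 'm) monoid_scheme \<Rightarrow> 'g topology \<Rightarrow> bool"
  where "almost_metrizable_group G T \<longleftrightarrow>
    (\<exists>K Q. subgroup K G \<and> compactin T K \<and>
       quotient_map T Q (\<lambda>x. x <#\<^bsub>G\<^esub> K) \<and> metrizable_space Q)"


section \<open>Complex Hilbert spaces\<close>

definition complex_ring :: "complex ring"
  where "complex_ring = \<lparr>carrier = UNIV, mult = (*), one = 1, zero = 0, add = (+)\<rparr>"

text \<open>The Hilbert spaces are carrier based since the irreducible representations of one group
  live on different spaces. The ring fields \<open>mult\<close> and \<open>one\<close>, which are part
  of every module record, play no role.\<close>

record 'h hilbert = "(complex, 'h) module" +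
  cinner :: "'h \<Rightarrow> 'h \<Rightarrow> complex"

definition hnorm :: "'h hilbert \<Rightarrow> 'h \<Rightarrow> real"
  where "hnorm H x = sqrt (Re (cinner H x x))"

text \<open>The locale \<^locale>\<open>Metric_space\<close> demands symmetry and nonnegativity also
  outside the carrier.\<close>

definition hdist :: "'h hilbert \<Rightarrow> 'h \<Rightarrow> 'h \<Rightarrow> real"
  where "hdist H x y =
    (if x \<in> carrier H \<and> y \<in> carrier H then hnorm H (x \<ominus>\<^bsub>H\<^esub> y) else 0)"

abbreviation htopology :: "'h hilbert \<Rightarrow> 'h topology"
  where "htopology H \<equiv> Metric_space.mtopology (carrier H) (hdist H)"

locale complex_inner_product_space = Module.module complex_ring H for H :: "'h hilbert" +
  assumes cinner_add_left:
      "\<lbrakk>x \<in> carrier H; y \<in> carrier H; z \<in> carrier H\<rbrakk> \<Longrightarrow>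
        cinner H (x \<oplus>\<^bsub>H\<^esub> y) z = cinner H x z + cinner H y z"
    and cinner_smult_left:
      "\<lbrakk>x \<in> carrier H; y \<in> carrier H\<rbrakk> \<Longrightarrow>
        cinner H (a \<odot>\<^bsub>H\<^esub> x) y = a * cinner H x y"
    and cinner_commute:
      "\<lbrakk>x \<in> carrier H; y \<in> carrier H\<rbrakk> \<Longrightarrow> cinner H y x = cnj (cinner H x y)"
    and cinner_pos:
      "\<lbrakk>x \<in> carrier H; x \<noteq> \<zero>\<^bsub>H\<^esub>\<rbrakk> \<Longrightarrow> 0 < Re (cinner H x x)"

lemma (in complex_inner_product_space) Metric_space_hdist:
  "Metric_space (carrier H) (hdist H)"
proof -
  have scal [simp]: "carrier complex_ring = UNIV" "a \<oplus>\<^bsub>complex_ring\<^esub> b = a + b"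
      "a \<otimes>\<^bsub>complex_ring\<^esub> b = a * b" "\<one>\<^bsub>complex_ring\<^esub> = 1" "\<zero>\<^bsub>complex_ring\<^esub> = 0"
    for a b by (auto simp: complex_ring_def)
  have zl: "cinner H \<zero>\<^bsub>H\<^esub> y = 0" if "y \<in> carrier H" for y
    using cinner_smult_left[of y y 0] smult_l_null[of y] that by simp
  have add_right: "cinner H x (y \<oplus>\<^bsub>H\<^esub> z) = cinner H x y + cinner H x z"
    if "x \<in> carrier H" "y \<in> carrier H" "z \<in> carrier H" for x y z
    using that cinner_add_left[of y z x]
    by (metis M.add.m_closed cinner_commute complex_cnj_add)
  have smult_right: "cinner H x (a \<odot>\<^bsub>H\<^esub> y) = cnj a * cinner H x y"
    if "x \<in> carrier H" "y \<in> carrier H" for a x y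
    using that by (metis UNIV_I cinner_commute cinner_smult_left complex_cnj_mult scal(1) smult_closed)
  have pos: "0 \<le> Re (cinner H x x)" if "x \<in> carrier H" for x
    using that cinner_pos[of x] zl[of x] by (cases "x = \<zero>\<^bsub>H\<^esub>") auto
  have zero_iff: "hnorm H x = 0 \<longleftrightarrow> x = \<zero>\<^bsub>H\<^esub>" if "x \<in> carrier H" for x
    using that cinner_pos[of x] zl[of x] unfolding hnorm_def by (cases "x = \<zero>\<^bsub>H\<^esub>") auto
  have real: "cinner H x x = of_real ((hnorm H x)\<^sup>2)" if "x \<in> carrier H" for x
    using that pos[of x] cinner_commute[of x x] unfolding hnorm_def by (simp add: complex_eq_iff)
  have nn: "0 \<le> hnorm H x" if "x \<in> carrier H" for x
    using pos[OF that] by (simp add: hnorm_def)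
  have CS: "Re (cinner H x y) \<le> hnorm H x * hnorm H y"
    if x: "x \<in> carrier H" and y: "y \<in> carrier H" for x y
  proof (cases "y = \<zero>\<^bsub>H\<^esub>")
    case True
    then show ?thesis using cinner_commute[OF x y] zl[OF x] nn[OF x] nn[OF y] by simp
  next
    case False
    then have ny: "hnorm H y > 0" using nn[OF y] zero_iff[OF y] by linarith
    define t where "t = Re (cinner H x y) / (hnorm H y)\<^sup>2"
    define z where "z = x \<oplus>\<^bsub>H\<^esub> (of_real (- t)) \<odot>\<^bsub>H\<^esub> y"
    have "Re (cinner H z z) = (hnorm H x)\<^sup>2 - 2 * t * Re (cinner H x y) + t\<^sup>2 * (hnorm H y)\<^sup>2"
      unfolding z_def using x y cinner_commute[OF x y] real[OF x] real[OF y]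
      by (simp add: cinner_add_left add_right cinner_smult_left smult_right power2_eq_square
          algebra_simps)
    moreover have "0 \<le> Re (cinner H z z)" using pos[of z] x y by (simp add: z_def)
    moreover have "t\<^sup>2 * (hnorm H y)\<^sup>2 = t * Re (cinner H x y)"
      using ny by (simp add: t_def power2_eq_square)
    ultimately have "t * Re (cinner H x y) \<le> (hnorm H x)\<^sup>2" by linarith
    then have "(Re (cinner H x y))\<^sup>2 \<le> (hnorm H x * hnorm H y)\<^sup>2"
      using ny by (simp add: t_def power2_eq_square field_simps)
    then show ?thesis using nn[OF x] nn[OF y] by (meson abs_le_square_iff abs_le_D1 abs_of_nonneg
          mult_nonneg_nonneg power2_le_imp_le)
  qed
  have tri: "hnorm H (x \<oplus>\<^bsub>H\<^esub> y) \<le> hnorm H x + hnorm H y"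
    if x: "x \<in> carrier H" and y: "y \<in> carrier H" for x y
  proof -
    have "(hnorm H (x \<oplus>\<^bsub>H\<^esub> y))\<^sup>2 = Re (cinner H (x \<oplus>\<^bsub>H\<^esub> y) (x \<oplus>\<^bsub>H\<^esub> y))"
      using real[of "x \<oplus>\<^bsub>H\<^esub> y"] x y by simp
    also have "\<dots> = (hnorm H x)\<^sup>2 + 2 * Re (cinner H x y) + (hnorm H y)\<^sup>2"
      using x y cinner_commute[OF x y] real[OF x] real[OF y]
      by (simp add: cinner_add_left add_right)
    also have "\<dots> \<le> (hnorm H x + hnorm H y)\<^sup>2"
      using CS[OF x y] by (simp add: power2_eq_square algebra_simps)
    finally show ?thesis using nn[OF x] nn[OF y] by (meson add_nonneg_nonneg power2_le_imp_le)
  qed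
  have uminus: "hnorm H (x \<ominus>\<^bsub>H\<^esub> y) = hnorm H (y \<ominus>\<^bsub>H\<^esub> x)"
    if x: "x \<in> carrier H" and y: "y \<in> carrier H" for x y
  proof -
    have m1: "\<ominus>\<^bsub>complex_ring\<^esub> 1 = (-1 :: complex)"
      using R.minus_equality[of "-1" 1] by simp
    have "(-1) \<odot>\<^bsub>H\<^esub> (x \<ominus>\<^bsub>H\<^esub> y) = \<ominus>\<^bsub>H\<^esub> (x \<ominus>\<^bsub>H\<^esub> y)"
      using smult_l_minus[of 1 "x \<ominus>\<^bsub>H\<^esub> y"] smult_one[of "x \<ominus>\<^bsub>H\<^esub> y"] x y m1 by simp
    also have "\<dots> = y \<ominus>\<^bsub>H\<^esub> x"
      using x y by (simp add: a_minus_def M.minus_add M.a_comm)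
    finally have eq: "y \<ominus>\<^bsub>H\<^esub> x = (-1) \<odot>\<^bsub>H\<^esub> (x \<ominus>\<^bsub>H\<^esub> y)" ..
    show ?thesis unfolding hnorm_def eq using x y
      by (simp add: cinner_smult_left smult_right)
  qed
  show ?thesis
  proof
    fix x y
    show "0 \<le> hdist H x y" using nn by (simp add: hdist_def)
    show "hdist H x y = hdist H y x" using uminus by (simp add: hdist_def)
  next
    fix x y assume xy: "x \<in> carrier H" "y \<in> carrier H"
    have "x = y" if "x \<ominus>\<^bsub>H\<^esub> y = \<zero>\<^bsub>H\<^esub>"
      using that xy M.minus_equality[of x "\<ominus>\<^bsub>H\<^esub> y"] by (simp add: a_minus_def)
    moreover have "y \<ominus>\<^bsub>H\<^esub> y = \<zero>\<^bsub>H\<^esub>" using xy by (simp add: a_minus_def M.r_neg)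
    ultimately show "hdist H x y = 0 \<longleftrightarrow> x = y"
      using xy zero_iff[of "x \<ominus>\<^bsub>H\<^esub> y"] by (auto simp: hdist_def)
  next
    fix x y z assume xyz: "x \<in> carrier H" "y \<in> carrier H" "z \<in> carrier H"
    then have "x \<ominus>\<^bsub>H\<^esub> z = (x \<ominus>\<^bsub>H\<^esub> y) \<oplus>\<^bsub>H\<^esub> (y \<ominus>\<^bsub>H\<^esub> z)"
      by (simp add: a_minus_def M.a_assoc M.r_neg1)
    then show "hdist H x z \<le> hdist H x y + hdist H y z"
      using tri[of "x \<ominus>\<^bsub>H\<^esub> y" "y \<ominus>\<^bsub>H\<^esub> z"] xyz by (simp add: hdist_def)
  qed
qed

locale complex_hilbert_space = complex_inner_product_space +
  assumes complete: "Metric_space.mcomplete (carrier H) (hdist H)"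

definition linear_map :: "'h hilbert \<Rightarrow> 'k hilbert \<Rightarrow> ('h \<Rightarrow> 'k) \<Rightarrow> bool"
  where "linear_map H K A \<longleftrightarrow> A \<in> carrier H \<rightarrow> carrier K \<and>
    (\<forall>x\<in>carrier H. \<forall>y\<in>carrier H. A (x \<oplus>\<^bsub>H\<^esub> y) = A x \<oplus>\<^bsub>K\<^esub> A y) \<and>
    (\<forall>c. \<forall>x\<in>carrier H. A (c \<odot>\<^bsub>H\<^esub> x) = c \<odot>\<^bsub>K\<^esub> A x)"

definition hilbert_iso :: "'h hilbert \<Rightarrow> 'k hilbert \<Rightarrow> ('h \<Rightarrow> 'k) \<Rightarrow> bool"
  where "hilbert_iso H K M \<longleftrightarrow> linear_map H K M \<and> bij_betw M (carrier H) (carrier K) \<and>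
    (\<forall>x\<in>carrier H. \<forall>y\<in>carrier H. cinner K (M x) (M y) = cinner H x y)"


section \<open>The unitary group with the strong operator topology\<close>

text \<open>As in \<^const>\<open>BijGroup\<close>, operators are extensional functions on the carrier.\<close>

definition unitaries :: "'h hilbert \<Rightarrow> ('h \<Rightarrow> 'h) set"
  where "unitaries H = {A \<in> extensional (carrier H). linear_map H H A \<and>
    A ` carrier H = carrier H \<and>
    (\<forall>x\<in>carrier H. \<forall>y\<in>carrier H. hdist H (A x) (A y) = hdist H x y)}"

definition unitary_group :: "'h hilbert \<Rightarrow> ('h \<Rightarrow> 'h) monoid"
  where "unitary_group H = (BijGroup (carrier H))\<lparr>carrier := unitaries H\<rparr>"

definition strong_operator_topology :: "'h hilbert \<Rightarrow> ('h \<Rightarrow> 'h) topology"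
  where "strong_operator_topology H =
    subtopology (product_topology (\<lambda>_. htopology H) (carrier H)) (unitaries H)"


section \<open>Unitary representations and the dual object\<close>

type_synonym ('g, 'h) rep = "'h hilbert \<times> ('g \<Rightarrow> 'h \<Rightarrow> 'h)"

definition unitary_rep :: "('g, 'm) monoid_scheme \<Rightarrow> 'g topology \<Rightarrow> ('g, 'h) rep \<Rightarrow> bool"
  where "unitary_rep G T = (\<lambda>(H, \<rho>). complex_hilbert_space H \<and>
    \<rho> \<in> hom G (unitary_group H) \<and> continuous_map T (strong_operator_topology H) \<rho>)"

text \<open>The representation on the zero space is excluded, as usual. Otherwise every
  neighborhood of its class would be the whole dual object, since the zero function belongs to
  every cone of positive definite functions below, so that the dual object would never be
  discrete.\<close>

definition irreducible_rep :: "('g, 'm) monoid_scheme \<Rightarrow> 'g topology \<Rightarrow> ('g, 'h) rep \<Rightarrow> bool"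
  where "irreducible_rep G T = (\<lambda>(H, \<rho>). unitary_rep G T (H, \<rho>) \<and> carrier H \<noteq> {\<zero>\<^bsub>H\<^esub>} \<and>
    \<not> (\<exists>E. submodule E complex_ring H \<and> closedin (htopology H) E \<and>
          {\<zero>\<^bsub>H\<^esub>} \<subset> E \<and> E \<subset> carrier H \<and> (\<forall>g\<in>carrier G. \<rho> g ` E \<subseteq> E)))"

definition equivalent_reps ::
    "('g, 'm) monoid_scheme \<Rightarrow> ('g, 'h) rep \<Rightarrow> ('g, 'k) rep \<Rightarrow> bool"
  where "equivalent_reps G = (\<lambda>(H, \<rho>) (K, \<psi>). \<exists>M. hilbert_iso H K M \<and>
    (\<forall>x\<in>carrier G. \<forall>v\<in>carrier H. \<rho> x v = inv_into (carrier H) M (\<psi> x (M v))))"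

text \<open>The classes of the irreducible representations whose Hilbert space has its elements in
  \<open>'h\<close>. An irreducible representation \<open>\<rho>\<close> on \<open>H\<close> is equivalent to one on a space
  of functions on the group: for \<open>w \<noteq> 0\<close>, mapping \<open>v\<close> to the function
  \<open>g \<mapsto> (v, \<rho>(g)w)\<close> is injective, as \<open>w\<close> is cyclic. So the type
  \<open>'g \<Rightarrow> complex\<close> for \<open>'h\<close> already yields every class, and a theorem for all \<open>'h\<close>
  speaks about the full dual object.\<close>

definition rep_equivalence ::
    "('g, 'm) monoid_scheme \<Rightarrow> 'g topology \<Rightarrow> (('g, 'h) rep \<times> ('g, 'h) rep) set"
  where "rep_equivalence G T =
    {(r, s). irreducible_rep G T r \<and> irreducible_rep G T s \<and> equivalent_reps G r s}"

lemma irreducible_rep_closed: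
  assumes "irreducible_rep G T (H, \<rho>)" "x \<in> carrier G" "v \<in> carrier H"
  shows "\<rho> x v \<in> carrier H"
proof -
  have "\<rho> x \<in> unitaries H"
    using assms by (auto simp: irreducible_rep_def unitary_rep_def unitary_group_def hom_def)
  then show ?thesis using assms(3) by (auto simp: unitaries_def linear_map_def)
qed

lemma equivalent_reps_iff:
  assumes "irreducible_rep G T (H, \<rho>)" "irreducible_rep G T (K, \<psi>)"
  shows "equivalent_reps G (H, \<rho>) (K, \<psi>) \<longleftrightarrow>
    (\<exists>M. hilbert_iso H K M \<and> (\<forall>x\<in>carrier G. \<forall>v\<in>carrier H. M (\<rho> x v) = \<psi> x (M v)))"
proof -
  have "(\<rho> x v = inv_into (carrier H) M (\<psi> x (M v))) = (M (\<rho> x v) = \<psi> x (M v))"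
    if M: "hilbert_iso H K M" and xv: "x \<in> carrier G" "v \<in> carrier H" for M x v
  proof -
    have b: "bij_betw M (carrier H) (carrier K)" using M by (simp add: hilbert_iso_def)
    have "M v \<in> carrier K" using b xv by (auto simp: bij_betw_def)
    then have "\<psi> x (M v) \<in> carrier K" using irreducible_rep_closed[OF assms(2)] xv by blast
    moreover have "\<rho> x v \<in> carrier H" using irreducible_rep_closed[OF assms(1)] xv by blast
    ultimately show ?thesis
      by (metis b bij_betw_inv_into_left bij_betw_inv_into_right)
  qed
  then show ?thesis
    unfolding equivalent_reps_def split by (intro ex_cong1 conj_cong refl ball_cong) blast
qed

lemma equiv_rep_equivalence:
  "equiv {r :: ('g, 'h) rep. irreducible_rep G T r} (rep_equivalence G T)"
proof (rule equivI)
  show "rep_equivalence G T \<subseteq> {r. irreducible_rep G T r} \<times> {r. irreducible_rep G T r}"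
    by (auto simp: rep_equivalence_def)
next
  have "hilbert_iso H H (\<lambda>v. v)" for H :: "'h hilbert"
    by (auto simp: hilbert_iso_def linear_map_def bij_betw_def)
  then show "refl_on {r :: ('g, 'h) rep. irreducible_rep G T r} (rep_equivalence G T)"
    by (auto simp: rep_equivalence_def refl_on_def equivalent_reps_iff intro!: exI[of _ "\<lambda>v. v"])
next
  have "hilbert_iso K H (inv_into (carrier H) M)" if "complex_hilbert_space H" "hilbert_iso H K M"
    for H K :: "'h hilbert" and M
  proof -
    interpret complex_hilbert_space H by fact
    have b: "bij_betw M (carrier H) (carrier K)" and l: "linear_map H K M"
      and i: "\<And>x y. \<lbrakk>x \<in> carrier H; y \<in> carrier H\<rbrakk> \<Longrightarrow> cinner K (M x) (M y) = cinner H x y"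
      using that by (auto simp: hilbert_iso_def)
    let ?N = "inv_into (carrier H) M"
    have N: "?N y \<in> carrier H" "M (?N y) = y" if "y \<in> carrier K" for y
      using that b by (auto simp: bij_betw_def inv_into_into f_inv_into_f)
    have NM: "?N (M x) = x" if "x \<in> carrier H" for x
      using that b by (auto simp: bij_betw_def)
    have smult: "c \<odot>\<^bsub>H\<^esub> x \<in> carrier H" if "x \<in> carrier H" for c x
      using smult_closed[of c x] that by (simp add: complex_ring_def)
    have "?N (x \<oplus>\<^bsub>K\<^esub> y) = ?N x \<oplus>\<^bsub>H\<^esub> ?N y" if "x \<in> carrier K" "y \<in> carrier K" for x y
      using l N[OF that(1)] N[OF that(2)] NM[of "?N x \<oplus>\<^bsub>H\<^esub> ?N y"] by (simp add: linear_map_def)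
    moreover have "?N (c \<odot>\<^bsub>K\<^esub> x) = c \<odot>\<^bsub>H\<^esub> ?N x" if "x \<in> carrier K" for c x
      using l N[OF that(1)] NM[of "c \<odot>\<^bsub>H\<^esub> ?N x"] smult by (simp add: linear_map_def)
    moreover have "cinner H (?N x) (?N y) = cinner K x y"
      if "x \<in> carrier K" "y \<in> carrier K" for x y
      using i[of "?N x" "?N y"] N that by simp
    ultimately show ?thesis
      using b N(1) by (auto simp: hilbert_iso_def linear_map_def bij_betw_inv_into)
  qed note inv = this
  show "sym (rep_equivalence G T :: (('g, 'h) rep \<times> ('g, 'h) rep) set)"
  proof (rule symI)
    fix r s :: "('g, 'h) rep" assume rs: "(r, s) \<in> rep_equivalence G T"
    obtain H \<rho> K \<psi> where eq: "r = (H, \<rho>)" "s = (K, \<psi>)" by (cases r, cases s) auto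
    have irr: "irreducible_rep G T (H, \<rho>)" "irreducible_rep G T (K, \<psi>)"
      using rs eq by (auto simp: rep_equivalence_def)
    obtain M where M: "hilbert_iso H K M"
        "\<And>x v. \<lbrakk>x \<in> carrier G; v \<in> carrier H\<rbrakk> \<Longrightarrow> M (\<rho> x v) = \<psi> x (M v)"
      using rs eq irr equivalent_reps_iff by (fastforce simp: rep_equivalence_def)
    let ?N = "inv_into (carrier H) M"
    have b: "bij_betw M (carrier H) (carrier K)" using M by (simp add: hilbert_iso_def)
    have "?N (\<psi> x w) = \<rho> x (?N w)" if "x \<in> carrier G" "w \<in> carrier K" for x w
    proof -
      have "?N w \<in> carrier H" "M (?N w) = w"
        using that b by (auto simp: bij_betw_def inv_into_into f_inv_into_f)
      then show ?thesis
        by (metis M(2) b bij_betw_inv_into_left irr(1) irreducible_rep_closed that(1))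
    qed
    moreover have "hilbert_iso K H ?N"
      using inv M irr by (auto simp: irreducible_rep_def unitary_rep_def)
    ultimately show "(s, r) \<in> rep_equivalence G T"
      using irr eq equivalent_reps_iff[OF irr(2,1)] by (auto simp: rep_equivalence_def)
  qed
next
  show "trans (rep_equivalence G T :: (('g, 'h) rep \<times> ('g, 'h) rep) set)"
  proof (rule transI)
    fix r s t :: "('g, 'h) rep"
    assume rs: "(r, s) \<in> rep_equivalence G T" and st: "(s, t) \<in> rep_equivalence G T"
    obtain H \<rho> K \<psi> L \<tau> where eq: "r = (H, \<rho>)" "s = (K, \<psi>)" "t = (L, \<tau>)"
      by (cases r, cases s, cases t) auto
    have irr: "irreducible_rep G T (H, \<rho>)" "irreducible_rep G T (K, \<psi>)"
        "irreducible_rep G T (L, \<tau>)"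
      using rs st eq by (auto simp: rep_equivalence_def)
    obtain M where M: "hilbert_iso H K M"
        "\<And>x v. \<lbrakk>x \<in> carrier G; v \<in> carrier H\<rbrakk> \<Longrightarrow> M (\<rho> x v) = \<psi> x (M v)"
      using rs eq irr equivalent_reps_iff by (fastforce simp: rep_equivalence_def)
    obtain N where N: "hilbert_iso K L N"
        "\<And>x v. \<lbrakk>x \<in> carrier G; v \<in> carrier K\<rbrakk> \<Longrightarrow> N (\<psi> x v) = \<tau> x (N v)"
      using st eq irr equivalent_reps_iff by (fastforce simp: rep_equivalence_def)
    have MK: "M v \<in> carrier K" if "v \<in> carrier H" for v
      using M(1) that by (auto simp: hilbert_iso_def bij_betw_def)
    have "hilbert_iso H L (N \<circ> M)"
      using M(1) N(1) MK bij_betw_trans[of M "carrier H" "carrier K" N "carrier L"]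
      by (auto simp: hilbert_iso_def linear_map_def Pi_iff)
    moreover have "(N \<circ> M) (\<rho> x v) = \<tau> x ((N \<circ> M) v)"
      if "x \<in> carrier G" "v \<in> carrier H" for x v
      using M(2) N(2) MK that by simp
    ultimately show "(r, t) \<in> rep_equivalence G T"
      using irr eq equivalent_reps_iff[OF irr(1,3)] by (auto simp: rep_equivalence_def)
  qed
qed

definition dual_object :: "('g, 'm) monoid_scheme \<Rightarrow> 'g topology \<Rightarrow> ('g, 'h) rep set set"
  where "dual_object G T = {r. irreducible_rep G T r} // rep_equivalence G T"


section \<open>The Fell topology\<close>

definition coefficients :: "('g, 'm) monoid_scheme \<Rightarrow> ('g, 'h) rep \<Rightarrow> ('g \<Rightarrow> complex) set"
  where "coefficients G =
    (\<lambda>(H, \<rho>). {\<lambda>g\<in>carrier G. cinner H (\<rho> g v) v | v. v \<in> carrier H})"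

definition coefficient_cone :: "('g, 'm) monoid_scheme \<Rightarrow> ('g, 'h) rep \<Rightarrow> ('g \<Rightarrow> complex) set"
  where "coefficient_cone G r =
    {\<lambda>g\<in>carrier G. \<Sum>i<n. p i g | (n :: nat) p. \<forall>i<n. p i \<in> coefficients G r}"

lemma coefficient_cone_cong:
  assumes "(r, s) \<in> rep_equivalence G T"
  shows "coefficient_cone G r = coefficient_cone G s"
proof -
  obtain H \<rho> K \<psi> where eq: "r = (H, \<rho>)" "s = (K, \<psi>)" by (cases r, cases s) auto
  have irr: "irreducible_rep G T (H, \<rho>)" "irreducible_rep G T (K, \<psi>)"
    using assms eq by (auto simp: rep_equivalence_def)
  obtain M where M: "hilbert_iso H K M"
      "\<And>x v. \<lbrakk>x \<in> carrier G; v \<in> carrier H\<rbrakk> \<Longrightarrow> M (\<rho> x v) = \<psi> x (M v)"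
    using assms eq irr equivalent_reps_iff by (fastforce simp: rep_equivalence_def)
  have K: "carrier K = M ` carrier H"
    using M(1) by (auto simp: hilbert_iso_def bij_betw_def)
  have "(\<lambda>g\<in>carrier G. cinner H (\<rho> g v) v) = (\<lambda>g\<in>carrier G. cinner K (\<psi> g (M v)) (M v))"
    if "v \<in> carrier H" for v
    using M that irreducible_rep_closed[OF irr(1)]
    by (auto simp: hilbert_iso_def restrict_def fun_eq_iff simp flip: M(2))
  then have "coefficients G r = coefficients G s"
    unfolding coefficients_def eq split K Setcompr_eq_image image_image by simp
  then show ?thesis by (simp add: coefficient_cone_def)
qed

text \<open>By the preceding lemma the choice of the representatives \<open>s\<close> and \<open>r\<close> of the
  classes in the next two definitions is irrelevant.\<close>

definition fell_nbhd ::
    "('g, 'm) monoid_scheme \<Rightarrow> 'g topology \<Rightarrow> nat \<Rightarrow> (nat \<Rightarrow> 'g \<Rightarrow> complex) \<Rightarrow> 'g set \<Rightarrow> real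
      \<Rightarrow> ('g, 'h) rep set set"
  where "fell_nbhd G T n f C \<epsilon> = {c \<in> dual_object G T. \<exists>s\<in>c. \<exists>h.
    (\<forall>i<n. h i \<in> coefficient_cone G s) \<and> (\<forall>x\<in>C. \<forall>i<n. cmod (f i x - h i x) < \<epsilon>)}"

definition fell_open :: "('g, 'm) monoid_scheme \<Rightarrow> 'g topology \<Rightarrow> ('g, 'h) rep set set \<Rightarrow> bool"
  where "fell_open G T U \<longleftrightarrow> U \<subseteq> dual_object G T \<and>
    (\<forall>c\<in>U. \<forall>r\<in>c. \<exists>n f C \<epsilon>. (\<forall>i<n. f i \<in> coefficient_cone G r) \<and>
       compactin T C \<and> \<epsilon> > 0 \<and> fell_nbhd G T n f C \<epsilon> \<subseteq> U)"

lemma fell_nbhd_append: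
  "fell_nbhd G T (m + n) (\<lambda>i. if i < m then f i else f' (i - m)) (C \<union> C') (min \<epsilon> \<epsilon>')
    \<subseteq> (fell_nbhd G T m f C \<epsilon> \<inter> fell_nbhd G T n f' C' \<epsilon>' :: ('g, 'h) rep set set)"
proof
  fix c :: "('g, 'h) rep set"
  let ?f = "\<lambda>i. if i < m then f i else f' (i - m)"
  assume "c \<in> fell_nbhd G T (m + n) ?f (C \<union> C') (min \<epsilon> \<epsilon>')"
  then have c': "c \<in> dual_object G T"
    and "\<exists>s\<in>c. \<exists>h. (\<forall>i<m + n. h i \<in> coefficient_cone G s) \<and>
      (\<forall>x\<in>C \<union> C'. \<forall>i<m + n. cmod (?f i x - h i x) < min \<epsilon> \<epsilon>')"
    unfolding fell_nbhd_def by (simp_all only: mem_Collect_eq)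
  then obtain s h where s: "s \<in> c"
    and h: "\<forall>i<m + n. h i \<in> coefficient_cone G s"
    and lt: "\<forall>x\<in>C \<union> C'. \<forall>i<m + n. cmod (?f i x - h i x) < min \<epsilon> \<epsilon>'"
    by (elim bexE exE conjE)
  have "cmod (f i x - h i x) < \<epsilon>" if "x \<in> C" "i < m" for x i
    using lt[rule_format, of x i] that by simp
  then have "c \<in> fell_nbhd G T m f C \<epsilon>"
    unfolding fell_nbhd_def using c' h by (auto intro!: bexI[OF _ s] exI[of _ h])
  moreover have "cmod (f' i x - h (m + i) x) < \<epsilon>'" if "x \<in> C'" "i < n" for x i
    using lt[rule_format, of x "m + i"] that by simp
  then have "c \<in> fell_nbhd G T n f' C' \<epsilon>'"
    unfolding fell_nbhd_def using c' h by (auto intro!: bexI[OF _ s] exI[of _ "\<lambda>i. h (m + i)"])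
  ultimately show "c \<in> fell_nbhd G T m f C \<epsilon> \<inter> fell_nbhd G T n f' C' \<epsilon>'" by blast
qed

lemma istopology_fell_open:
  "istopology (fell_open G T :: ('g, 'h) rep set set \<Rightarrow> bool)"
  unfolding istopology_def
proof (intro conjI allI impI)
  fix U V :: "('g, 'h) rep set set" assume U: "fell_open G T U" and V: "fell_open G T V"
  show "fell_open G T (U \<inter> V)"
    unfolding fell_open_def
  proof (intro conjI ballI)
    show "U \<inter> V \<subseteq> dual_object G T" using U by (auto simp: fell_open_def)
  next
    fix c r assume c: "c \<in> U \<inter> V" "r \<in> c"
    obtain m f C \<epsilon> where 1: "\<And>i. i < m \<Longrightarrow> f i \<in> coefficient_cone G r" "compactin T C" "\<epsilon> > 0"
        "fell_nbhd G T m f C \<epsilon> \<subseteq> U"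
      using bspec[OF bspec[OF conjunct2[OF U[unfolded fell_open_def]]]] c
      by (metis (no_types, lifting) IntD1)
    obtain n f' C' \<epsilon>' where 2: "\<And>i. i < n \<Longrightarrow> f' i \<in> coefficient_cone G r" "compactin T C'"
        "\<epsilon>' > 0" "fell_nbhd G T n f' C' \<epsilon>' \<subseteq> V"
      using bspec[OF bspec[OF conjunct2[OF V[unfolded fell_open_def]]]] c
      by (metis (no_types, lifting) IntD2)
    have "compactin T (C \<union> C')" "min \<epsilon> \<epsilon>' > 0" using 1 2 by (auto intro: compactin_Un)
    moreover have "\<forall>i<m + n. (if i < m then f i else f' (i - m)) \<in> coefficient_cone G r"
      using 1(1) 2(1) by auto
    moreover have "fell_nbhd G T (m + n) (\<lambda>i. if i < m then f i else f' (i - m))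
        (C \<union> C') (min \<epsilon> \<epsilon>') \<subseteq> U \<inter> V"
      using fell_nbhd_append[of G T m n f f' C C' \<epsilon> \<epsilon>'] 1(4) 2(4) by fastforce
    ultimately show "\<exists>n f C \<epsilon>. (\<forall>i<n. f i \<in> coefficient_cone G r) \<and> compactin T C \<and> \<epsilon> > 0 \<and>
        fell_nbhd G T n f C \<epsilon> \<subseteq> U \<inter> V"
      by (intro exI conjI)
  qed
next
  fix \<U> :: "('g, 'h) rep set set set" assume \<U>: "\<forall>U\<in>\<U>. fell_open G T U"
  show "fell_open G T (\<Union>\<U>)"
    unfolding fell_open_def
  proof (intro conjI ballI)
    show "\<Union>\<U> \<subseteq> dual_object G T" using \<U> by (auto simp: fell_open_def)
  next
    fix c r assume "c \<in> \<Union>\<U>" "r \<in> c"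
    then obtain U where U: "U \<in> \<U>" "c \<in> U" by blast
    with \<U> have open_U: "fell_open G T U" by blast
    obtain n f C \<epsilon> where "\<forall>i<n. f i \<in> coefficient_cone G r" "compactin T C"
        "\<epsilon> > 0" "fell_nbhd G T n f C \<epsilon> \<subseteq> U"
      using bspec[OF bspec[OF conjunct2[OF open_U[unfolded fell_open_def]] U(2)] \<open>r \<in> c\<close>]
      by (elim exE conjE)
    then show "\<exists>n f C \<epsilon>. (\<forall>i<n. f i \<in> coefficient_cone G r) \<and> compactin T C \<and> \<epsilon> > 0 \<and>
        fell_nbhd G T n f C \<epsilon> \<subseteq> \<Union>\<U>"
      using U(1) by (meson Union_upper order_trans)
  qed
qed

definition fell_topology :: "('g, 'm) monoid_scheme \<Rightarrow> 'g topology \<Rightarrow> ('g, 'h) rep set topology"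
  where "fell_topology G T = topology (fell_open G T)"

lemma openin_fell_topology: "openin (fell_topology G T) U \<longleftrightarrow> fell_open G T U"
  by (simp add: fell_topology_def istopology_fell_open topology_inverse')

end

theory Submission
  imports Defs
begin

text \<open>
  Uniformly continuous functions on a totally bounded group have averages of right translates
  that are almost constant, which with Tychonoff's theorem gives a left-invariant mean \<open>M\<close> playing
  the role of the Haar measure of the completion. For an irreducible \<open>\<sigma>\<close> the invariant form
  \<open>M (\<lambda>x. \<bar>(u, \<sigma> x v)\<bar>\<^sup>2)\<close> attains its maximum on the unit sphere, so by irreducibility it is a multiple
  of the norm, and Bessel's inequality shows that \<open>\<sigma>\<close> is finite dimensional. As usual, coefficients
  of inequivalent representations are orthogonal with respect to \<open>M\<close>.

  Let \<open>f\<close> be a normalized coefficient of \<open>\<rho>\<close>. By orthogonality no positive definite function \<open>g\<close>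
  belonging to another class is uniformly \<open>\<epsilon>\<close>-close to \<open>f\<close> on all of \<open>G\<close>. Let \<open>U\<^sub>0 = G\<close> and let
  \<open>U\<^sub>1 \<supseteq> U\<^sub>2 \<supseteq> \<dots>\<close> be a base at the compact subgroup \<open>K\<close>. As in the Banach-Dieudonne theorem one chooses
  finite sets \<open>F\<^sub>n \<subseteq> U\<^sub>n\<close> such that no such \<open>g\<close> is \<open>\<epsilon>\<close>-close to \<open>f\<close> on \<open>F\<^sub>0 \<union> \<dots> \<union> F\<^sub>n \<union> U\<^bsub>n+1\<^esub>\<close>.
  The choice is possible by compactness: functions \<open>g\<close> that are close to \<open>f\<close> on a neighborhood of
  \<open>\<one>\<close> belong, by Bessel's inequality, to finitely many finite dimensional classes. Then
  \<open>K \<union> F\<^sub>0 \<union> F\<^sub>1 \<union> \<dots>\<close> is a compact set which isolates \<open>\<rho>\<close>.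
\<close>

section \<open>Means on bounded functions\<close>

text \<open>Fell neighborhoods test functions on compact sets only, and a precompact group need not
  be locally compact, so separation on all of \<open>G\<close> is not enough. Almost metrizability
  enters only to replace \<open>G\<close> by a compact set. That set contains \<open>K\<close>
  because the finite sets accumulate at \<open>K\<close> rather than at \<open>\<one>\<close>. Means
  replace Haar measure so that no completion has to be built. Of integration the argument needs
  linearity, positivity, invariance on uniformly continuous functions, and strict positivity, which
  follows from covering the group by finitely many translates. The compactness arguments take place
  in the topology of pointwise convergence. Hence separation is shown for the closures of the cones
  and with weak inequalities. Finite dimensionality keeps the limits within the span of the matrix
  coefficients, so that orthogonality survives. This needs a bound on the value at
  \<open>\<one>\<close>; the bound \<open>2\<close> is available because only functions within
  \<open>1 / 8\<close> of \<open>f\<close> at \<open>\<one>\<close> matter, where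
  \<open>f \<one> = 1\<close>.\<close>

lemma compact_box:
  fixes K :: "'a \<Rightarrow> 'b::topological_space set"
  assumes "\<And>x. compact (K x)"
  shows "compact {g. \<forall>x. g x \<in> K x}"
proof -
  have "compactin (product_topology (\<lambda>_. euclidean) UNIV) (PiE UNIV K)"
    using assms by (subst compactin_PiE) auto
  moreover have "PiE UNIV K = {g. \<forall>x. g x \<in> K x}" by auto
  ultimately show ?thesis by (simp add: euclidean_product_topology)
qed

definition bounded_fun :: "'a set \<Rightarrow> ('a \<Rightarrow> complex) \<Rightarrow> bool"
  where "bounded_fun S f \<longleftrightarrow> (\<exists>b. \<forall>x\<in>S. cmod (f x) \<le> b)"

text \<open>Unbounded functions get the value \<open>0\<close> so that the set of all means is compact.\<close>

definition mean :: "'a set \<Rightarrow> (('a \<Rightarrow> complex) \<Rightarrow> complex) \<Rightarrow> bool"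
  where "mean S m \<longleftrightarrow>
    (\<forall>f g. bounded_fun S f \<longrightarrow> bounded_fun S g \<longrightarrow> m (\<lambda>x. f x + g x) = m f + m g) \<and>
    (\<forall>c f. bounded_fun S f \<longrightarrow> m (\<lambda>x. c * f x) = c * m f) \<and>
    (\<forall>f. bounded_fun S f \<longrightarrow> (\<forall>x\<in>S. 0 \<le> Re (f x) \<and> Im (f x) = 0) \<longrightarrow>
      0 \<le> Re (m f) \<and> Im (m f) = 0) \<and>
    m (\<lambda>x. 1) = 1 \<and> (\<forall>f. \<not> bounded_fun S f \<longrightarrow> m f = 0)"

lemma bounded_funI: "(\<And>x. x \<in> S \<Longrightarrow> cmod (f x) \<le> b) \<Longrightarrow> bounded_fun S f"
  by (auto simp: bounded_fun_def)

lemma bounded_funE: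
  assumes "bounded_fun S f"
  obtains b where "b > 0" "\<And>x. x \<in> S \<Longrightarrow> cmod (f x) \<le> b"
proof -
  obtain b where b: "\<And>x. x \<in> S \<Longrightarrow> cmod (f x) \<le> b" using assms by (auto simp: bounded_fun_def)
  have "cmod (f x) \<le> max b 1" if "x \<in> S" for x using b[OF that] by simp
  then show ?thesis using that[of "max b 1"] by simp
qed

lemma bounded_fun_const [simp]: "bounded_fun S (\<lambda>x. c)"
  by (auto simp: bounded_fun_def)

lemma bounded_fun_add: "bounded_fun S f \<Longrightarrow> bounded_fun S g \<Longrightarrow> bounded_fun S (\<lambda>x. f x + g x)"
  unfolding bounded_fun_def by (meson add_mono norm_triangle_le)

lemma bounded_fun_mult:
  assumes "bounded_fun S f" "bounded_fun S g"
  shows "bounded_fun S (\<lambda>x. f x * g x)"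
proof -
  obtain a b where "\<forall>x\<in>S. cmod (f x) \<le> a" "\<forall>x\<in>S. cmod (g x) \<le> b"
    using assms by (auto simp: bounded_fun_def)
  then have "\<forall>x\<in>S. cmod (f x * g x) \<le> a * b"
    by (smt (verit) mult_mono norm_ge_zero norm_mult)
  then show ?thesis by (auto simp: bounded_fun_def)
qed

lemma bounded_fun_cnj: "bounded_fun S f \<Longrightarrow> bounded_fun S (\<lambda>x. cnj (f x))"
  by (auto simp: bounded_fun_def)

lemma bounded_fun_diff:
  "bounded_fun S f \<Longrightarrow> bounded_fun S g \<Longrightarrow> bounded_fun S (\<lambda>x. f x - g x)"
  using bounded_fun_add[of S f "\<lambda>x. (-1) * g x"] bounded_fun_mult[of S "\<lambda>x. -1" g] by simp

lemma bounded_fun_sum: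
  "(\<And>i. i \<in> I \<Longrightarrow> bounded_fun S (f i)) \<Longrightarrow> bounded_fun S (\<lambda>x. \<Sum>i\<in>I. f i x)"
  by (induction I rule: infinite_finite_induct) (auto intro: bounded_fun_add)

lemma bounded_fun_Re: "bounded_fun S f \<Longrightarrow> bounded_fun S (\<lambda>x. of_real (Re (f x)))"
  unfolding bounded_fun_def by (metis abs_Re_le_cmod norm_of_real order_trans)

lemma bounded_fun_Im: "bounded_fun S f \<Longrightarrow> bounded_fun S (\<lambda>x. of_real (Im (f x)))"
  unfolding bounded_fun_def by (metis abs_Im_le_cmod norm_of_real order_trans)

lemmas bounded_fun_intros = bounded_fun_add bounded_fun_mult bounded_fun_cnj
  bounded_fun_diff bounded_fun_sum bounded_fun_Re bounded_fun_Im

locale mean_functional =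
  fixes S :: "'a set" and m :: "('a \<Rightarrow> complex) \<Rightarrow> complex"
  assumes mean: "mean S m"
begin

lemma add: "bounded_fun S f \<Longrightarrow> bounded_fun S g \<Longrightarrow> m (\<lambda>x. f x + g x) = m f + m g"
  using mean by (simp add: mean_def)

lemma cmult: "bounded_fun S f \<Longrightarrow> m (\<lambda>x. c * f x) = c * m f"
  using mean by (simp add: mean_def)

lemma const: "m (\<lambda>x. c) = c"
  using cmult[of "\<lambda>x. 1" c] mean by (simp add: mean_def)

lemma diff: "bounded_fun S f \<Longrightarrow> bounded_fun S g \<Longrightarrow> m (\<lambda>x. f x - g x) = m f - m g"
  using add[of f "\<lambda>x. (-1) * g x"] cmult[of g "-1"] bounded_fun_mult[of S "\<lambda>x. -1" g] by simp

lemma sum: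
  "(\<And>i. i \<in> I \<Longrightarrow> bounded_fun S (f i)) \<Longrightarrow> m (\<lambda>x. \<Sum>i\<in>I. f i x) = (\<Sum>i\<in>I. m (f i))"
  by (induction I rule: infinite_finite_induct) (auto simp: const add bounded_fun_sum)

lemma nonneg:
  assumes "bounded_fun S f" "\<And>x. x \<in> S \<Longrightarrow> 0 \<le> Re (f x)" "\<And>x. x \<in> S \<Longrightarrow> Im (f x) = 0"
  shows "0 \<le> Re (m f)" "Im (m f) = 0"
proof -
  have "bounded_fun S f \<longrightarrow> (\<forall>x\<in>S. 0 \<le> Re (f x) \<and> Im (f x) = 0) \<longrightarrow>
      0 \<le> Re (m f) \<and> Im (m f) = 0"
    using mean unfolding mean_def by blast
  then show "0 \<le> Re (m f)" "Im (m f) = 0" using assms by auto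
qed

lemma real:
  assumes "bounded_fun S f" "\<And>x. x \<in> S \<Longrightarrow> Im (f x) = 0"
  shows "Im (m f) = 0"
proof -
  obtain b where b: "\<And>x. x \<in> S \<Longrightarrow> cmod (f x) \<le> b" using assms by (auto simp: bounded_fun_def)
  \<comment> \<open>Adding a bound of \<open>f\<close> makes the function nonnegative, and the added
    constant has a real mean.\<close>
  have "Im (m (\<lambda>x. of_real b + f x)) = 0"
  proof (rule nonneg(2))
    fix x assume "x \<in> S"
    then show "0 \<le> Re (of_real b + f x)" using b[of x] abs_Re_le_cmod[of "f x"] by simp
  qed (use assms in \<open>auto intro: bounded_fun_intros\<close>)
  then show ?thesis using assms by (simp add: add const)
qed

lemma split: 
  assumes "bounded_fun S f"
  shows "m f = m (\<lambda>x. of_real (Re (f x))) + \<i> * m (\<lambda>x. of_real (Im (f x)))"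
proof -
  have "m f = m (\<lambda>x. of_real (Re (f x)) + \<i> * of_real (Im (f x)))"
    by (simp flip: complex_eq)
  then show ?thesis using assms by (simp add: add cmult bounded_fun_intros)
qed

lemma Re_m: "bounded_fun S f \<Longrightarrow> Re (m f) = Re (m (\<lambda>x. of_real (Re (f x))))"
  by (subst split) (simp_all add: real bounded_fun_intros)

lemma mono:
  assumes "bounded_fun S f" "bounded_fun S g" "\<And>x. x \<in> S \<Longrightarrow> Re (f x) \<le> Re (g x)"
  shows "Re (m f) \<le> Re (m g)"
proof -
  have "0 \<le> Re (m (\<lambda>x. of_real (Re (g x)) - of_real (Re (f x))))"
    by (rule nonneg) (use assms in \<open>auto intro: bounded_fun_intros\<close>)
  then show ?thesis
    using assms by (simp add: Re_m[of f] Re_m[of g] diff bounded_fun_intros)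
qed

lemma norm_le:
  assumes "\<And>x. x \<in> S \<Longrightarrow> cmod (f x) \<le> b"
  shows "cmod (m f) \<le> b"
proof (cases "m f = 0")
  case True
  have "0 \<le> b"
  proof (cases "S = {}")
    \<comment> \<open>There is no mean on the empty set: monotonicity would give
      \<open>1 \<le> 0\<close>.\<close>
    case True
    then have "Re (m (\<lambda>x. 1)) \<le> Re (m (\<lambda>x. 0))" by (intro mono) auto
    then show ?thesis by (simp add: const)
  qed (use assms norm_ge_zero order_trans in blast)
  then show ?thesis using True by simp
next
  case False
  \<comment> \<open>A unimodular factor rotates \<open>m f\<close> onto the positive real axis, so
    that monotonicity for real parts bounds its modulus.\<close>
  define c where "c = cnj (m f) / cmod (m f)"
  have bf: "bounded_fun S f" using assms by (rule bounded_funI)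
  have c: "cmod c = 1" using False by (simp add: c_def norm_divide)
  have "c * m f = of_real (cmod (m f))"
    using False by (simp add: c_def complex_norm_square[symmetric] power2_eq_square mult.commute)
  then have "cmod (m f) = Re (m (\<lambda>x. c * f x))" using bf by (simp add: cmult)
  also have "\<dots> \<le> Re (m (\<lambda>x. of_real b))"
  proof (rule mono)
    fix x assume "x \<in> S"
    have "Re (c * f x) \<le> cmod (c * f x)" by (rule complex_Re_le_cmod)
    also have "\<dots> \<le> b" using assms[OF \<open>x \<in> S\<close>] c by (simp add: norm_mult)
    finally show "Re (c * f x) \<le> Re (of_real b)" by simp
  qed (use bf in \<open>auto intro: bounded_fun_intros\<close>)
  finally show ?thesis by (simp add: const)
qed

text \<open>The difference is bounded by \<open>0\<close> on \<open>S\<close>, so its mean vanishes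
  by \<open>norm_le\<close>. This allows group identities, which hold on the carrier only, to be
  used under a mean of total functions.\<close>

lemma cong:
  assumes "bounded_fun S f" "\<And>x. x \<in> S \<Longrightarrow> f x = g x"
  shows "m f = m g"
proof -
  have "bounded_fun S g" using assms by (auto simp: bounded_fun_def)
  then have "m (\<lambda>x. f x - g x) = m f - m g" using assms diff by simp
  moreover have "cmod (m (\<lambda>x. f x - g x)) \<le> 0" by (rule norm_le) (simp add: assms)
  ultimately show ?thesis by simp
qed

lemma cnj: 
  assumes "bounded_fun S f"
  shows "m (\<lambda>x. cnj (f x)) = cnj (m f)"
proof -
  have "m (\<lambda>x. cnj (f x)) = m (\<lambda>x. of_real (Re (f x)) - \<i> * of_real (Im (f x)))"
    by (rule arg_cong[of _ _ m]) (auto simp: complex_eq_iff)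
  also have "\<dots> = m (\<lambda>x. of_real (Re (f x))) - \<i> * m (\<lambda>x. of_real (Im (f x)))"
    using assms by (simp add: diff cmult bounded_fun_intros)
  also have "\<dots> = cnj (m f)"
    using assms by (subst (3) split) (simp_all add: complex_eq_iff real bounded_fun_intros)
  finally show ?thesis .
qed

end

text \<open>As in the Banach-Alaoglu theorem: by \<open>norm_le\<close> the coordinate at a bounded
  function lies in a fixed disc, and each clause of \<open>mean\<close> is a closed condition on
  finitely many coordinates.\<close>

lemma compact_means: "compact {m. mean S m}"
proof -
  define bd where "bd f = (SOME b. (\<forall>x\<in>S. cmod (f x) \<le> b))" for f :: "'a \<Rightarrow> complex"
  define K where "K f = (if bounded_fun S f then cball 0 (bd f) else {0::complex})" for f
  have "compact {m. \<forall>f. m f \<in> K f}" by (rule compact_box) (simp add: K_def)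
  moreover have "closed {m. mean S m}"
    unfolding mean_def
    by (intro closed_Collect_conj closed_Collect_all closed_Collect_imp open_Collect_const
        closed_Collect_eq closed_Collect_le continuous_on_product_coordinates continuous_on_const
        continuous_on_add continuous_on_mult continuous_on_Re continuous_on_Im)
  ultimately have "compact ({m. \<forall>f. m f \<in> K f} \<inter> {m. mean S m})" by (rule compact_Int_closed)
  moreover have "m f \<in> K f" if "mean S m" for m f
  proof -
    interpret mean_functional S m by unfold_locales fact
    show ?thesis
    proof (cases "bounded_fun S f")
      case True
      then have "\<forall>x\<in>S. cmod (f x) \<le> bd f" unfolding bd_def bounded_fun_def by (rule someI_ex)
      then show ?thesis using True by (auto simp: K_def intro: norm_le)
    next
      case False
      then show ?thesis using mean unfolding mean_def K_def by simp
    qed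
  qed
  then have "{m. \<forall>f. m f \<in> K f} \<inter> {m. mean S m} = {m. mean S m}" by blast
  ultimately show ?thesis by (simp only:)
qed

text \<open>The value \<open>0\<close> at unbounded functions is prescribed by the last clause of
  \<open>mean\<close>.\<close>

definition uniform_mean :: "'a set \<Rightarrow> 'a set \<Rightarrow> ('a \<Rightarrow> complex) \<Rightarrow> complex"
  where "uniform_mean S A f = (if bounded_fun S f then (\<Sum>a\<in>A. f a) / of_nat (card A) else 0)"

lemma mean_uniform:
  assumes "finite A" "A \<noteq> {}" "A \<subseteq> S"
  shows "mean S (uniform_mean S A)"
proof -
  have "0 < card A" using assms by (simp add: card_gt_0_iff)
  then show ?thesis
    unfolding mean_def uniform_mean_def using assms
    by (auto simp: bounded_fun_intros sum.distrib add_divide_distrib sum_distrib_left subset_iff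
        Re_divide_of_nat Im_divide_of_nat intro!: divide_nonneg_nonneg sum_nonneg)
qed

section \<open>Totally bounded groups and uniformly continuous functions\<close>

locale totally_bounded_group = topological_group G T for G (structure) and T +
  assumes totally_bounded: "\<lbrakk>openin T U; \<one> \<in> U\<rbrakk> \<Longrightarrow>
    \<exists>A. finite A \<and> A \<subseteq> carrier G \<and> (\<forall>x\<in>carrier G. \<exists>a\<in>A. inv a \<otimes> x \<in> U)"
begin

lemma openin_subset_carrier: "openin T U \<Longrightarrow> U \<subseteq> carrier G"
  using openin_subset topspace_eq_carrier by blast

lemma open_inv:
  assumes "openin T U"
  shows "openin T {x \<in> carrier G. inv x \<in> U}"
  using openin_continuous_map_preimage[OF continuous_inv assms] by (simp add: topspace_eq_carrier)

text \<open>Inversion turns left into right translates: total boundedness is applied to the inverse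
  of \<open>U\<close> and to the point \<open>inv x\<close>.\<close>

lemma totally_bounded_right:
  assumes "openin T U" "\<one> \<in> U"
  shows "\<exists>A. finite A \<and> A \<subseteq> carrier G \<and> (\<forall>x\<in>carrier G. \<exists>a\<in>A. x \<otimes> a \<in> U)"
proof -
  obtain A where A: "finite A" "A \<subseteq> carrier G"
    "\<And>x. x \<in> carrier G \<Longrightarrow> \<exists>a\<in>A. inv a \<otimes> x \<in> {x \<in> carrier G. inv x \<in> U}"
    using totally_bounded[OF open_inv[OF assms(1)]] assms by auto
  have "\<exists>a\<in>A. x \<otimes> a \<in> U" if "x \<in> carrier G" for x
    using A(3)[of "inv x"] A(2) that by (auto simp: inv_mult_group subset_iff)
  then show ?thesis using A by blast
qed

lemma open_translate:
  assumes "openin T U" "a \<in> carrier G" "b \<in> carrier G"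
  shows "openin T {x \<in> carrier G. a \<otimes> x \<otimes> b \<in> U}"
proof -
  have 1: "continuous_map T T (\<lambda>x. c \<otimes> x)" if "c \<in> carrier G" for c
    using continuous_map_compose[of T "prod_topology T T" "\<lambda>x. (c, x)" T, OF _ continuous_mult] that
    by (simp add: o_def continuous_map_pairedI topspace_eq_carrier)
  have 2: "continuous_map T T (\<lambda>x. x \<otimes> c)" if "c \<in> carrier G" for c
    using continuous_map_compose[of T "prod_topology T T" "\<lambda>x. (x, c)" T, OF _ continuous_mult] that
    by (simp add: o_def continuous_map_pairedI topspace_eq_carrier)
  have "continuous_map T T (\<lambda>x. a \<otimes> x \<otimes> b)"
    using continuous_map_compose[OF 1 2] assms by (simp add: o_def)
  then show ?thesis
    using openin_continuous_map_preimage[OF _ assms(1)] by (fastforce simp: topspace_eq_carrier)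
qed

text \<open>Uniform continuity is required to hold uniformly for all two-sided translates of the function,
  so that averages of translates keep the modulus of continuity.\<close>

definition ucont :: "('a \<Rightarrow> complex) \<Rightarrow> bool"
  where "ucont f \<longleftrightarrow> bounded_fun (carrier G) f \<and>
    (\<forall>\<epsilon>>0. \<exists>U. openin T U \<and> \<one> \<in> U \<and>
      (\<forall>x\<in>carrier G. \<forall>u\<in>U. \<forall>y\<in>carrier G. cmod (f (x \<otimes> u \<otimes> y) - f (x \<otimes> y)) \<le> \<epsilon>))"

text \<open>Total boundedness reduces the arbitrary right factor \<open>y\<close> to finitely many.
  Writing \<open>y = a \<otimes> v\<close> with \<open>a\<close> from a finite set and
  \<open>v \<in> U\<close>, one has \<open>x \<otimes> u \<otimes> y = x \<otimes> a \<otimes> (inv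
  a \<otimes> u \<otimes> a) \<otimes> v\<close>, so it is enough that finitely many conjugates of
  \<open>u\<close> lie in \<open>U\<close>. The path uses three comparisons, whence
  \<open>\<epsilon> / 3\<close>.\<close>

lemma ucontI:
  assumes "bounded_fun (carrier G) f"
    and "\<And>\<epsilon>. \<epsilon> > 0 \<Longrightarrow> \<exists>U. openin T U \<and> \<one> \<in> U \<and>
      (\<forall>x\<in>carrier G. \<forall>u\<in>U. cmod (f (x \<otimes> u) - f x) \<le> \<epsilon>)"
  shows "ucont f"
  unfolding ucont_def
proof (intro conjI allI impI)
  fix \<epsilon> :: real assume "\<epsilon> > 0"
  then obtain U where U: "openin T U" "\<one> \<in> U"
    "\<And>x u. x \<in> carrier G \<Longrightarrow> u \<in> U \<Longrightarrow> cmod (f (x \<otimes> u) - f x) \<le> \<epsilon> / 3"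
    using assms(2)[of "\<epsilon> / 3"] by auto
  obtain A where A: "finite A" "A \<subseteq> carrier G" "\<And>x. x \<in> carrier G \<Longrightarrow> \<exists>a\<in>A. inv a \<otimes> x \<in> U"
    using totally_bounded[OF U(1,2)] by auto
  define W where "W = (\<Inter>a\<in>A. {x \<in> carrier G. inv a \<otimes> x \<otimes> a \<in> U}) \<inter> carrier G"
  have "openin T W"
  proof (cases "A = {}")
    case True then show ?thesis by (simp add: W_def flip: topspace_eq_carrier)
  next
    case False
    have "openin T (carrier G)" by (simp flip: topspace_eq_carrier)
    then show ?thesis unfolding W_def
      using A U False by (intro openin_Int openin_INT2 open_translate) auto
  qed
  moreover have "\<one> \<in> W" using A(2) U(2) by (auto simp: W_def subset_iff)
  moreover have "cmod (f (x \<otimes> u \<otimes> y) - f (x \<otimes> y)) \<le> \<epsilon>"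
    if x: "x \<in> carrier G" and u: "u \<in> W" and y: "y \<in> carrier G" for x u y
  proof -
    obtain a where a: "a \<in> A" "inv a \<otimes> y \<in> U" using A(3)[OF y] by blast
    define v where "v = inv a \<otimes> y"
    define w where "w = inv a \<otimes> u \<otimes> a"
    have cl: "a \<in> carrier G" "v \<in> carrier G" "u \<in> carrier G" "w \<in> carrier G"
      using a A(2) y u by (auto simp: v_def w_def W_def)
    have uv: "v \<in> U" "w \<in> U" using a u by (auto simp: v_def w_def W_def)
    have y_eq: "y = a \<otimes> v" using cl y by (simp add: v_def m_assoc[symmetric])
    have "x \<otimes> u \<otimes> y = ((x \<otimes> a) \<otimes> w) \<otimes> v"
    proof -
      have "a \<otimes> w = u \<otimes> a" using cl by (simp add: w_def m_assoc[symmetric])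
      then show ?thesis using cl x y_eq by (metis m_assoc m_closed)
    qed
    moreover have "x \<otimes> y = (x \<otimes> a) \<otimes> v" using cl x y_eq by (simp add: m_assoc)
    moreover have "cmod (f (x \<otimes> a \<otimes> w \<otimes> v) - f (x \<otimes> a \<otimes> w)) \<le> \<epsilon> / 3"
      "cmod (f (x \<otimes> a \<otimes> w) - f (x \<otimes> a)) \<le> \<epsilon> / 3" "cmod (f (x \<otimes> a \<otimes> v) - f (x \<otimes> a)) \<le> \<epsilon> / 3"
      using U(3) uv cl x by auto
    moreover have "cmod (f (x \<otimes> a \<otimes> w \<otimes> v) - f (x \<otimes> a \<otimes> v)) \<le>
        cmod (f (x \<otimes> a \<otimes> w \<otimes> v) - f (x \<otimes> a \<otimes> w)) + cmod (f (x \<otimes> a \<otimes> w) - f (x \<otimes> a)) +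
        cmod (f (x \<otimes> a \<otimes> v) - f (x \<otimes> a))"
      using norm_triangle_ineq[of "f (x \<otimes> a \<otimes> w \<otimes> v) - f (x \<otimes> a \<otimes> w)" "f (x \<otimes> a \<otimes> w) - f (x \<otimes> a)"]
        norm_triangle_ineq4[of "f (x \<otimes> a \<otimes> w \<otimes> v) - f (x \<otimes> a)" "f (x \<otimes> a \<otimes> v) - f (x \<otimes> a)"]
      by simp
    ultimately show ?thesis by simp
  qed
  ultimately show "\<exists>U. openin T U \<and> \<one> \<in> U \<and> (\<forall>x\<in>carrier G. \<forall>u\<in>U. \<forall>y\<in>carrier G.
      cmod (f (x \<otimes> u \<otimes> y) - f (x \<otimes> y)) \<le> \<epsilon>)" by blast
qed fact

lemma ucont_bounded: "ucont f \<Longrightarrow> bounded_fun (carrier G) f"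
  by (simp add: ucont_def)

lemma ucontE:
  assumes "ucont f" "\<epsilon> > 0"
  obtains U where "openin T U" "\<one> \<in> U" 
    "\<And>x u y. x \<in> carrier G \<Longrightarrow> u \<in> U \<Longrightarrow> y \<in> carrier G \<Longrightarrow> cmod (f (x \<otimes> u \<otimes> y) - f (x \<otimes> y)) \<le> \<epsilon>"
proof -
  obtain U where "openin T U \<and> \<one> \<in> U \<and>
      (\<forall>x\<in>carrier G. \<forall>u\<in>U. \<forall>y\<in>carrier G. cmod (f (x \<otimes> u \<otimes> y) - f (x \<otimes> y)) \<le> \<epsilon>)"
    using assms unfolding ucont_def by metis
  then show ?thesis using that[of U] by metis
qed

lemma ucontE1:
  assumes "ucont f" "\<epsilon> > 0"
  obtains U where "openin T U" "\<one> \<in> U" 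
    "\<And>x u. x \<in> carrier G \<Longrightarrow> u \<in> U \<Longrightarrow> cmod (f (x \<otimes> u) - f x) \<le> \<epsilon>"
proof -
  obtain U where U: "openin T U" "\<one> \<in> U" 
    "\<And>x u y. x \<in> carrier G \<Longrightarrow> u \<in> U \<Longrightarrow> y \<in> carrier G \<Longrightarrow> cmod (f (x \<otimes> u \<otimes> y) - f (x \<otimes> y)) \<le> \<epsilon>"
    using ucontE[OF assms] by blast
  then have "cmod (f (x \<otimes> u) - f x) \<le> \<epsilon>" if "x \<in> carrier G" "u \<in> U" for x u
  proof -
    have "u \<in> carrier G" using that openin_subset_carrier[OF U(1)] by blast
    then show ?thesis using that U(3)[of x u \<one>] by simp
  qed
  then show ?thesis using that U by blast
qed

lemma ucont_const: "ucont (\<lambda>x. c)"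
  using openin_topspace[of T] by (intro ucontI) (auto simp: topspace_eq_carrier)

text \<open>Serves conjugation and the real and imaginary parts at once; \<open>h 0 = 0\<close>
  keeps the composition bounded.\<close>

lemma ucont_contraction:
  assumes f: "ucont f" and h: "\<And>z w. cmod (h z - h w) \<le> cmod (z - w)" "h 0 = 0"
  shows "ucont (\<lambda>x. h (f x))"
  unfolding ucont_def
proof (intro conjI allI impI)
  have "cmod (h z) \<le> cmod z" for z using h(1)[of z 0] h(2) by simp
  then show "bounded_fun (carrier G) (\<lambda>x. h (f x))"
    using ucont_bounded[OF f] unfolding bounded_fun_def by (meson order_trans)
  fix \<epsilon> :: real assume "\<epsilon> > 0"
  then obtain U where "openin T U" "\<one> \<in> U" 
    "\<And>x u y. x \<in> carrier G \<Longrightarrow> u \<in> U \<Longrightarrow> y \<in> carrier G \<Longrightarrow> cmod (f (x \<otimes> u \<otimes> y) - f (x \<otimes> y)) \<le> \<epsilon>"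
    using ucontE[OF f] by blast
  then show "\<exists>U. openin T U \<and> \<one> \<in> U \<and> (\<forall>x\<in>carrier G. \<forall>u\<in>U. \<forall>y\<in>carrier G.
      cmod (h (f (x \<otimes> u \<otimes> y)) - h (f (x \<otimes> y))) \<le> \<epsilon>)"
    by (intro exI[of _ U]) (use h(1) order_trans in blast)
qed

lemma ucont_cnj: "ucont f \<Longrightarrow> ucont (\<lambda>x. cnj (f x))"
  by (erule ucont_contraction) (simp_all only: complex_mod_cnj complex_cnj_zero order_refl
      flip: complex_cnj_diff)

lemma ucont_Re: "ucont f \<Longrightarrow> ucont (\<lambda>x. of_real (Re (f x)))"
  by (erule ucont_contraction) (simp_all only: norm_of_real abs_Re_le_cmod complex.sel zero_complex.sel
      of_real_0 flip: of_real_diff minus_complex.sel)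

lemma ucont_Im: "ucont f \<Longrightarrow> ucont (\<lambda>x. of_real (Im (f x)))"
  by (erule ucont_contraction) (simp_all only: norm_of_real abs_Im_le_cmod complex.sel zero_complex.sel
      of_real_0 flip: of_real_diff minus_complex.sel)

lemma ucont_add:
  assumes "ucont f" "ucont g"
  shows "ucont (\<lambda>x. f x + g x)"
proof (rule ucontI)
  fix \<epsilon> :: real assume "\<epsilon> > 0"
  then obtain U V where U: "openin T U" "\<one> \<in> U"
      "\<And>x u. x \<in> carrier G \<Longrightarrow> u \<in> U \<Longrightarrow> cmod (f (x \<otimes> u) - f x) \<le> \<epsilon> / 2"
    and V: "openin T V" "\<one> \<in> V"
      "\<And>x u. x \<in> carrier G \<Longrightarrow> u \<in> V \<Longrightarrow> cmod (g (x \<otimes> u) - g x) \<le> \<epsilon> / 2"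
    using ucontE1[OF assms(1), of "\<epsilon> / 2"] ucontE1[OF assms(2), of "\<epsilon> / 2"] by (metis half_gt_zero)
  have "cmod (f (x \<otimes> u) + g (x \<otimes> u) - (f x + g x)) \<le> \<epsilon>" if "x \<in> carrier G" "u \<in> U \<inter> V" for x u
    using U(3)[of x u] V(3)[of x u] that
      norm_triangle_ineq[of "f (x \<otimes> u) - f x" "g (x \<otimes> u) - g x"] by (simp add: algebra_simps)
  then show "\<exists>U. openin T U \<and> \<one> \<in> U \<and>
      (\<forall>x\<in>carrier G. \<forall>u\<in>U. cmod (f (x \<otimes> u) + g (x \<otimes> u) - (f x + g x)) \<le> \<epsilon>)"
    using U V by (intro exI[of _ "U \<inter> V"]) auto
qed (use assms in \<open>auto intro: bounded_fun_intros ucont_bounded\<close>)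

lemma ucont_mult:
  assumes "ucont f" "ucont g"
  shows "ucont (\<lambda>x. f x * g x)"
proof (rule ucontI)
  obtain a b where ab: "a > 0" "b > 0" "\<And>x. x \<in> carrier G \<Longrightarrow> cmod (f x) \<le> a"
      "\<And>x. x \<in> carrier G \<Longrightarrow> cmod (g x) \<le> b"
    using bounded_funE[OF ucont_bounded[OF assms(1)]] bounded_funE[OF ucont_bounded[OF assms(2)]]
    by metis
  fix \<epsilon> :: real assume \<epsilon>: "\<epsilon> > 0"
  obtain U where U: "openin T U" "\<one> \<in> U"
      "\<And>x u. x \<in> carrier G \<Longrightarrow> u \<in> U \<Longrightarrow> cmod (f (x \<otimes> u) - f x) \<le> \<epsilon> / (2 * b)"
    using ucontE1[OF assms(1), of "\<epsilon> / (2 * b)"] \<epsilon> ab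
      by (metis divide_pos_pos mult_pos_pos zero_less_numeral)
  obtain V where V: "openin T V" "\<one> \<in> V"
      "\<And>x u. x \<in> carrier G \<Longrightarrow> u \<in> V \<Longrightarrow> cmod (g (x \<otimes> u) - g x) \<le> \<epsilon> / (2 * a)"
    using ucontE1[OF assms(2), of "\<epsilon> / (2 * a)"] \<epsilon> ab
      by (metis divide_pos_pos mult_pos_pos zero_less_numeral)
  have "cmod (f (x \<otimes> u) * g (x \<otimes> u) - f x * g x) \<le> \<epsilon>" if x: "x \<in> carrier G"
    and u: "u \<in> U \<inter> V" for x u
  proof -
    have xu: "x \<otimes> u \<in> carrier G" using x u openin_subset_carrier[OF U(1)] by auto
    have "f (x \<otimes> u) * g (x \<otimes> u) - f x * g x =
        (f (x \<otimes> u) - f x) * g (x \<otimes> u) + f x * (g (x \<otimes> u) - g x)" by (simp add: algebra_simps)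
    also have "cmod \<dots> \<le> cmod (f (x \<otimes> u) - f x) * cmod (g (x \<otimes> u)) + cmod (f x) * cmod (g (x \<otimes> u) - g x)"
      by (metis norm_mult norm_triangle_ineq)
    also have "\<dots> \<le> (\<epsilon> / (2 * b)) * b + a * (\<epsilon> / (2 * a))"
      using U(3)[of x u] V(3)[of x u] ab(3)[OF x] ab(4)[OF xu] x u ab(1,2) \<epsilon>
      by (intro add_mono mult_mono) auto
    also have "\<dots> = \<epsilon>" using ab(1,2) by simp
    finally show ?thesis .
  qed
  then show "\<exists>U. openin T U \<and> \<one> \<in> U \<and>
      (\<forall>x\<in>carrier G. \<forall>u\<in>U. cmod (f (x \<otimes> u) * g (x \<otimes> u) - f x * g x) \<le> \<epsilon>)"
    using U V by (intro exI[of _ "U \<inter> V"]) auto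
qed (use assms in \<open>auto intro: bounded_fun_intros ucont_bounded\<close>)


section \<open>Averages of right translates and the invariant mean\<close>

lemma bounded_fun_comp:
  "bounded_fun S f \<Longrightarrow> (\<And>a. a \<in> S \<Longrightarrow> g a \<in> S) \<Longrightarrow> bounded_fun S (\<lambda>a. f (g a))"
  by (auto simp: bounded_fun_def)

lemma bounded_fun_left_translate:
  "bounded_fun (carrier G) f \<Longrightarrow> x \<in> carrier G \<Longrightarrow> bounded_fun (carrier G) (\<lambda>a. f (x \<otimes> a))"
  by (erule bounded_fun_comp) simp

lemma ucont_left_translate:
  assumes f: "ucont f" and c: "c \<in> carrier G"
  shows "ucont (\<lambda>x. f (c \<otimes> x))"
proof (rule ucontI)
  show "bounded_fun (carrier G) (\<lambda>x. f (c \<otimes> x))"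
    by (rule bounded_fun_left_translate[OF ucont_bounded[OF f] c])
  fix \<epsilon> :: real assume "\<epsilon> > 0"
  then obtain U where U: "openin T U" "\<one> \<in> U" 
    "\<And>x u. x \<in> carrier G \<Longrightarrow> u \<in> U \<Longrightarrow> cmod (f (x \<otimes> u) - f x) \<le> \<epsilon>"
    using ucontE1[OF f] by blast
  have "cmod (f (c \<otimes> (x \<otimes> u)) - f (c \<otimes> x)) \<le> \<epsilon>" if "x \<in> carrier G" "u \<in> U" for x u
    using U(3)[of "c \<otimes> x" u] that c openin_subset_carrier[OF U(1)]
    by (auto simp: m_assoc subset_iff)
  then show "\<exists>U. openin T U \<and> \<one> \<in> U \<and>
      (\<forall>x\<in>carrier G. \<forall>u\<in>U. cmod (f (c \<otimes> (x \<otimes> u)) - f (c \<otimes> x)) \<le> \<epsilon>)"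
    using U by blast
qed

text \<open>Convolution of \<open>f\<close> with a finitely additive measure. For
  \<open>uniform_mean (carrier G) A\<close> it is the average of the right translates of
  \<open>f\<close> by the elements of \<open>A\<close>.\<close>

definition smear :: "(('a \<Rightarrow> complex) \<Rightarrow> complex) \<Rightarrow> ('a \<Rightarrow> complex) \<Rightarrow> 'a \<Rightarrow> complex"
  where "smear m f x = m (\<lambda>a. f (x \<otimes> a))"

lemma smear_norm_le:
  assumes "mean (carrier G) m" "\<And>x. x \<in> carrier G \<Longrightarrow> cmod (f x) \<le> b" "x \<in> carrier G"
  shows "cmod (smear m f x) \<le> b"
proof -
  interpret m: mean_functional "carrier G" m by unfold_locales fact
  show ?thesis unfolding smear_def by (rule m.norm_le) (use assms in auto)
qed

lemma smear_bounded:
  "mean (carrier G) m \<Longrightarrow> bounded_fun (carrier G) f \<Longrightarrow> bounded_fun (carrier G) (smear m f)"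
proof -
  assume m: "mean (carrier G) m" and f: "bounded_fun (carrier G) f"
  obtain b where "\<And>x. x \<in> carrier G \<Longrightarrow> cmod (f x) \<le> b" using bounded_funE[OF f] by blast
  then show ?thesis by (intro bounded_funI[of _ _ b] smear_norm_le[OF m])
qed

text \<open>The averaging variable is absorbed into the right factor \<open>y \<otimes> a\<close>.
  Since the assumed bound is uniform in that factor, the same \<open>\<epsilon>\<close> survives any
  number of averagings.\<close>

lemma smear_modulus:
  assumes m: "mean (carrier G) m" and f: "bounded_fun (carrier G) f"
    and le: "\<And>y. y \<in> carrier G \<Longrightarrow> cmod (f (z \<otimes> y) - f (x \<otimes> y)) \<le> \<epsilon>"
    and x: "x \<in> carrier G" "z \<in> carrier G" "y \<in> carrier G"
  shows "cmod (smear m f (z \<otimes> y) - smear m f (x \<otimes> y)) \<le> \<epsilon>"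
proof -
  interpret m: mean_functional "carrier G" m by unfold_locales fact
  have b: "bounded_fun (carrier G) (\<lambda>a. f (w \<otimes> y \<otimes> a))" if "w \<in> carrier G" for w
    by (rule bounded_fun_comp[OF f]) (use that x in simp)
  have "smear m f (z \<otimes> y) - smear m f (x \<otimes> y) =
      m (\<lambda>a. f (z \<otimes> y \<otimes> a) - f (x \<otimes> y \<otimes> a))"
    unfolding smear_def using m.diff[OF b b] x by simp
  moreover have "cmod \<dots> \<le> \<epsilon>"
    by (rule m.norm_le) (use le x in \<open>simp add: m_assoc\<close>)
  ultimately show ?thesis by simp
qed

lemma ucont_smear:
  assumes m: "mean (carrier G) m" and f: "ucont f"
  shows "ucont (smear m f)"
  unfolding ucont_def
proof (intro conjI allI impI)
  show "bounded_fun (carrier G) (smear m f)" using assms by (simp add: smear_bounded ucont_bounded)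
  fix \<epsilon> :: real assume "\<epsilon> > 0"
  then obtain U where U: "openin T U" "\<one> \<in> U" 
    "\<And>x u y. x \<in> carrier G \<Longrightarrow> u \<in> U \<Longrightarrow> y \<in> carrier G \<Longrightarrow> cmod (f (x \<otimes> u \<otimes> y) - f (x \<otimes> y)) \<le> \<epsilon>"
    using ucontE[OF f] by blast
  have "cmod (smear m f (x \<otimes> u \<otimes> y) - smear m f (x \<otimes> y)) \<le> \<epsilon>"
    if "x \<in> carrier G" "u \<in> U" "y \<in> carrier G" for x u y
    using that openin_subset_carrier[OF U(1)]
    by (intro smear_modulus[OF m ucont_bounded[OF f]]) (auto intro: U(3))
  then show "\<exists>U. openin T U \<and> \<one> \<in> U \<and> (\<forall>x\<in>carrier G. \<forall>u\<in>U. \<forall>y\<in>carrier G.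
      cmod (smear m f (x \<otimes> u \<otimes> y) - smear m f (x \<otimes> y)) \<le> \<epsilon>)" using U by blast
qed

lemma smear_real:
  assumes "mean (carrier G) m" "bounded_fun (carrier G) f" "\<And>x. x \<in> carrier G \<Longrightarrow> Im (f x) = 0"
    "x \<in> carrier G"
  shows "Im (smear m f x) = 0"
proof -
  interpret m: mean_functional "carrier G" m by unfold_locales fact
  show ?thesis unfolding smear_def
    by (rule m.real[OF bounded_fun_left_translate[OF assms(2,4)]]) (use assms in auto)
qed

text \<open>Convolution of measures, ordered so that averaging by \<open>n\<close> and then by
  \<open>m\<close> is one averaging by \<open>convolve m n\<close>. The guard gives the value that
  \<open>mean\<close> prescribes for unbounded functions.\<close>

definition convolve :: "(('a \<Rightarrow> complex) \<Rightarrow> complex) \<Rightarrow> (('a \<Rightarrow> complex) \<Rightarrow> complex) \<Rightarrow>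
    ('a \<Rightarrow> complex) \<Rightarrow> complex"
  where "convolve m n f = (if bounded_fun (carrier G) f then m (smear n f) else 0)"

lemma mean_convolve:
  assumes m: "mean (carrier G) m" and n: "mean (carrier G) n"
  shows "mean (carrier G) (convolve m n)"
proof -
  interpret m: mean_functional "carrier G" m by unfold_locales fact
  interpret n: mean_functional "carrier G" n by unfold_locales fact
  have s: "m (smear n f) = m (\<lambda>x. h x)"
    if "bounded_fun (carrier G) f" "\<And>x. x \<in> carrier G \<Longrightarrow> smear n f x = h x" for f h
    by (rule m.cong[OF smear_bounded[OF n that(1)] that(2)])
  show ?thesis
    unfolding mean_def
  proof (intro conjI allI impI)
    fix f g assume f: "bounded_fun (carrier G) f" and g: "bounded_fun (carrier G) g"
    have "m (smear n (\<lambda>x. f x + g x)) = m (\<lambda>x. smear n f x + smear n g x)"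
      by (rule s[OF bounded_fun_add[OF f g]], unfold smear_def)
        (rule n.add; intro bounded_fun_left_translate[OF f] bounded_fun_left_translate[OF g])
    then show "convolve m n (\<lambda>x. f x + g x) = convolve m n f + convolve m n g"
      using f g n by (simp add: convolve_def bounded_fun_add m.add smear_bounded)
  next
    fix c f assume f: "bounded_fun (carrier G) f"
    have "m (smear n (\<lambda>x. c * f x)) = m (\<lambda>x. c * smear n f x)"
      by (rule s[OF bounded_fun_mult[OF bounded_fun_const f]], unfold smear_def)
        (rule n.cmult[OF bounded_fun_left_translate[OF f]])
    then show "convolve m n (\<lambda>x. c * f x) = c * convolve m n f"
      using f n by (simp add: convolve_def bounded_fun_mult m.cmult smear_bounded)
  next
    fix f assume f: "bounded_fun (carrier G) f" "\<forall>x\<in>carrier G. 0 \<le> Re (f x) \<and> Im (f x) = 0"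
    have "0 \<le> Re (smear n f x)" "Im (smear n f x) = 0" if "x \<in> carrier G" for x
      unfolding smear_def using f(2) that
      by (auto intro!: n.nonneg bounded_fun_left_translate[OF f(1)])
    then show "0 \<le> Re (convolve m n f)" "Im (convolve m n f) = 0"
      using f n by (auto simp: convolve_def smear_bounded intro!: m.nonneg)
  next
    have "smear n (\<lambda>x. 1) = (\<lambda>x. 1)" by (simp add: smear_def n.const fun_eq_iff)
    then show "convolve m n (\<lambda>x. 1) = 1" by (simp add: convolve_def m.const)
  next
    fix f assume "\<not> bounded_fun (carrier G) f"
    then show "convolve m n f = 0" by (simp only: convolve_def if_False)
  qed
qed

lemma smear_convolve:
  assumes m: "mean (carrier G) m" and n: "mean (carrier G) n" and f: "bounded_fun (carrier G) f"
    and x: "x \<in> carrier G"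
  shows "smear (convolve m n) f x = smear m (smear n f) x"
proof -
  interpret m: mean_functional "carrier G" m by unfold_locales fact
  interpret n: mean_functional "carrier G" n by unfold_locales fact
  have "m (smear n (\<lambda>a. f (x \<otimes> a))) = m (\<lambda>a. smear n f (x \<otimes> a))"
  proof (rule m.cong)
    show "bounded_fun (carrier G) (smear n (\<lambda>a. f (x \<otimes> a)))"
      by (rule smear_bounded[OF n bounded_fun_left_translate[OF f x]])
    fix y assume y: "y \<in> carrier G"
    have "bounded_fun (carrier G) (\<lambda>a. f (x \<otimes> (y \<otimes> a)))"
      using bounded_fun_left_translate[OF bounded_fun_left_translate[OF f x] y] .
    then show "smear n (\<lambda>a. f (x \<otimes> a)) y = smear n f (x \<otimes> y)"
      unfolding smear_def by (rule n.cong) (use x y in \<open>simp add: m_assoc\<close>)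
  qed
  then show ?thesis using f x
    by (simp add: smear_def[of "convolve m n"] convolve_def bounded_fun_left_translate[OF f] smear_def[of m])
qed

text \<open>If \<open>f\<close> is below the midpoint of its range at \<open>x\<^sub>0\<close>, then averaging the right
  translates of \<open>f\<close> by \<open>b \<otimes> x\<^sub>0\<close>, for \<open>b\<close> in a finite set such that every \<open>x \<otimes> b\<close> can be
  made close to \<open>\<one>\<close>, lowers the maximum by a fixed proportion of the range.\<close>

lemma range_reduction:
  assumes f: "bounded_fun (carrier G) f" "\<And>x. x \<in> carrier G \<Longrightarrow> Im (f x) = 0"
    and U: "\<And>x u y. x \<in> carrier G \<Longrightarrow> u \<in> U \<Longrightarrow> y \<in> carrier G \<Longrightarrow> cmod (f (x \<otimes> u \<otimes> y) - f (x \<otimes> y)) \<le> \<epsilon>"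
      "U \<subseteq> carrier G"
    and B: "finite B" "B \<subseteq> carrier G" "\<And>x. x \<in> carrier G \<Longrightarrow> \<exists>b\<in>B. x \<otimes> b \<in> U"
    and range: "\<And>x. x \<in> carrier G \<Longrightarrow> lo \<le> Re (f x) \<and> Re (f x) \<le> hi"
    and large: "hi - lo > 4 * \<epsilon>"
    and r: "r = 1 - 1 / (4 * real (card B))"
  shows "\<exists>m lo' hi'. mean (carrier G) m \<and> hi' - lo' \<le> r * (hi - lo) \<and>
    (\<forall>x\<in>carrier G. lo' \<le> Re (smear m f x) \<and> Re (smear m f x) \<le> hi')"
proof -
  have "B \<noteq> {}" using B(3)[of \<one>] by auto
  then have N: "card B \<ge> 1" using B(1) by (simp add: Suc_leI card_gt_0_iff)
  define D where "D = hi - lo"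
  have "0 \<le> hi - lo" using range[of \<one>] by simp
  then have D: "D \<ge> 0" by (simp add: D_def)
  show ?thesis
  proof (cases "\<exists>x0\<in>carrier G. Re (f x0) \<le> (lo + hi) / 2")
    \<comment> \<open>If \<open>f\<close> stays above the midpoint, the lower bound rises by half
      the range, and the point mass at \<open>\<one>\<close> will do.\<close>
    case False
    have "uniform_mean (carrier G) {\<one>} f' = f' \<one>" if "bounded_fun (carrier G) f'" for f'
      using that by (simp add: uniform_mean_def)
    then have eq: "smear (uniform_mean (carrier G) {\<one>}) f x = f x" if "x \<in> carrier G" for x
      using that by (simp add: smear_def bounded_fun_left_translate[OF f(1)])
    have "real (card B) \<ge> 1" using N by simp
    then have "1 / (4 * real (card B)) \<le> 1 / 2" by (simp add: field_simps)
    then have "hi - (lo + hi) / 2 \<le> r * (hi - lo)"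
      using D mult_right_mono[of "1/2" r D] by (simp add: r D_def field_simps)
    then show ?thesis using False range eq mean_uniform[of "{\<one>}" "carrier G"]
      by (intro exI[of _ "uniform_mean (carrier G) {\<one>}"] exI[of _ "(lo + hi) / 2"] exI[of _ hi])
        (auto simp: not_le intro: less_imp_le)
  next
    case True
    then obtain x0 where x0: "x0 \<in> carrier G" "Re (f x0) \<le> (lo + hi) / 2" by blast
    define A where "A = (\<lambda>b. b \<otimes> x0) ` B"
    have inj: "inj_on (\<lambda>b. b \<otimes> x0) B" using B(2) x0 by (auto simp: inj_on_def subset_iff)
    have A: "finite A" "A \<noteq> {}" "A \<subseteq> carrier G" "card A = card B"
      using B \<open>B \<noteq> {}\<close> x0 inj by (auto simp: A_def card_image)
    let ?m = "uniform_mean (carrier G) A"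
    have eq: "Re (smear ?m f x) = (\<Sum>b\<in>B. Re (f (x \<otimes> (b \<otimes> x0)))) / real (card B)"
      if "x \<in> carrier G" for x
    proof -
      have "smear ?m f x = (\<Sum>a\<in>A. f (x \<otimes> a)) / of_nat (card A)"
        using that by (simp add: smear_def uniform_mean_def bounded_fun_left_translate[OF f(1)])
      then show ?thesis using inj A(4) by (simp add: Re_divide_of_nat A_def sum.reindex)
    qed
    have "lo \<le> Re (smear ?m f x) \<and> Re (smear ?m f x) \<le> lo + r * D" if x: "x \<in> carrier G" for x
    proof -
      have rg: "lo \<le> Re (f (x \<otimes> (b \<otimes> x0)))" "Re (f (x \<otimes> (b \<otimes> x0))) \<le> hi" if "b \<in> B" for b
        using range[of "x \<otimes> (b \<otimes> x0)"] that B(2) x x0(1) by auto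
      have low: "real (card B) * lo \<le> (\<Sum>b\<in>B. Re (f (x \<otimes> (b \<otimes> x0))))"
        using sum_bounded_below[of B lo "\<lambda>b. Re (f (x \<otimes> (b \<otimes> x0)))"] rg(1) by simp
      obtain b where b: "b \<in> B" "x \<otimes> b \<in> U" using B(3)[OF x] by blast
      \<comment> \<open>As \<open>x \<otimes> b\<close> is close to \<open>\<one>\<close>, the value
        at one of the averaged points is almost the value at \<open>x0\<close>.\<close>
      have "cmod (f (\<one> \<otimes> (x \<otimes> b) \<otimes> x0) - f (\<one> \<otimes> x0)) \<le> \<epsilon>" by (rule U(1)) (use b x0 in auto)
      then have "cmod (f (x \<otimes> (b \<otimes> x0)) - f x0) \<le> \<epsilon>"
        using b x x0 B(2) by (auto simp: m_assoc subset_iff)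
      then have "Re (f (x \<otimes> (b \<otimes> x0))) \<le> Re (f x0) + \<epsilon>"
        using abs_Re_le_cmod[of "f (x \<otimes> (b \<otimes> x0)) - f x0"] by simp
      \<comment> \<open>The midpoint is \<open>D / 2\<close> below \<open>hi\<close>, and
        \<open>\<epsilon> < D / 4\<close>.\<close>
      then have "Re (f (x \<otimes> (b \<otimes> x0))) \<le> hi - D / 4"
        using x0(2) large by (simp add: D_def field_simps)
      \<comment> \<open>One summand gains \<open>D / 4\<close> and no other exceeds
        \<open>hi\<close>; division by \<open>card B\<close> turns this gain into the factor
        \<open>r\<close>.\<close>
      then have "(\<Sum>b\<in>B. Re (f (x \<otimes> (b \<otimes> x0)))) \<le> (hi - D / 4) + (\<Sum>b\<in>B - {b}. hi)"
        using sum.remove[OF B(1) b(1), of "\<lambda>b. Re (f (x \<otimes> (b \<otimes> x0)))"] rg(2)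
          sum_mono[of "B - {b}" "\<lambda>b. Re (f (x \<otimes> (b \<otimes> x0)))" "\<lambda>_. hi"] by simp
      also have "\<dots> = real (card B) * hi - D / 4"
        using B(1) b(1) N by (simp add: card_Diff_singleton of_nat_diff algebra_simps)
      finally have "(\<Sum>b\<in>B. Re (f (x \<otimes> (b \<otimes> x0)))) / real (card B) \<le>
          (real (card B) * hi - D / 4) / real (card B)"
        by (rule divide_right_mono) simp
      also have "\<dots> = hi - D / (4 * card B)" using N by (simp add: field_simps)
      also have "hi - D / (4 * card B) = lo + r * D" using N by (simp add: r D_def field_simps)
      finally have "Re (smear ?m f x) \<le> lo + r * D" using eq[OF x] by simp
      moreover have "lo \<le> Re (smear ?m f x)"
        unfolding eq[OF x] using N low by (subst pos_le_divide_eq) (simp_all add: mult.commute)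
      ultimately show ?thesis by blast
    qed
    then show ?thesis using mean_uniform[OF A(1-3)]
      by (intro exI[of _ ?m] exI[of _ lo] exI[of _ "lo + r * D"]) (auto simp: D_def)
  qed
qed

text \<open>Iteration of \<open>range_reduction\<close>. The factor \<open>r\<close> depends only on
  \<open>U\<close> and \<open>B\<close>, hence on the modulus of continuity of \<open>f\<close>,
  which averaging preserves. So the same \<open>r\<close> applies in every round, and the range
  decays geometrically until the threshold \<open>4 * \<epsilon> = \<eta>\<close>.\<close>

lemma almost_constant_average:
  assumes f: "ucont f" "\<And>x. x \<in> carrier G \<Longrightarrow> Im (f x) = 0" and "\<eta> > 0"
  shows "\<exists>m c. mean (carrier G) m \<and> (\<forall>x\<in>carrier G. cmod (smear m f x - c) \<le> \<eta>)"
proof -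
  define \<epsilon> where "\<epsilon> = \<eta> / 4"
  then have "\<epsilon> > 0" using \<open>\<eta> > 0\<close> by simp
  then obtain U where U: "openin T U" "\<one> \<in> U" 
    "\<And>x u y. x \<in> carrier G \<Longrightarrow> u \<in> U \<Longrightarrow> y \<in> carrier G \<Longrightarrow> cmod (f (x \<otimes> u \<otimes> y) - f (x \<otimes> y)) \<le> \<epsilon>"
    using ucontE[OF f(1)] by blast
  obtain B where B: "finite B" "B \<subseteq> carrier G" "\<And>x. x \<in> carrier G \<Longrightarrow> \<exists>b\<in>B. x \<otimes> b \<in> U"
    using totally_bounded_right[OF U(1,2)] by auto
  define r where "r = 1 - 1 / (4 * real (card B))"
  have "B \<noteq> {}" using B(3)[of \<one>] by auto
  then have "card B \<ge> 1" using B(1) by (simp add: Suc_leI card_gt_0_iff)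
  then have r: "0 \<le> r" "r < 1" by (auto simp: r_def field_simps)
  obtain b where b: "b > 0" "\<And>x. x \<in> carrier G \<Longrightarrow> cmod (f x) \<le> b"
    using bounded_funE[OF ucont_bounded[OF f(1)]] by metis
  \<comment> \<open>The initial range is at most \<open>2 * b\<close>; the maximum records that the
    reduction stops once the range is at most \<open>4 * \<epsilon>\<close>.\<close>
  have *: "\<exists>m lo hi. mean (carrier G) m \<and> hi - lo \<le> max (4 * \<epsilon>) (r ^ k * (2 * b)) \<and>
      (\<forall>x\<in>carrier G. lo \<le> Re (smear m f x) \<and> Re (smear m f x) \<le> hi)" for k
  proof (induction k)
    case 0
    have "uniform_mean (carrier G) {\<one>} f' = f' \<one>" if "bounded_fun (carrier G) f'" for f'
      using that by (simp add: uniform_mean_def)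
    then have eq: "smear (uniform_mean (carrier G) {\<one>}) f x = f x" if "x \<in> carrier G" for x
      using that by (simp add: smear_def bounded_fun_left_translate[OF ucont_bounded[OF f(1)]])
    have "- b \<le> Re (f x) \<and> Re (f x) \<le> b" if "x \<in> carrier G" for x
      using b(2)[OF that] abs_Re_le_cmod[of "f x"] by linarith
    then show ?case
      using eq mean_uniform[of "{\<one>}" "carrier G"]
      by (intro exI[of _ "uniform_mean (carrier G) {\<one>}"] exI[of _ "- b"] exI[of _ b]) auto
  next
    case (Suc k)
    then obtain m lo hi where m: "mean (carrier G) m" "hi - lo \<le> max (4 * \<epsilon>) (r ^ k * (2 * b))"
      "\<And>x. x \<in> carrier G \<Longrightarrow> lo \<le> Re (smear m f x) \<and> Re (smear m f x) \<le> hi" by blast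
    show ?case
    proof (cases "hi - lo \<le> 4 * \<epsilon>")
      case True
      then show ?thesis using m by (intro exI[of _ m] exI[of _ lo] exI[of _ hi]) auto
    next
      case False
      have Usub: "U \<subseteq> carrier G" using U openin_subset_carrier by blast
      have "\<exists>n lo' hi'. mean (carrier G) n \<and> hi' - lo' \<le> r * (hi - lo) \<and>
        (\<forall>x\<in>carrier G. lo' \<le> Re (smear n (smear m f) x) \<and> Re (smear n (smear m f) x) \<le> hi')"
      proof (rule range_reduction[where U = U and B = B and \<epsilon> = \<epsilon>])
        fix x u y assume "x \<in> carrier G" "u \<in> U" "y \<in> carrier G"
        then show "cmod (smear m f (x \<otimes> u \<otimes> y) - smear m f (x \<otimes> y)) \<le> \<epsilon>"
          using Usub by (intro smear_modulus[OF m(1) ucont_bounded[OF f(1)]]) (auto intro: U(3))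
      qed (use m B f False Usub in
          \<open>auto simp: smear_bounded ucont_bounded smear_real r_def\<close>)
      then obtain n lo' hi' where n: "mean (carrier G) n" "hi' - lo' \<le> r * (hi - lo)"
        "\<And>x. x \<in> carrier G \<Longrightarrow> lo' \<le> Re (smear n (smear m f) x) \<and> Re (smear n (smear m f) x) \<le> hi'"
        by blast
      have "r * (hi - lo) \<le> r * (r ^ k * (2 * b))" using m(2) False r by (intro mult_left_mono) auto
      then have "hi' - lo' \<le> max (4 * \<epsilon>) (r ^ Suc k * (2 * b))" using n(2) by simp
      then show ?thesis
        using n m(1) f(1)
        by (intro exI[of _ "convolve n m"] exI[of _ lo'] exI[of _ hi'])
          (auto simp: mean_convolve smear_convolve ucont_bounded)
    qed
  qed
  have "(\<lambda>k. r ^ k * (2 * b)) \<longlonglongrightarrow> 0 * (2 * b)"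
    using r by (intro tendsto_mult LIMSEQ_realpow_zero tendsto_const) auto
  then have "eventually (\<lambda>k. r ^ k * (2 * b) < 4 * \<epsilon>) sequentially"
    using \<open>\<epsilon> > 0\<close> by (intro order_tendstoD(2)) auto
  then obtain k where "r ^ k * (2 * b) < 4 * \<epsilon>" by (auto simp: eventually_sequentially)
  with *[of k] obtain m lo hi where m: "mean (carrier G) m" "hi - lo \<le> \<eta>"
      "\<And>x. x \<in> carrier G \<Longrightarrow> lo \<le> Re (smear m f x) \<and> Re (smear m f x) \<le> hi"
    by (auto simp: \<epsilon>_def max_def)
  have "cmod (smear m f x - of_real lo) \<le> \<eta>" if "x \<in> carrier G" for x
  proof -
    have "smear m f x - of_real lo = of_real (Re (smear m f x) - lo)"
      using smear_real[OF m(1) ucont_bounded[OF f(1)] f(2) that] by (simp add: complex_eq_iff)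
    then show ?thesis using m(2) m(3)[OF that] by (simp only: norm_of_real) simp
  qed
  then show ?thesis using m(1) by blast
qed

text \<open>Averaging an almost constant function leaves it close to the same constant. Hence the
  mean \<open>n\<close> found for \<open>smear m f\<close> does not spoil what \<open>m\<close> has
  achieved on \<open>F\<close>.\<close>

lemma almost_constant_averages:
  assumes "finite F" "\<And>f. f \<in> F \<Longrightarrow> ucont f" "\<And>f x. f \<in> F \<Longrightarrow> x \<in> carrier G \<Longrightarrow> Im (f x) = 0"
    and "\<eta> > 0"
  shows "\<exists>m. mean (carrier G) m \<and> (\<forall>f\<in>F. \<exists>c. \<forall>x\<in>carrier G. cmod (smear m f x - c) \<le> \<eta>)"
  using assms(1-3)
proof (induction F rule: finite_induct)
  case empty
  then show ?case using mean_uniform[of "{\<one>}" "carrier G"] by auto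
next
  case (insert f F)
  obtain m where m: "mean (carrier G) m"
      "\<And>f. f \<in> F \<Longrightarrow> \<exists>c. \<forall>x\<in>carrier G. cmod (smear m f x - c) \<le> \<eta>"
    using insert.IH insert.prems by auto
  obtain n c where n: "mean (carrier G) n" "\<forall>x\<in>carrier G. cmod (smear n (smear m f) x - c) \<le> \<eta>"
    using almost_constant_average[OF ucont_smear[OF m(1), of f] _ \<open>\<eta> > 0\<close>] insert.prems m(1)
    by (auto simp: smear_real ucont_bounded)
  interpret n: mean_functional "carrier G" n by unfold_locales fact
  have sc: "smear (convolve n m) g x = smear n (smear m g) x"
    if "g \<in> insert f F" "x \<in> carrier G" for g x
    using that insert.prems m(1) n(1) by (intro smear_convolve) (auto simp: ucont_bounded)
  have "\<exists>c. \<forall>x\<in>carrier G. cmod (smear (convolve n m) g x - c) \<le> \<eta>" if g: "g \<in> F" for g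
  proof -
    obtain d where d: "\<And>x. x \<in> carrier G \<Longrightarrow> cmod (smear m g x - d) \<le> \<eta>" using m(2)[OF g] by blast
    have "cmod (smear n (smear m g) x - d) \<le> \<eta>" if x: "x \<in> carrier G" for x
    proof -
      have "bounded_fun (carrier G) g" using g insert.prems by (auto intro: ucont_bounded)
      then have "n (\<lambda>a. smear m g (x \<otimes> a) - d) = smear n (smear m g) x - d"
            using n.diff[OF bounded_fun_left_translate[OF smear_bounded[OF m(1)] x] bounded_fun_const]
        by (simp add: smear_def[of n] n.const)
      moreover have "cmod (n (\<lambda>a. smear m g (x \<otimes> a) - d)) \<le> \<eta>"
        by (rule n.norm_le) (use d x in auto)
      ultimately show ?thesis by simp
    qed
    then show ?thesis using sc g by auto
  qed
  moreover have "\<forall>x\<in>carrier G. cmod (smear (convolve n m) f x - c) \<le> \<eta>" using sc n(2) by auto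
  ultimately show ?case using mean_convolve[OF n(1) m(1)] by blast
qed

text \<open>The means of the translate of \<open>f\<close> by \<open>y\<close> and of
  \<open>f\<close> itself are \<open>smear m f y\<close> and \<open>smear m f \<one>\<close>, so a
  mean with almost constant averages is almost invariant. Almost invariance is a closed condition,
  and compactness of the set of means yields a mean that satisfies all these conditions.\<close>

theorem ex_invariant_mean:
  "\<exists>m. mean (carrier G) m \<and> (\<forall>f y. ucont f \<longrightarrow> y \<in> carrier G \<longrightarrow> m (\<lambda>x. f (y \<otimes> x)) = m f)"
proof -
  let ?I = "{f. ucont f \<and> (\<forall>x\<in>carrier G. Im (f x) = 0)} \<times> carrier G \<times> {0::real<..}"
  define C where "C = (\<lambda>(f, y, \<eta>). {m :: ('a \<Rightarrow> complex) \<Rightarrow> complex. cmod (m (\<lambda>x. f (y \<otimes> x)) - m f) \<le> \<eta>})"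
  have "{m. mean (carrier G) m} \<inter> (\<Inter>i\<in>?I. C i) \<noteq> {}"
  proof (rule compact_imp_fip_image[OF compact_means])
    fix i show "closed (C i)"
      unfolding C_def
      by (cases i) (auto intro!: closed_Collect_le continuous_intros continuous_on_product_coordinates)
  next
    fix J assume J: "finite J" "J \<subseteq> ?I"
    define F where "F = fst ` J"
    define \<eta> where "\<eta> = Min (insert 1 ((\<lambda>i. snd (snd i)) ` J))"
    have \<eta>: "\<eta> > 0" "\<And>f y e. (f, y, e) \<in> J \<Longrightarrow> \<eta> \<le> e"
    proof -
      show "\<eta> > 0" unfolding \<eta>_def using J by (subst Min_gr_iff) auto
      fix f y e assume "(f, y, e) \<in> J"
      then have "e \<in> (\<lambda>i. snd (snd i)) ` J" by force
      then show "\<eta> \<le> e" unfolding \<eta>_def using J by (intro Min_le) auto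
    qed
    \<comment> \<open>Halved because both means are compared with the same constant
      \<open>c\<close>.\<close>
    obtain m where m: "mean (carrier G) m"
      "\<And>f. f \<in> F \<Longrightarrow> \<exists>c. \<forall>x\<in>carrier G. cmod (smear m f x - c) \<le> \<eta> / 2"
    proof -
      have "finite F" "\<And>f. f \<in> F \<Longrightarrow> ucont f" "\<And>f x. f \<in> F \<Longrightarrow> x \<in> carrier G \<Longrightarrow> Im (f x) = 0"
        using J by (auto simp: F_def)
      then show ?thesis using almost_constant_averages[of F "\<eta> / 2"] \<eta>(1) that by auto
    qed
    interpret m: mean_functional "carrier G" m by unfold_locales fact
    have "cmod (m (\<lambda>x. f (y \<otimes> x)) - m f) \<le> e" if "(f, y, e) \<in> J" for f y e
    proof -
      have fF: "f \<in> F" and y: "y \<in> carrier G" and f: "bounded_fun (carrier G) f"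
        using that J(2) by (force simp: F_def ucont_bounded)+
      obtain c where c: "\<And>x. x \<in> carrier G \<Longrightarrow> cmod (smear m f x - c) \<le> \<eta> / 2"
        using m(2)[OF fF] by blast
      have "smear m f y = m (\<lambda>x. f (y \<otimes> x))" "smear m f \<one> = m f"
        using y by (auto simp: smear_def intro!: m.cong[OF bounded_fun_left_translate[OF f]])
      then have "cmod (m (\<lambda>x. f (y \<otimes> x)) - c) \<le> \<eta> / 2" "cmod (m f - c) \<le> \<eta> / 2"
        using c[of y] c[of \<one>] y by auto
      then have "cmod (m (\<lambda>x. f (y \<otimes> x)) - m f) \<le> \<eta>"
        using norm_triangle_ineq4[of "m (\<lambda>x. f (y \<otimes> x)) - c" "m f - c"] by simp
      then show ?thesis using \<eta>(2)[OF that] by linarith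
    qed
    then show "{m. mean (carrier G) m} \<inter> (\<Inter>i\<in>J. C i) \<noteq> {}"
      using m(1) by (auto simp: C_def)
  qed
  then obtain m where m: "mean (carrier G) m" "\<And>i. i \<in> ?I \<Longrightarrow> m \<in> C i" by blast
  interpret m: mean_functional "carrier G" m by unfold_locales fact
  have re: "m (\<lambda>x. f (y \<otimes> x)) = m f"
    if f: "ucont f" "\<And>x. x \<in> carrier G \<Longrightarrow> Im (f x) = 0" and y: "y \<in> carrier G" for f y
  proof -
    have "cmod (m (\<lambda>x. f (y \<otimes> x)) - m f) \<le> \<eta>" if "\<eta> > 0" for \<eta>
      using m(2)[of "(f, y, \<eta>)"] that f y by (simp add: C_def)
    then have "cmod (m (\<lambda>x. f (y \<otimes> x)) - m f) \<le> 0" by (rule field_le_epsilon[of _ 0, simplified])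
    then show ?thesis by simp
  qed
  \<comment> \<open>The range argument is for real functions; the general case splits into real and
    imaginary parts.\<close>
  have "m (\<lambda>x. f (y \<otimes> x)) = m f" if f: "ucont f" and y: "y \<in> carrier G" for f y
    using m.split[OF ucont_bounded[OF f]] m.split[OF ucont_bounded[OF ucont_left_translate[OF f y]]]
      re[OF ucont_Re[OF f] _ y] re[OF ucont_Im[OF f] _ y] by simp
  then show ?thesis using m(1) by blast
qed

end

section \<open>Complex Hilbert spaces\<close>

lemma complex_ring_simps [simp]:
  "carrier complex_ring = UNIV" "a \<oplus>\<^bsub>complex_ring\<^esub> b = a + b" "a \<otimes>\<^bsub>complex_ring\<^esub> b = a * b"
  "\<one>\<^bsub>complex_ring\<^esub> = 1" "\<zero>\<^bsub>complex_ring\<^esub> = 0"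
  by (auto simp: complex_ring_def)

lemma complex_ring_uminus [simp]:
  assumes "cring complex_ring"
  shows "\<ominus>\<^bsub>complex_ring\<^esub> a = - a"
proof -
  interpret cring complex_ring by fact
  show ?thesis using minus_equality[of "- a" a] by simp
qed

text \<open>Forms may be degenerate, so that one locale covers the inner product, the invariant
  forms, and the difference of a multiple of the inner product and such a form. For the last kind
  Cauchy-Schwarz identifies eigenvectors.\<close>

locale psd_form = Module.module complex_ring H for H :: "'h hilbert" +
  fixes b :: "'h \<Rightarrow> 'h \<Rightarrow> complex"
  assumes add_left: "\<lbrakk>x \<in> carrier H; y \<in> carrier H; z \<in> carrier H\<rbrakk> \<Longrightarrow>
      b (x \<oplus>\<^bsub>H\<^esub> y) z = b x z + b y z"
    and smult_left: "\<lbrakk>x \<in> carrier H; y \<in> carrier H\<rbrakk> \<Longrightarrow> b (a \<odot>\<^bsub>H\<^esub> x) y = a * b x y"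
    and commute: "\<lbrakk>x \<in> carrier H; y \<in> carrier H\<rbrakk> \<Longrightarrow> b y x = cnj (b x y)"
    and nonneg: "x \<in> carrier H \<Longrightarrow> 0 \<le> Re (b x x)"
begin

lemma smult_in_carrier [simp, intro]: "x \<in> carrier H \<Longrightarrow> a \<odot>\<^bsub>H\<^esub> x \<in> carrier H"
  using smult_closed by simp

lemma minus_eq_smult:
  assumes "x \<in> carrier H" "y \<in> carrier H"
  shows "x \<ominus>\<^bsub>H\<^esub> y = x \<oplus>\<^bsub>H\<^esub> (-1) \<odot>\<^bsub>H\<^esub> y"
  using smult_l_minus[of 1 y] smult_one[of y] assms
  by (simp add: a_minus_def complex_ring_uminus[OF R.is_cring])

lemma add_right:
  assumes "x \<in> carrier H" "y \<in> carrier H" "z \<in> carrier H"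
  shows "b x (y \<oplus>\<^bsub>H\<^esub> z) = b x y + b x z"
  using assms commute[of "y \<oplus>\<^bsub>H\<^esub> z" x] commute[of y x] commute[of z x] by (simp add: add_left)

lemma smult_right:
  assumes "x \<in> carrier H" "y \<in> carrier H"
  shows "b x (a \<odot>\<^bsub>H\<^esub> y) = cnj a * b x y"
  using assms commute[of "a \<odot>\<^bsub>H\<^esub> y" x] commute[of y x] by (simp add: smult_left)

lemma diff_left: "\<lbrakk>x \<in> carrier H; y \<in> carrier H; z \<in> carrier H\<rbrakk> \<Longrightarrow> b (x \<ominus>\<^bsub>H\<^esub> y) z = b x z - b y z"
  by (simp add: minus_eq_smult add_left smult_left)

lemma diff_right: "\<lbrakk>x \<in> carrier H; y \<in> carrier H; z \<in> carrier H\<rbrakk> \<Longrightarrow> b x (y \<ominus>\<^bsub>H\<^esub> z) = b x y - b x z"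
  by (simp add: minus_eq_smult add_right smult_right)

lemma zero_left: "y \<in> carrier H \<Longrightarrow> b \<zero>\<^bsub>H\<^esub> y = 0"
  using smult_left[of y y 0] smult_l_null[of y] by simp

lemma zero_right: "y \<in> carrier H \<Longrightarrow> b y \<zero>\<^bsub>H\<^esub> = 0"
  using commute[of "\<zero>\<^bsub>H\<^esub>" y] by (simp add: zero_left)

lemma self_real: "x \<in> carrier H \<Longrightarrow> b x x = of_real (Re (b x x))"
  using commute[of x x] by (simp add: complex_eq_iff)

lemma Cauchy_Schwarz:
  assumes x: "x \<in> carrier H" and y: "y \<in> carrier H"
  shows "(cmod (b x y))\<^sup>2 \<le> Re (b x x) * Re (b y y)"
proof -
  define \<beta> where "\<beta> = b x y"
  \<comment> \<open>Nonnegativity of the form at \<open>x - t \<beta> y\<close>.\<close>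
  have key: "2 * t * (cmod \<beta>)\<^sup>2 \<le> Re (b x x) + t\<^sup>2 * (cmod \<beta>)\<^sup>2 * Re (b y y)" for t :: real
  proof -
    define s where "s = - of_real t * \<beta>"
    have ss: "s * cnj s = of_real (t\<^sup>2 * (cmod \<beta>)\<^sup>2)"
    proof -
      have "(cmod s)\<^sup>2 = t\<^sup>2 * (cmod \<beta>)\<^sup>2" by (simp add: s_def norm_mult power_mult_distrib)
      then show ?thesis using complex_norm_square[of s] by metis
    qed
    have sb: "cnj s * \<beta> = - of_real (t * (cmod \<beta>)\<^sup>2)"
    proof -
      have "cnj s * \<beta> = - of_real t * (\<beta> * cnj \<beta>)" by (simp add: s_def)
      then show ?thesis unfolding complex_norm_square[symmetric] by simp
    qed
    have "b (x \<oplus>\<^bsub>H\<^esub> s \<odot>\<^bsub>H\<^esub> y) (x \<oplus>\<^bsub>H\<^esub> s \<odot>\<^bsub>H\<^esub> y) =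
        b x x + cnj s * \<beta> + cnj (cnj s * \<beta>) + s * cnj s * b y y"
      using x y commute[OF x y]
      by (simp add: add_left add_right smult_left smult_right \<beta>_def algebra_simps)
    also have "Re \<dots> = Re (b x x) - 2 * t * (cmod \<beta>)\<^sup>2 + t\<^sup>2 * (cmod \<beta>)\<^sup>2 * Re (b y y)"
      by (subst self_real[OF y]) (simp add: ss sb)
    finally show ?thesis using nonneg[of "x \<oplus>\<^bsub>H\<^esub> s \<odot>\<^bsub>H\<^esub> y"] x y by simp
  qed
  show ?thesis
  proof (cases "Re (b y y) = 0 \<or> \<beta> = 0")
    \<comment> \<open>If \<open>b y y\<close> vanishes, the inequality is linear in
      \<open>t\<close>, and a large \<open>t\<close> violates it unless
      \<open>\<beta> = 0\<close>.\<close>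
    case True
    have "\<beta> = 0"
    proof (rule ccontr)
      assume "\<beta> \<noteq> 0"
      then have p: "(cmod \<beta>)\<^sup>2 > 0" by simp
      have "2 * ((Re (b x x) + 1) / (cmod \<beta>)\<^sup>2) * (cmod \<beta>)\<^sup>2 \<le> Re (b x x)"
        using key[of "(Re (b x x) + 1) / (cmod \<beta>)\<^sup>2"] True \<open>\<beta> \<noteq> 0\<close> by simp
      then show False using p nonneg[OF x] by simp
    qed
    then show ?thesis using nonneg[OF x] nonneg[OF y] by (simp add: \<beta>_def)
  next
    case False
    then have C: "Re (b y y) > 0" using nonneg[OF y] by simp
    \<comment> \<open>This \<open>t\<close> minimizes the quadratic polynomial in
      \<open>key\<close>.\<close>
    have "2 * (cmod \<beta>)\<^sup>2 / Re (b y y) \<le> Re (b x x) + (cmod \<beta>)\<^sup>2 / Re (b y y)"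
      using key[of "1 / Re (b y y)"] C by (simp add: power2_eq_square)
    then show ?thesis using C by (simp add: field_simps \<beta>_def)
  qed
qed

text \<open>The parallelogram law with the term for the sum of \<open>x\<close> and \<open>y\<close>
  dropped. It replaces the triangle inequality without taking square roots.\<close>

lemma diff_le:
  assumes "x \<in> carrier H" "y \<in> carrier H"
  shows "Re (b (x \<ominus>\<^bsub>H\<^esub> y) (x \<ominus>\<^bsub>H\<^esub> y)) \<le> 2 * Re (b x x) + 2 * Re (b y y)"
  using nonneg[of "x \<oplus>\<^bsub>H\<^esub> y"] assms by (simp add: add_left add_right diff_left diff_right)

end

sublocale complex_inner_product_space \<subseteq> form: psd_form H "cinner H"
proof
  show "\<And>x. x \<in> carrier H \<Longrightarrow> 0 \<le> Re (cinner H x x)"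
  proof -
    fix x assume x: "x \<in> carrier H"
    show "0 \<le> Re (cinner H x x)"
    proof (cases "x = \<zero>\<^bsub>H\<^esub>")
      case True
      then show ?thesis using cinner_smult_left[of x x 0] smult_l_null[of x] x by simp
    qed (use cinner_pos[OF x] in simp)
  qed
qed (rule cinner_add_left cinner_smult_left cinner_commute; assumption)+

context complex_inner_product_space
begin

abbreviation ip (\<open>\<langle>_, _\<rangle>\<close>) where "\<langle>x, y\<rangle> \<equiv> cinner H x y"

lemma hnorm_nonneg: "x \<in> carrier H \<Longrightarrow> 0 \<le> hnorm H x"
  by (simp add: hnorm_def form.nonneg)

lemma hnorm_sq: "x \<in> carrier H \<Longrightarrow> (hnorm H x)\<^sup>2 = Re \<langle>x, x\<rangle>"
  by (simp add: hnorm_def form.nonneg)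

lemma cinner_self: "x \<in> carrier H \<Longrightarrow> \<langle>x, x\<rangle> = of_real ((hnorm H x)\<^sup>2)"
  by (simp add: hnorm_sq flip: form.self_real)

lemma hnorm_eq_0_iff: "x \<in> carrier H \<Longrightarrow> hnorm H x = 0 \<longleftrightarrow> x = \<zero>\<^bsub>H\<^esub>"
  using cinner_pos[of x] form.zero_left[of x] by (cases "x = \<zero>\<^bsub>H\<^esub>") (auto simp: hnorm_def)

lemma cinner_bound:
  assumes "x \<in> carrier H" "y \<in> carrier H"
  shows "cmod \<langle>x, y\<rangle> \<le> hnorm H x * hnorm H y"
proof (rule power2_le_imp_le)
  show "(cmod \<langle>x, y\<rangle>)\<^sup>2 \<le> (hnorm H x * hnorm H y)\<^sup>2"
    using form.Cauchy_Schwarz[of x y] assms by (simp add: power_mult_distrib hnorm_sq)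
qed (use assms in \<open>simp add: hnorm_nonneg\<close>)

lemma hnorm_smult: "x \<in> carrier H \<Longrightarrow> hnorm H (a \<odot>\<^bsub>H\<^esub> x) = cmod a * hnorm H x"
proof (rule power2_eq_imp_eq)
  assume x: "x \<in> carrier H"
  have "\<langle>a \<odot>\<^bsub>H\<^esub> x, a \<odot>\<^bsub>H\<^esub> x\<rangle> = (a * cnj a) * \<langle>x, x\<rangle>"
    using x by (simp only: form.smult_left form.smult_right form.smult_in_carrier mult_ac)
  also have "\<dots> = of_real ((cmod a)\<^sup>2) * \<langle>x, x\<rangle>" by (simp only: complex_norm_square)
  finally show "(hnorm H (a \<odot>\<^bsub>H\<^esub> x))\<^sup>2 = (cmod a * hnorm H x)\<^sup>2"
    using x by (simp add: hnorm_sq power_mult_distrib)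
qed (simp_all add: hnorm_nonneg)

lemma hdist_eq: "x \<in> carrier H \<Longrightarrow> y \<in> carrier H \<Longrightarrow> hdist H x y = hnorm H (x \<ominus>\<^bsub>H\<^esub> y)"
  by (simp add: hdist_def)

lemma diff_eq_zero: "x \<in> carrier H \<Longrightarrow> y \<in> carrier H \<Longrightarrow> x \<ominus>\<^bsub>H\<^esub> y = \<zero>\<^bsub>H\<^esub> \<Longrightarrow> x = y"
  using Metric_space.zero[OF Metric_space_hdist, of x y] hnorm_eq_0_iff[of "\<zero>\<^bsub>H\<^esub>"]
  by (simp add: hdist_eq)

lemma eq_by_cinner:
  assumes x: "x \<in> carrier H" and y: "y \<in> carrier H"
    and "\<And>z. z \<in> carrier H \<Longrightarrow> \<langle>x, z\<rangle> = \<langle>y, z\<rangle>"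
  shows "x = y"
proof (rule diff_eq_zero[OF x y])
  have "\<langle>x \<ominus>\<^bsub>H\<^esub> y, x \<ominus>\<^bsub>H\<^esub> y\<rangle> = 0" using assms by (simp add: form.diff_left)
  then show "x \<ominus>\<^bsub>H\<^esub> y = \<zero>\<^bsub>H\<^esub>"
    using hnorm_eq_0_iff[of "x \<ominus>\<^bsub>H\<^esub> y"] x y by (simp add: hnorm_def)
qed

lemma hnorm_diff_triangle:
  assumes "x \<in> carrier H" "y \<in> carrier H" "z \<in> carrier H"
  shows "hnorm H (x \<ominus>\<^bsub>H\<^esub> z) \<le> hnorm H (x \<ominus>\<^bsub>H\<^esub> y) + hnorm H (y \<ominus>\<^bsub>H\<^esub> z)"
  using Metric_space.triangle[OF Metric_space_hdist, of x y z] assms by (simp add: hdist_eq)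

lemma hnorm_diff_zero: "x \<in> carrier H \<Longrightarrow> hnorm H (x \<ominus>\<^bsub>H\<^esub> \<zero>\<^bsub>H\<^esub>) = hnorm H x"
  by (simp add: hnorm_def form.diff_left form.diff_right form.zero_left form.zero_right)

fun lincomb :: "(nat \<Rightarrow> complex) \<Rightarrow> (nat \<Rightarrow> 'h) \<Rightarrow> nat \<Rightarrow> 'h" where
  "lincomb c e 0 = \<zero>\<^bsub>H\<^esub>"
| "lincomb c e (Suc n) = lincomb c e n \<oplus>\<^bsub>H\<^esub> c n \<odot>\<^bsub>H\<^esub> e n"

lemma lincomb_closed [simp]: "(\<And>i. i < n \<Longrightarrow> e i \<in> carrier H) \<Longrightarrow> lincomb c e n \<in> carrier H"
  by (induction n) auto

lemma cinner_lincomb: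
  "(\<And>i. i < n \<Longrightarrow> e i \<in> carrier H) \<Longrightarrow> y \<in> carrier H \<Longrightarrow>
    \<langle>lincomb c e n, y\<rangle> = (\<Sum>i<n. c i * \<langle>e i, y\<rangle>)"
  by (induction n) (auto simp: form.zero_left form.add_left form.smult_left)

text \<open>The closed subspaces to which irreducibility is applied all arise as common kernels of
  bounded functionals, so that closedness comes down to one estimate.\<close>

lemma closed_submodule_kernel:
  assumes lin: "\<And>l x y. l \<in> L \<Longrightarrow> x \<in> carrier H \<Longrightarrow> y \<in> carrier H \<Longrightarrow> l (x \<oplus>\<^bsub>H\<^esub> y) = l x + l y"
      "\<And>l x a. l \<in> L \<Longrightarrow> x \<in> carrier H \<Longrightarrow> l (a \<odot>\<^bsub>H\<^esub> x) = a * l x"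
    and bd: "\<And>l. l \<in> L \<Longrightarrow> \<exists>c. \<forall>x\<in>carrier H. cmod (l x) \<le> c * hnorm H x"
  defines "E \<equiv> {x \<in> carrier H. \<forall>l\<in>L. l x = (0 :: complex)}"
  shows "submodule E complex_ring H" "closedin (htopology H) E"
proof -
  have z: "l \<zero>\<^bsub>H\<^esub> = 0" if "l \<in> L" for l
    using lin(2)[OF that, of "\<zero>\<^bsub>H\<^esub>" 0] smult_l_null[of "\<zero>\<^bsub>H\<^esub>"] by simp
  have m: "\<ominus>\<^bsub>H\<^esub> x = (-1) \<odot>\<^bsub>H\<^esub> x" if "x \<in> carrier H" for x
    using form.minus_eq_smult[of "\<zero>\<^bsub>H\<^esub>" x] that by (simp add: a_minus_def)
  show "submodule E complex_ring H"
    by (rule submoduleI) (auto simp: E_def z lin m)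
  interpret Metric_space "carrier H" "hdist H" by (rule Metric_space_hdist)
  show "closedin (htopology H) E"
    unfolding closedin_metric
  proof (intro conjI allI impI)
    fix x assume "x \<in> carrier H - E"
    then obtain l where x: "x \<in> carrier H" and l: "l \<in> L" "l x \<noteq> 0" by (auto simp: E_def)
    obtain c where c: "\<And>x. x \<in> carrier H \<Longrightarrow> cmod (l x) \<le> c * hnorm H x" using bd[OF l(1)] by blast
    \<comment> \<open>On the ball of this radius \<open>l\<close> changes by less than
      \<open>cmod (l x)\<close>; the added \<open>1\<close> avoids a zero denominator.\<close>
    define r where "r = cmod (l x) / (\<bar>c\<bar> + 1)"
    have "r > 0" using l by (simp add: r_def add_nonneg_pos)
    moreover have "y \<notin> E" if "y \<in> mball x r" for y
    proof
      assume "y \<in> E"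
      then have y: "y \<in> carrier H" "l y = 0" using l by (auto simp: E_def)
      have d: "hnorm H (x \<ominus>\<^bsub>H\<^esub> y) < r" using that x y by (simp add: hdist_eq)
      have "l x = l (x \<ominus>\<^bsub>H\<^esub> y)" using x y l by (simp add: form.minus_eq_smult lin)
      also have "cmod \<dots> \<le> c * hnorm H (x \<ominus>\<^bsub>H\<^esub> y)" using c x y by simp
      also have "\<dots> \<le> (\<bar>c\<bar> + 1) * hnorm H (x \<ominus>\<^bsub>H\<^esub> y)"
        using hnorm_nonneg[of "x \<ominus>\<^bsub>H\<^esub> y"] x y by (intro mult_right_mono) auto
      also have "\<dots> < (\<bar>c\<bar> + 1) * r" using d by (intro mult_strict_left_mono) auto
      also have "\<dots> = cmod (l x)" by (simp add: r_def)
      finally show False by simp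
    qed
    ultimately show "\<exists>r>0. disjnt E (mball x r)" by (auto simp: disjnt_iff)
  qed (auto simp: E_def)
qed

end

context complex_hilbert_space
begin

lemma Cauchy_converges:
  assumes u: "\<And>n. u n \<in> carrier H"
    and cauchy: "\<And>e. e > 0 \<Longrightarrow> \<exists>N. \<forall>m\<ge>N. \<forall>n\<ge>N. hnorm H (u m \<ominus>\<^bsub>H\<^esub> u n) < e"
  shows "\<exists>x\<in>carrier H. (\<lambda>n. hnorm H (u n \<ominus>\<^bsub>H\<^esub> x)) \<longlonglongrightarrow> 0"
proof -
  interpret Metric_space "carrier H" "hdist H" by (rule Metric_space_hdist)
  have "MCauchy u" unfolding MCauchy_def using assms by (auto simp: hdist_eq)
  then obtain x where lim: "limitin mtopology u x sequentially" using complete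
    by (auto simp: mcomplete_def)
  then have x: "x \<in> carrier H" using limitin_mspace by blast
  have "(\<lambda>n. hdist H (u n) x) \<longlonglongrightarrow> 0" using lim limitin_metric_dist_null by blast
  then show ?thesis using x u by (auto simp: hdist_eq)
qed

text \<open>A form which is bounded, up to an arbitrarily small multiple of the norm, by finitely many
  functionals is compact, so that its maximum on the unit sphere is attained.\<close>

lemma maximum_attained:
  assumes "psd_form H b"
    and compact: "\<And>\<eta>. \<eta> > 0 \<Longrightarrow> \<exists>A K. finite A \<and> A \<subseteq> carrier H \<and>
      (\<forall>u\<in>carrier H. Re (b u u) \<le> K * (\<Sum>a\<in>A. (cmod \<langle>u, a\<rangle>)\<^sup>2) + \<eta> * (hnorm H u)\<^sup>2)"
    and nonzero: "carrier H \<noteq> {\<zero>\<^bsub>H\<^esub>}"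
  shows "\<exists>u\<in>carrier H. hnorm H u = 1 \<and> (\<forall>w\<in>carrier H. Re (b w w) \<le> Re (b u u) * (hnorm H w)\<^sup>2)"
proof -
  interpret b: psd_form H b by fact
  define S where "S = {u \<in> carrier H. hnorm H u = 1}"
  have normalize: "(1 / of_real (hnorm H w)) \<odot>\<^bsub>H\<^esub> w \<in> S" if "w \<in> carrier H" "w \<noteq> \<zero>\<^bsub>H\<^esub>" for w
    using that hnorm_eq_0_iff[of w] hnorm_nonneg[of w] by (simp add: S_def hnorm_smult norm_divide)
  obtain w0 where "w0 \<in> carrier H" "w0 \<noteq> \<zero>\<^bsub>H\<^esub>" using nonzero M.zero_closed by blast
  then have "S \<noteq> {}" using normalize by blast
  have "bdd_above ((\<lambda>u. Re (b u u)) ` S)"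
  proof -
    obtain A K where A: "finite A" "A \<subseteq> carrier H"
      "\<And>u. u \<in> carrier H \<Longrightarrow> Re (b u u) \<le> K * (\<Sum>a\<in>A. (cmod \<langle>u, a\<rangle>)\<^sup>2) + 1 * (hnorm H u)\<^sup>2"
      using compact[of 1] by auto
    have "Re (b u u) \<le> \<bar>K\<bar> * (\<Sum>a\<in>A. (hnorm H a)\<^sup>2) + 1" if u: "u \<in> S" for u
    proof -
      have uc: "u \<in> carrier H" "hnorm H u = 1" using u by (auto simp: S_def)
      have "(\<Sum>a\<in>A. (cmod \<langle>u, a\<rangle>)\<^sup>2) \<le> (\<Sum>a\<in>A. (hnorm H a)\<^sup>2)"
        using A(2) uc cinner_bound[OF uc(1)] by (intro sum_mono power_mono) (auto simp: subset_iff)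
      then have "\<bar>K\<bar> * (\<Sum>a\<in>A. (cmod \<langle>u, a\<rangle>)\<^sup>2) \<le> \<bar>K\<bar> * (\<Sum>a\<in>A. (hnorm H a)\<^sup>2)"
        by (intro mult_left_mono) auto
      moreover have "K * (\<Sum>a\<in>A. (cmod \<langle>u, a\<rangle>)\<^sup>2) \<le> \<bar>K\<bar> * (\<Sum>a\<in>A. (cmod \<langle>u, a\<rangle>)\<^sup>2)"
        by (intro mult_right_mono sum_nonneg) auto
      ultimately show ?thesis using A(3)[OF uc(1)] uc(2) by simp
    qed
    then show ?thesis by (rule bdd_aboveI2)
  qed note bdd = this
  define \<mu> where "\<mu> = (SUP u\<in>S. Re (b u u))"
  have le: "Re (b u u) \<le> \<mu>" if "u \<in> S" for u unfolding \<mu>_def by (rule cSUP_upper[OF that bdd])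
  have \<mu>: "Re (b w w) \<le> \<mu> * (hnorm H w)\<^sup>2" if w: "w \<in> carrier H" for w
  proof (cases "w = \<zero>\<^bsub>H\<^esub>")
    case True
    then show ?thesis using b.zero_left[of w] w hnorm_eq_0_iff[of w] by simp
  next
    case False
    define t where "t = hnorm H w"
    have t: "t > 0" using False hnorm_eq_0_iff[OF w] hnorm_nonneg[OF w] by (simp add: t_def)
    have "Re (b ((1 / of_real t) \<odot>\<^bsub>H\<^esub> w) ((1 / of_real t) \<odot>\<^bsub>H\<^esub> w)) \<le> \<mu>"
      using le[OF normalize[OF w False]] by (simp add: t_def)
    then have "Re (b w w) / (t * t) \<le> \<mu>"
      using w by (simp add: b.smult_left b.smult_right Re_divide_of_real flip: of_real_mult)
    then show ?thesis using t by (simp add: t_def field_simps power2_eq_square)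
  qed
  \<comment> \<open>Nonnegative because \<open>\<mu>\<close> is the supremum. Its small values on
    the unit sphere signal almost maximizing vectors.\<close>
  interpret q: psd_form H "\<lambda>x y. of_real \<mu> * \<langle>x, y\<rangle> - b x y"
  proof
    fix x y assume "x \<in> carrier H" "y \<in> carrier H"
    then show "of_real \<mu> * \<langle>y, x\<rangle> - b y x = cnj (of_real \<mu> * \<langle>x, y\<rangle> - b x y)"
      using b.commute[of x y] cinner_commute[of x y] by simp
  next
    fix x assume "x \<in> carrier H"
    then show "0 \<le> Re (of_real \<mu> * \<langle>x, x\<rangle> - b x x)"
      using \<mu>[of x] by (simp add: hnorm_sq)
  qed (auto simp: form.add_left b.add_left form.smult_left b.smult_left algebra_simps)
  have "\<exists>u\<in>S. Re (b u u) > \<mu> - 1 / Suc n" for n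
    using less_cSUP_iff[OF \<open>S \<noteq> {}\<close> bdd, of "\<mu> - 1 / Suc n"] by (simp add: \<mu>_def)
  then obtain u where u: "\<And>n. u n \<in> S" "\<And>n. Re (b (u n) (u n)) > \<mu> - 1 / Suc n" by metis
  have uc: "u n \<in> carrier H" "hnorm H (u n) = 1" for n using u(1)[of n] by (auto simp: S_def)
  have "\<exists>A K. finite A \<and> A \<subseteq> carrier H \<and> (\<forall>u\<in>carrier H.
      Re (b u u) \<le> K * (\<Sum>a\<in>A. (cmod \<langle>u, a\<rangle>)\<^sup>2) + 1 / Suc n * (hnorm H u)\<^sup>2)" for n
    by (rule compact) simp
  then obtain A K where A: "\<And>n. finite (A n)" "\<And>n. A n \<subseteq> carrier H"
    "\<And>n u. u \<in> carrier H \<Longrightarrow>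
      Re (b u u) \<le> K n * (\<Sum>a\<in>A n. (cmod \<langle>u, a\<rangle>)\<^sup>2) + 1 / Suc n * (hnorm H u)\<^sup>2" by metis
  \<comment> \<open>Countably many test vectors, collected over the accuracies
    \<open>1 / Suc n\<close>; the zero vector keeps the set nonempty for the enumeration.\<close>
  define D where "D = insert \<zero>\<^bsub>H\<^esub> (\<Union>n. A n)"
  have "countable D" using A(1) by (auto simp: D_def countable_finite)
  then have rD: "range (from_nat_into D) = D" by (intro range_from_nat_into) (auto simp: D_def)
  define d where "d = from_nat_into D"
  have dc: "d k \<in> carrier H" for k
  proof -
    have "d k \<in> D" unfolding d_def by (rule from_nat_into) (simp add: D_def)
    then show ?thesis using A(2) by (auto simp: D_def)
  qed
  define x where "x n k = \<langle>u n, d k\<rangle>" for n k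
  \<comment> \<open>A countable product of discs is sequentially compact. This replaces a diagonal
    argument for the inner products with all test vectors.\<close>
  define X where "X = {g :: nat \<Rightarrow> complex. \<forall>k. g k \<in> cball 0 (hnorm H (d k))}"
  have "seq_compact X"
    unfolding X_def by (rule compact_imp_seq_compact, rule compact_box) simp
  moreover have "x n \<in> X" for n
    using cinner_bound[OF uc(1) dc] uc(2) by (simp add: x_def X_def)
  ultimately obtain l r where r: "strict_mono r" "(x \<circ> r) \<longlonglongrightarrow> l"
    using seq_compactE[of X x] by blast
  have conv: "\<exists>z. (\<lambda>n. \<langle>u (r n), a\<rangle>) \<longlonglongrightarrow> z" if "a \<in> D" for a
  proof -
    obtain k where k: "a = d k" using \<open>a \<in> D\<close> rD by (auto simp: d_def)
    have "(\<lambda>n. (x \<circ> r) n k) \<longlonglongrightarrow> l k"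
      using continuous_on_tendsto_compose[OF continuous_on_product_coordinates[of k] r(2)] by simp
    then show ?thesis by (auto simp: x_def k)
  qed
  \<comment> \<open>The finitely many inner products converge along the subsequence, and the error
    term is small because differences of unit vectors are bounded.\<close>
  have b_cauchy: "\<exists>N. \<forall>m\<ge>N. \<forall>n\<ge>N. Re (b (u (r m) \<ominus>\<^bsub>H\<^esub> u (r n)) (u (r m) \<ominus>\<^bsub>H\<^esub> u (r n))) < e"
    if "e > 0" for e
  proof -
    obtain k where k: "1 / Suc k < e / 8" using nat_approx_posE[of "e / 8"] \<open>e > 0\<close> by auto
    \<comment> \<open>Solves \<open>(\<bar>K k\<bar> + 1) * (card (A k) + 1) * e'\<^sup>2 = e /
      2\<close>. The other half of \<open>e\<close> is for \<open>4 / Suc k\<close>, since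
      differences of unit vectors have squared norm at most \<open>4\<close>.\<close>
    define e' where "e' = sqrt (e / (2 * (\<bar>K k\<bar> + 1) * (card (A k) + 1)))"
    have den: "2 * (\<bar>K k\<bar> + 1) * (real (card (A k)) + 1) > 0" by (intro mult_pos_pos) auto
    have e': "e' > 0" using \<open>e > 0\<close> den by (simp add: e'_def)
    have "\<exists>N. \<forall>m\<ge>N. \<forall>n\<ge>N. cmod (\<langle>u (r m), a\<rangle> - \<langle>u (r n), a\<rangle>) < e'" if "a \<in> A k" for a
    proof -
      have "Cauchy (\<lambda>n. \<langle>u (r n), a\<rangle>)"
        using conv[of a] that by (auto simp: D_def intro: LIMSEQ_imp_Cauchy)
      then show ?thesis using e' by (auto simp: Cauchy_def dist_norm)
    qed
    then obtain N where N: "\<And>a m n. a \<in> A k \<Longrightarrow> m \<ge> N a \<Longrightarrow> n \<ge> N a \<Longrightarrow>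
        cmod (\<langle>u (r m), a\<rangle> - \<langle>u (r n), a\<rangle>) < e'" by metis
    define N0 where "N0 = Max (insert 0 (N ` A k))"
    have N0: "N a \<le> N0" if "a \<in> A k" for a using that A(1)[of k] by (simp add: N0_def)
    have "Re (b (u (r m) \<ominus>\<^bsub>H\<^esub> u (r n)) (u (r m) \<ominus>\<^bsub>H\<^esub> u (r n))) < e" if mn: "m \<ge> N0" "n \<ge> N0" for m n
    proof -
      define w where "w = u (r m) \<ominus>\<^bsub>H\<^esub> u (r n)"
      have w: "w \<in> carrier H" using uc by (simp add: w_def)
      have "(hnorm H w)\<^sup>2 \<le> 2 * Re \<langle>u (r m), u (r m)\<rangle> + 2 * Re \<langle>u (r n), u (r n)\<rangle>"
        using form.diff_le[of "u (r m)" "u (r n)"] uc w by (simp add: hnorm_sq w_def)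
      then have w4: "(hnorm H w)\<^sup>2 \<le> 4" using uc by (simp flip: hnorm_sq)
      have "(cmod \<langle>w, a\<rangle>)\<^sup>2 \<le> e'\<^sup>2" if "a \<in> A k" for a
        using N[OF that, of m n] N0[OF that] mn uc A(2)[of k] that
        by (intro power_mono) (auto simp: w_def form.diff_left subset_iff)
      then have "(\<Sum>a\<in>A k. (cmod \<langle>w, a\<rangle>)\<^sup>2) \<le> real (card (A k)) * e'\<^sup>2"
        using sum_bounded_above[of "A k" "\<lambda>a. (cmod \<langle>w, a\<rangle>)\<^sup>2" "e'\<^sup>2"] by simp
      also have "\<dots> \<le> (card (A k) + 1) * e'\<^sup>2" by (intro mult_right_mono) auto
      finally have "K k * (\<Sum>a\<in>A k. (cmod \<langle>w, a\<rangle>)\<^sup>2) \<le> (\<bar>K k\<bar> + 1) * ((card (A k) + 1) * e'\<^sup>2)"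
        by (intro mult_mono) (auto intro: sum_nonneg)
      also have "\<dots> = e / 2"
        using \<open>e > 0\<close> den by (simp add: e'_def field_simps)
      finally have "K k * (\<Sum>a\<in>A k. (cmod \<langle>w, a\<rangle>)\<^sup>2) \<le> e / 2" .
      moreover have "1 / Suc k * (hnorm H w)\<^sup>2 \<le> 1 / Suc k * 4" using w4
        by (intro mult_left_mono) auto
      moreover have "1 / Suc k * 4 < e / 2" using k by (simp add: field_simps)
      ultimately show ?thesis using A(3)[OF w, of k] unfolding w_def[symmetric] by linarith
    qed
    then show ?thesis by blast
  qed
  have r_ge: "n \<le> r n" for n using r(1) by (rule seq_suble)
  have qle: "Re (of_real \<mu> * \<langle>u (r n), u (r n)\<rangle> - b (u (r n)) (u (r n))) \<le> 1 / Suc n" for n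
  proof -
    have "Re (of_real \<mu> * \<langle>u (r n), u (r n)\<rangle> - b (u (r n)) (u (r n))) < 1 / Suc (r n)"
      using u(2)[of "r n"] uc[of "r n"] hnorm_sq[of "u (r n)"] by simp
    also have "\<dots> \<le> 1 / Suc n" using r_ge[of n] by (simp add: frac_le)
    finally show ?thesis by simp
  qed
  show ?thesis
  proof (cases "\<mu> > 0")
    \<comment> \<open>Then \<open>\<mu> = 0\<close>, and every unit vector attains it.\<close>
    case False
    have "Re (b (u 0) (u 0)) = \<mu>" using b.nonneg[OF uc(1)[of 0]] le[OF u(1)[of 0]] False by linarith
    then show ?thesis using uc \<mu> by (intro bexI[of _ "u 0"]) auto
  next
    case True
    \<comment> \<open>\<open>\<mu>\<close> times the squared norm of a difference is the sum of the
      two forms there. The form \<open>q\<close> is small by \<open>diff_le\<close>, because the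
      vectors almost maximize, and \<open>b\<close> is small by \<open>b_cauchy\<close>. Division by
      \<open>\<mu> > 0\<close> gives convergence in norm.\<close>
    have cauchy: "\<exists>N. \<forall>m\<ge>N. \<forall>n\<ge>N. hnorm H (u (r m) \<ominus>\<^bsub>H\<^esub> u (r n)) < e" if "e > 0" for e
    proof -
      define e2 where "e2 = \<mu> * e\<^sup>2 / 2"
      have e2: "e2 > 0" using True \<open>e > 0\<close> by (simp add: e2_def)
      obtain N where N: "\<And>m n. m \<ge> N \<Longrightarrow> n \<ge> N \<Longrightarrow>
          Re (b (u (r m) \<ominus>\<^bsub>H\<^esub> u (r n)) (u (r m) \<ominus>\<^bsub>H\<^esub> u (r n))) < e2" using b_cauchy[OF e2] by blast
      obtain k where k: "1 / Suc k < e2 / 4" using nat_approx_posE[of "e2 / 4"] e2 by auto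
      have "hnorm H (u (r m) \<ominus>\<^bsub>H\<^esub> u (r n)) < e" if mn: "m \<ge> max N k" "n \<ge> max N k" for m n
      proof -
        define w where "w = u (r m) \<ominus>\<^bsub>H\<^esub> u (r n)"
        have w: "w \<in> carrier H" using uc by (simp add: w_def)
        have i: "1 / Suc j \<le> 1 / Suc k" if "j \<ge> k" for j using that by (simp add: frac_le)
        have "Re (of_real \<mu> * \<langle>w, w\<rangle> - b w w) \<le> 2 * (1 / Suc m) + 2 * (1 / Suc n)"
          using q.diff_le[of "u (r m)" "u (r n)"] uc(1) qle[of m] qle[of n] unfolding w_def by smt
        also have "\<dots> < e2" using i[of m] i[of n] mn k by simp
        finally have "\<mu> * (hnorm H w)\<^sup>2 - Re (b w w) < e2" using w by (simp add: hnorm_sq)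
        then have "\<mu> * (hnorm H w)\<^sup>2 < \<mu> * e\<^sup>2" using N[of m n] mn by (simp add: w_def e2_def)
        then show ?thesis using True \<open>e > 0\<close> by (simp add: w_def power_less_imp_less_base)
      qed
      then show ?thesis by blast
    qed
    obtain v where v: "v \<in> carrier H" "(\<lambda>n. hnorm H (u (r n) \<ominus>\<^bsub>H\<^esub> v)) \<longlonglongrightarrow> 0"
      using Cauchy_converges[OF uc(1) cauchy] by blast
    have norm_v: "hnorm H v = 1"
    proof -
      have "\<bar>hnorm H v - 1\<bar> \<le> hnorm H (u (r n) \<ominus>\<^bsub>H\<^esub> v)" for n
      proof -
        have "hnorm H (u (r n) \<ominus>\<^bsub>H\<^esub> v) = hnorm H (v \<ominus>\<^bsub>H\<^esub> u (r n))"
          using Metric_space.commute[OF Metric_space_hdist] uc v by (metis hdist_eq)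
        then show ?thesis
          using hnorm_diff_triangle[of "u (r n)" v "\<zero>\<^bsub>H\<^esub>"] hnorm_diff_triangle[of v "u (r n)" "\<zero>\<^bsub>H\<^esub>"]
            uc[of "r n"] v(1) by (simp add: hnorm_diff_zero)
      qed
      then have "\<bar>hnorm H v - 1\<bar> \<le> 0" by (intro LIMSEQ_le_const[OF v(2)]) auto
      then show ?thesis by simp
    qed
    \<comment> \<open>Writing \<open>v\<close> as the difference of \<open>u (r n)\<close> and
      \<open>w\<close> and using \<open>diff_le\<close> once more avoids a continuity argument for
      \<open>b\<close>.\<close>
    have "Re (of_real \<mu> * \<langle>v, v\<rangle> - b v v) \<le> 0"
    proof (rule LIMSEQ_le_const[where X = "\<lambda>n. 2 * (1 / Suc n) + 2 * (\<mu> * (hnorm H (u (r n) \<ominus>\<^bsub>H\<^esub> v))\<^sup>2)"])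
      show "(\<lambda>n. 2 * (1 / Suc n) + 2 * (\<mu> * (hnorm H (u (r n) \<ominus>\<^bsub>H\<^esub> v))\<^sup>2)) \<longlonglongrightarrow> 0"
        using tendsto_add[OF tendsto_mult[OF tendsto_const[of 2] LIMSEQ_Suc[OF lim_1_over_n[where 'a = real]]]
            tendsto_mult[OF tendsto_const[of 2] tendsto_mult[OF tendsto_const[of \<mu>] tendsto_power[OF v(2), of 2]]]]
        by simp
      have "Re (of_real \<mu> * \<langle>v, v\<rangle> - b v v) \<le> 2 * (1 / Suc n) + 2 * (\<mu> * (hnorm H (u (r n) \<ominus>\<^bsub>H\<^esub> v))\<^sup>2)" for n
      proof -
        define w where "w = u (r n) \<ominus>\<^bsub>H\<^esub> v"
        have w: "w \<in> carrier H" using uc v by (simp add: w_def)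
        have uw: "u (r n) \<ominus>\<^bsub>H\<^esub> w = v"
          using uc v w by (intro eq_by_cinner) (auto simp: form.diff_left w_def)
        have "Re (of_real \<mu> * \<langle>v, v\<rangle> - b v v) \<le>
            2 * Re (of_real \<mu> * \<langle>u (r n), u (r n)\<rangle> - b (u (r n)) (u (r n))) + 2 * Re (of_real \<mu> * \<langle>w, w\<rangle> - b w w)"
          using q.diff_le[OF uc(1) w, of "r n"] unfolding uw .
        moreover have "Re (of_real \<mu> * \<langle>w, w\<rangle> - b w w) \<le> \<mu> * (hnorm H w)\<^sup>2"
          using b.nonneg[OF w] w by (simp add: hnorm_sq)
        ultimately show ?thesis using qle[of n] unfolding w_def[symmetric] by linarith
      qed
      then show "\<exists>N. \<forall>n\<ge>N. Re (of_real \<mu> * \<langle>v, v\<rangle> - b v v) \<le>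
          2 * (1 / Suc n) + 2 * (\<mu> * (hnorm H (u (r n) \<ominus>\<^bsub>H\<^esub> v))\<^sup>2)" by blast
    qed
    then have "\<mu> \<le> Re (b v v)" using norm_v v(1) hnorm_sq[of v] by simp
    moreover have "Re (b v v) \<le> \<mu>" using \<mu>[OF v(1)] norm_v by simp
    ultimately have "Re (b v v) = \<mu>" by simp
    then show ?thesis using v(1) norm_v \<mu> by (intro bexI[of _ v]) auto
  qed
qed

end

section \<open>Orthonormal systems and finite bases\<close>

context complex_inner_product_space
begin

definition orthonormal :: "(nat \<Rightarrow> 'h) \<Rightarrow> nat \<Rightarrow> bool"
  where "orthonormal e n \<longleftrightarrow> (\<forall>i<n. e i \<in> carrier H) \<and>
    (\<forall>i<n. \<forall>j<n. \<langle>e i, e j\<rangle> = (if i = j then 1 else 0))"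

definition residual :: "(nat \<Rightarrow> 'h) \<Rightarrow> nat \<Rightarrow> 'h \<Rightarrow> 'h"
  where "residual e n w = w \<ominus>\<^bsub>H\<^esub> lincomb (\<lambda>i. \<langle>w, e i\<rangle>) e n"

lemma residual_closed: "orthonormal e n \<Longrightarrow> w \<in> carrier H \<Longrightarrow> residual e n w \<in> carrier H"
  by (simp add: residual_def orthonormal_def)

lemma residual_orthogonal:
  assumes e: "orthonormal e n" and w: "w \<in> carrier H" and j: "j < n"
  shows "\<langle>residual e n w, e j\<rangle> = 0"
proof -
  have "\<langle>residual e n w, e j\<rangle> = \<langle>w, e j\<rangle> - (\<Sum>i<n. \<langle>w, e i\<rangle> * \<langle>e i, e j\<rangle>)"
    using e w j by (simp add: residual_def orthonormal_def form.diff_left cinner_lincomb)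
  also have "(\<Sum>i<n. \<langle>w, e i\<rangle> * \<langle>e i, e j\<rangle>) = (\<Sum>i<n. if i = j then \<langle>w, e j\<rangle> else 0)"
    using e j by (intro sum.cong) (auto simp: orthonormal_def)
  finally show ?thesis using j by simp
qed

text \<open>Pythagoras: the residual is orthogonal to the combination that was subtracted.\<close>

lemma residual_norm:
  assumes e: "orthonormal e n" and w: "w \<in> carrier H"
  shows "(hnorm H (residual e n w))\<^sup>2 = (hnorm H w)\<^sup>2 - (\<Sum>i<n. (cmod \<langle>w, e i\<rangle>)\<^sup>2)"
proof -
  let ?z = "residual e n w"
  have ec: "\<And>i. i < n \<Longrightarrow> e i \<in> carrier H" using e by (simp add: orthonormal_def)
  have z: "?z \<in> carrier H" by (rule residual_closed[OF e w])
  have "\<langle>e i, ?z\<rangle> = 0" if "i < n" for i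
    using residual_orthogonal[OF e w that] cinner_commute[OF z ec[OF that]] by simp
  then have "\<langle>lincomb (\<lambda>i. \<langle>w, e i\<rangle>) e n, ?z\<rangle> = 0" using ec z by (simp add: cinner_lincomb)
  then have "\<langle>?z, ?z\<rangle> = \<langle>w, ?z\<rangle>"
    using ec w z form.diff_left[of w "lincomb (\<lambda>i. \<langle>w, e i\<rangle>) e n" ?z] by (simp add: residual_def)
  also have "\<dots> = \<langle>w, w\<rangle> - cnj \<langle>lincomb (\<lambda>i. \<langle>w, e i\<rangle>) e n, w\<rangle>"
    using ec w cinner_commute[of "lincomb (\<lambda>i. \<langle>w, e i\<rangle>) e n" w]
      by (simp add: residual_def form.diff_right)
  also have "\<langle>lincomb (\<lambda>i. \<langle>w, e i\<rangle>) e n, w\<rangle> = (\<Sum>i<n. \<langle>w, e i\<rangle> * cnj \<langle>w, e i\<rangle>)"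
    using ec w by (subst cinner_lincomb) (auto simp: cinner_commute[OF w] intro!: sum.cong)
  also have "\<dots> = of_real (\<Sum>i<n. (cmod \<langle>w, e i\<rangle>)\<^sup>2)"
    by (simp only: complex_norm_square of_real_sum)
  finally have "Re \<langle>?z, ?z\<rangle> = Re \<langle>w, w\<rangle> - (\<Sum>i<n. (cmod \<langle>w, e i\<rangle>)\<^sup>2)" by (simp del: of_real_sum)
  then show ?thesis using z w by (simp add: hnorm_sq)
qed

lemma Bessel: "orthonormal e n \<Longrightarrow> w \<in> carrier H \<Longrightarrow> (\<Sum>i<n. (cmod \<langle>w, e i\<rangle>)\<^sup>2) \<le> (hnorm H w)\<^sup>2"
  using residual_norm[of e n w] zero_le_power2[of "hnorm H (residual e n w)"] by linarith

lemma orthonormal_extend: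
  assumes e: "orthonormal e n" and w: "w \<in> carrier H" "residual e n w \<noteq> \<zero>\<^bsub>H\<^esub>"
  shows "\<exists>e'. orthonormal e' (Suc n)"
proof -
  let ?z = "residual e n w"
  have ec: "\<And>i. i < n \<Longrightarrow> e i \<in> carrier H" using e by (simp add: orthonormal_def)
  have z: "?z \<in> carrier H" by (rule residual_closed[OF e w(1)])
  define t where "t = hnorm H ?z"
  have t: "t > 0" using w(2) z hnorm_eq_0_iff[OF z] hnorm_nonneg[OF z] by (simp add: t_def)
  define y where "y = (1 / of_real t) \<odot>\<^bsub>H\<^esub> ?z"
  have y: "y \<in> carrier H" using z by (simp add: y_def)
  have "\<langle>y, y\<rangle> = of_real ((hnorm H y)\<^sup>2)" by (rule cinner_self[OF y])
  moreover have "hnorm H y = 1" using z t by (simp add: y_def hnorm_smult norm_divide t_def)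
  ultimately have yy: "\<langle>y, y\<rangle> = 1" by simp
  have ye: "\<langle>y, e j\<rangle> = 0" if "j < n" for j
    using residual_orthogonal[OF e w(1) that] z ec[OF that] by (simp add: y_def form.smult_left)
  have ey: "\<langle>e j, y\<rangle> = 0" if "j < n" for j
    using ye[OF that] cinner_commute[OF y ec[OF that]] by simp
  have "orthonormal (e(n := y)) (Suc n)"
    using e y yy ye ey by (auto simp: orthonormal_def less_Suc_eq)
  then show ?thesis by blast
qed

definition basis :: "(nat \<Rightarrow> 'h) \<Rightarrow> nat \<Rightarrow> bool"
  where "basis e n \<longleftrightarrow> orthonormal e n \<and> (\<forall>w\<in>carrier H. w = lincomb (\<lambda>i. \<langle>w, e i\<rangle>) e n)"

text \<open>An orthonormal system of maximal length leaves no residual, since a nonzero one could be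
  normalized and appended.\<close>

lemma ex_basis:
  assumes "\<And>e n. orthonormal e n \<Longrightarrow> n \<le> N"
  shows "\<exists>e n. basis e n"
proof -
  have "\<exists>e. orthonormal e 0" by (auto simp: orthonormal_def)
  define S where "S = {k. \<exists>e. orthonormal e k}"
  define n where "n = Max S"
  have "S \<subseteq> {..N}" using assms by (auto simp: S_def)
  then have "finite S" by (rule finite_subset) simp
  moreover have "S \<noteq> {}" using \<open>\<exists>e. orthonormal e 0\<close> by (auto simp: S_def)
  ultimately have "n \<in> S" and n: "\<And>k. k \<in> S \<Longrightarrow> k \<le> n" by (auto simp: n_def)
  then have "\<exists>e. orthonormal e n" by (simp add: S_def)
  then obtain e where e: "orthonormal e n" by blast
  have "w = lincomb (\<lambda>i. \<langle>w, e i\<rangle>) e n" if w: "w \<in> carrier H" for w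
  proof (rule diff_eq_zero)
    have "residual e n w = \<zero>\<^bsub>H\<^esub>"
      using orthonormal_extend[OF e w] n[of "Suc n"] by (auto simp: S_def)
    then show "w \<ominus>\<^bsub>H\<^esub> lincomb (\<lambda>i. \<langle>w, e i\<rangle>) e n = \<zero>\<^bsub>H\<^esub>" by (simp add: residual_def)
  qed (use w e in \<open>auto simp: orthonormal_def\<close>)
  then show ?thesis using e by (auto simp: basis_def)
qed

lemma basis_closed: "basis e n \<Longrightarrow> i < n \<Longrightarrow> e i \<in> carrier H"
  by (simp add: basis_def orthonormal_def)

lemma Parseval:
  assumes "basis e n" "w \<in> carrier H" "y \<in> carrier H"
  shows "\<langle>w, y\<rangle> = (\<Sum>i<n. \<langle>w, e i\<rangle> * \<langle>e i, y\<rangle>)"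
  using assms cinner_lincomb[of n e y "\<lambda>i. \<langle>w, e i\<rangle>"] by (simp add: basis_def orthonormal_def)

lemma form_lincomb:
  assumes "psd_form H b" "\<And>i. i < n \<Longrightarrow> e i \<in> carrier H" "y \<in> carrier H"
  shows "b (lincomb c e n) y = (\<Sum>i<n. c i * b (e i) y)"
proof -
  interpret b: psd_form H b by fact
  show ?thesis using assms(2,3)
    by (induction n) (auto simp: b.zero_left b.add_left b.smult_left)
qed

text \<open>In finite dimension a form satisfies the compactness hypothesis of
  \<open>Schur_form\<close> with no error term, the basis vectors being the test vectors.\<close>

lemma form_bound_basis:
  assumes b: "psd_form H b" and e: "basis e n" and u: "u \<in> carrier H"
  shows "Re (b u u) \<le> n * (\<Sum>i<n. \<Sum>j<n. cmod (b (e i) (e j))) * (\<Sum>i<n. (cmod \<langle>u, e i\<rangle>)\<^sup>2)"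
proof -
  interpret b: psd_form H b by fact
  define B where "B = (\<Sum>i<n. \<Sum>j<n. cmod (b (e i) (e j)))"
  have ec: "\<And>i. i < n \<Longrightarrow> e i \<in> carrier H" using e by (rule basis_closed)
  define a where "a = (\<lambda>i. \<langle>u, e i\<rangle>)"
  have ua: "u = lincomb a e n" using e u by (simp add: basis_def a_def)
  have lin: "b u y = (\<Sum>i<n. a i * b (e i) y)" if "y \<in> carrier H" for y
    unfolding ua using form_lincomb[OF b] ec that by simp
  have B: "cmod (b (e i) (e j)) \<le> B" if "i < n" "j < n" for i j
  proof -
    have "cmod (b (e i) (e j)) \<le> (\<Sum>j<n. cmod (b (e i) (e j)))"
      using that by (intro member_le_sum) auto
    also have "\<dots> \<le> B" unfolding B_def
      using that
        by (intro member_le_sum[of i "{..<n}" "\<lambda>i. \<Sum>j<n. cmod (b (e i) (e j))"] sum_nonneg) auto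
    finally show ?thesis .
  qed
  have B0: "B \<ge> 0" by (simp add: B_def sum_nonneg)
  have "b u u = (\<Sum>i<n. \<Sum>j<n. a i * (cnj (a j) * b (e i) (e j)))"
  proof -
    have "b (e i) u = (\<Sum>j<n. cnj (a j) * b (e i) (e j))" if "i < n" for i
    proof -
      have "b (e i) u = cnj (b u (e i))" using b.commute[OF u ec[OF that]] .
      also have "\<dots> = (\<Sum>j<n. cnj (a j) * cnj (b (e j) (e i)))" using lin[OF ec[OF that]] by simp
      also have "\<dots> = (\<Sum>j<n. cnj (a j) * b (e i) (e j))"
      proof (rule sum.cong[OF refl])
        fix j assume "j \<in> {..<n}"
        then show "cnj (a j) * cnj (b (e j) (e i)) = cnj (a j) * b (e i) (e j)"
          using b.commute[of "e j" "e i"] ec that by (metis lessThan_iff)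
      qed
      finally show ?thesis .
    qed
    then show ?thesis using lin[OF u] by (simp add: sum_distrib_left)
  qed
  then have "Re (b u u) \<le> cmod (\<Sum>i<n. \<Sum>j<n. a i * (cnj (a j) * b (e i) (e j)))"
    by (simp only: complex_Re_le_cmod)
  also have "\<dots> \<le> (\<Sum>i<n. \<Sum>j<n. cmod (a i * (cnj (a j) * b (e i) (e j))))"
    by (rule order_trans[OF norm_sum sum_mono[OF norm_sum]])
  \<comment> \<open>Symmetrized by the inequality of arithmetic and geometric means; the sum over
    the free index yields the factor \<open>n\<close>.\<close>
  also have "\<dots> \<le> (\<Sum>i<n. \<Sum>j<n. B * (((cmod (a i))\<^sup>2 + (cmod (a j))\<^sup>2) / 2))"
  proof (intro sum_mono)
    fix i j assume ij: "i \<in> {..<n}" "j \<in> {..<n}"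
    have "cmod (a i * (cnj (a j) * b (e i) (e j))) = cmod (b (e i) (e j)) * (cmod (a i) * cmod (a j))"
      by (simp add: norm_mult)
    also have "\<dots> \<le> B * (((cmod (a i))\<^sup>2 + (cmod (a j))\<^sup>2) / 2)"
      using B ij B0 sum_squares_bound[of "cmod (a i)" "cmod (a j)"] by (intro mult_mono) auto
    finally show "cmod (a i * (cnj (a j) * b (e i) (e j))) \<le> B * (((cmod (a i))\<^sup>2 + (cmod (a j))\<^sup>2) / 2)" .
  qed
  also have "\<dots> = n * B * (\<Sum>i<n. (cmod (a i))\<^sup>2)"
    by (simp add: sum.distrib add_divide_distrib sum_divide_distrib[symmetric] sum_distrib_left[symmetric]
        distrib_left sum_distrib_right[symmetric])
  finally show ?thesis by (simp add: B_def a_def)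
qed

end

context totally_bounded_group
begin

lemma ucont_cong:
  assumes f: "ucont f" and eq: "\<And>x. x \<in> carrier G \<Longrightarrow> f x = g x"
  shows "ucont g"
proof (rule ucontI)
  show "bounded_fun (carrier G) g" using ucont_bounded[OF f] eq by (simp add: bounded_fun_def)
  fix \<epsilon> :: real assume "\<epsilon> > 0"
  then obtain U where U: "openin T U" "\<one> \<in> U"
    "\<And>x u. x \<in> carrier G \<Longrightarrow> u \<in> U \<Longrightarrow> cmod (f (x \<otimes> u) - f x) \<le> \<epsilon>"
    using ucontE1[OF f] by blast
  have "cmod (g (x \<otimes> u) - g x) \<le> \<epsilon>" if "x \<in> carrier G" "u \<in> U" for x u
  proof -
    have "u \<in> carrier G" using that openin_subset_carrier[OF U(1)] by blast
    then show ?thesis using U(3)[OF that] that(1) by (simp flip: eq)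
  qed
  then show "\<exists>U. openin T U \<and> \<one> \<in> U \<and> (\<forall>x\<in>carrier G. \<forall>u\<in>U. cmod (g (x \<otimes> u) - g x) \<le> \<epsilon>)"
    using U by blast
qed

lemma ucont_sum: "(\<And>i. i \<in> I \<Longrightarrow> ucont (f i)) \<Longrightarrow> ucont (\<lambda>x. \<Sum>i\<in>I. f i x)"
  by (induction I rule: infinite_finite_induct) (auto intro: ucont_add ucont_const)

end

section \<open>Positivity of an invariant mean\<close>

locale invariant_mean_group = totally_bounded_group G T for G (structure) and T +
  fixes M :: "('a \<Rightarrow> complex) \<Rightarrow> complex"
  assumes mean_M: "mean (carrier G) M"
    and invariant: "\<lbrakk>ucont f; y \<in> carrier G\<rbrakk> \<Longrightarrow> M (\<lambda>x. f (y \<otimes> x)) = M f"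
begin

sublocale mean: mean_functional "carrier G" M
  by unfold_locales (rule mean_M)

text \<open>By continuity \<open>Re (f x) \<ge> c\<close> on a neighborhood of
  \<open>\<one>\<close>, and finitely many translates of it cover the group. So a finite sum of
  translates of \<open>f\<close> has real part at least \<open>c\<close> everywhere, and by
  invariance each summand has the mean of \<open>f\<close>.\<close>

lemma mean_pos:
  assumes f: "ucont f" "\<And>x. x \<in> carrier G \<Longrightarrow> 0 \<le> Re (f x)" and "Re (f \<one>) > 0"
  shows "Re (M f) > 0"
proof -
  define c where "c = Re (f \<one>) / 2"
  have c: "c > 0" using assms by (simp add: c_def)
  obtain U where U: "openin T U" "\<one> \<in> U" "\<And>x u. x \<in> carrier G \<Longrightarrow> u \<in> U \<Longrightarrow> cmod (f (x \<otimes> u) - f x) \<le> c"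
    using ucontE1[OF f(1) c] by blast
  obtain A where A: "finite A" "A \<subseteq> carrier G" "\<And>x. x \<in> carrier G \<Longrightarrow> \<exists>a\<in>A. inv a \<otimes> x \<in> U"
    using totally_bounded[OF U(1,2)] by auto
  have fU: "Re (f u) \<ge> c" if "u \<in> U" for u
  proof -
    have "u \<in> carrier G" using that openin_subset_carrier[OF U(1)] by blast
    then have "cmod (f u - f \<one>) \<le> c" using U(3)[of \<one> u] that by simp
    then show ?thesis using abs_Re_le_cmod[of "f u - f \<one>"] by (simp add: c_def)
  qed
  have bd: "bounded_fun (carrier G) (\<lambda>x. f (inv a \<otimes> x))" if "a \<in> A" for a
    using ucont_bounded[OF ucont_left_translate[OF f(1)]] that A(2) by auto
  have "Re (M (\<lambda>x. of_real c)) \<le> Re (M (\<lambda>x. \<Sum>a\<in>A. f (inv a \<otimes> x)))"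
  proof (rule mean.mono)
    fix x assume x: "x \<in> carrier G"
    then obtain a where a: "a \<in> A" "inv a \<otimes> x \<in> U" using A(3) by blast
    have "Re (f (inv a \<otimes> x)) \<le> (\<Sum>a\<in>A. Re (f (inv a \<otimes> x)))"
      using a A x f(2) by (intro member_le_sum) auto
    then show "Re (of_real c) \<le> Re (\<Sum>a\<in>A. f (inv a \<otimes> x))" using fU[OF a(2)] by simp
  qed (auto intro: bounded_fun_sum bd)
  also have "\<dots> = (\<Sum>a\<in>A. Re (M f))"
    using A(2) bd by (subst mean.sum) (auto simp: invariant[OF f(1)] subset_iff)
  finally have "c \<le> real (card A) * Re (M f)" by (simp add: mean.const)
  then show ?thesis using c by (metis less_le_trans mult_le_0_iff not_less of_nat_0_le_iff)
qed

text \<open>The mean need not be invariant on indicator functions, but it is finitely additive there, so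
  that one of the finitely many translates covering the group has positive mass.\<close>

lemma translate_positive_mass:
  assumes "openin T U" "\<one> \<in> U"
  shows "\<exists>a\<in>carrier G. 0 < Re (M (\<lambda>x. if inv a \<otimes> x \<in> U then 1 else 0))"
proof -
  obtain A where A: "finite A" "A \<subseteq> carrier G" "\<And>x. x \<in> carrier G \<Longrightarrow> \<exists>a\<in>A. inv a \<otimes> x \<in> U"
    using totally_bounded[OF assms] by auto
  define f where "f a x = (if inv a \<otimes> x \<in> U then 1 else 0 :: complex)" for a x
  have bd: "bounded_fun (carrier G) (f a)" for a
    by (rule bounded_funI[of _ _ 1]) (simp add: f_def)
  have "Re (M (\<lambda>x. 1)) \<le> Re (M (\<lambda>x. \<Sum>a\<in>A. f a x))"
  proof (rule mean.mono)
    fix x assume "x \<in> carrier G"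
    then obtain a where a: "a \<in> A" "inv a \<otimes> x \<in> U" using A(3) by blast
    have "Re (f a x) \<le> (\<Sum>a\<in>A. Re (f a x))"
      using a A by (intro member_le_sum) (auto simp: f_def)
    then show "Re 1 \<le> Re (\<Sum>a\<in>A. f a x)" using a by (simp add: f_def)
  qed (auto intro: bounded_fun_sum bd)
  then have "1 \<le> (\<Sum>a\<in>A. Re (M (f a)))" using bd by (simp add: mean.const mean.sum)
  have "\<exists>a\<in>A. 0 < Re (M (f a))"
  proof (rule ccontr)
    assume "\<not> (\<exists>a\<in>A. 0 < Re (M (f a)))"
    then have "(\<Sum>a\<in>A. Re (M (f a))) \<le> 0" by (intro sum_nonpos) (auto simp: not_less)
    with \<open>1 \<le> (\<Sum>a\<in>A. Re (M (f a)))\<close> show False by simp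
  qed
  then show ?thesis using A(2) unfolding f_def[abs_def] by blast
qed

end

section \<open>Irreducible representations\<close>

locale irrep = invariant_mean_group G T M for G (structure) and T and M +
  fixes H :: "'h hilbert" and \<sigma>
  assumes irreducible: "irreducible_rep G T (H, \<sigma>)"
begin

sublocale hs: complex_hilbert_space H
  using irreducible by (simp add: irreducible_rep_def unitary_rep_def)

lemma rep_unitary: "x \<in> carrier G \<Longrightarrow> \<sigma> x \<in> unitaries H"
  using irreducible by (auto simp: irreducible_rep_def unitary_rep_def unitary_group_def hom_def)

lemma rep_closed [simp]: "x \<in> carrier G \<Longrightarrow> v \<in> carrier H \<Longrightarrow> \<sigma> x v \<in> carrier H"
  using irreducible_rep_closed[OF irreducible] .

lemma rep_add: "\<lbrakk>x \<in> carrier G; u \<in> carrier H; v \<in> carrier H\<rbrakk> \<Longrightarrow>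
    \<sigma> x (u \<oplus>\<^bsub>H\<^esub> v) = \<sigma> x u \<oplus>\<^bsub>H\<^esub> \<sigma> x v"
  using rep_unitary[of x] by (simp add: unitaries_def linear_map_def)

lemma rep_smult: "\<lbrakk>x \<in> carrier G; u \<in> carrier H\<rbrakk> \<Longrightarrow> \<sigma> x (c \<odot>\<^bsub>H\<^esub> u) = c \<odot>\<^bsub>H\<^esub> \<sigma> x u"
  using rep_unitary[of x] by (simp add: unitaries_def linear_map_def)

lemma rep_diff: "\<lbrakk>x \<in> carrier G; u \<in> carrier H; v \<in> carrier H\<rbrakk> \<Longrightarrow>
    \<sigma> x (u \<ominus>\<^bsub>H\<^esub> v) = \<sigma> x u \<ominus>\<^bsub>H\<^esub> \<sigma> x v"
  by (simp add: hs.form.minus_eq_smult rep_add rep_smult)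

lemma rep_zero: "x \<in> carrier G \<Longrightarrow> \<sigma> x \<zero>\<^bsub>H\<^esub> = \<zero>\<^bsub>H\<^esub>"
  using rep_smult[of x "\<zero>\<^bsub>H\<^esub>" 0] hs.smult_l_null[of "\<zero>\<^bsub>H\<^esub>"] hs.smult_l_null[of "\<sigma> x \<zero>\<^bsub>H\<^esub>"] by simp

lemma rep_norm: "x \<in> carrier G \<Longrightarrow> v \<in> carrier H \<Longrightarrow> hnorm H (\<sigma> x v) = hnorm H v"
proof -
  assume a: "x \<in> carrier G" "v \<in> carrier H"
  have "hdist H (\<sigma> x v) (\<sigma> x \<zero>\<^bsub>H\<^esub>) = hdist H v \<zero>\<^bsub>H\<^esub>"
    using rep_unitary[OF a(1)] a(2) by (simp add: unitaries_def)
  then show ?thesis using a by (simp add: hs.hdist_eq rep_zero hs.hnorm_diff_zero)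
qed

text \<open>Unitaries are defined by preservation of distances. Polarization recovers the real part
  of the inner product, and multiplying \<open>u\<close> by \<open>\<i>\<close> recovers the
  imaginary part.\<close>

lemma rep_cinner:
  assumes x: "x \<in> carrier G" and u: "u \<in> carrier H" and v: "v \<in> carrier H"
  shows "cinner H (\<sigma> x u) (\<sigma> x v) = cinner H u v"
proof -
  have Re: "Re (cinner H (\<sigma> x u) (\<sigma> x v)) = Re (cinner H u v)" if "u \<in> carrier H" for u
  proof -
    have "(hnorm H (\<sigma> x (u \<oplus>\<^bsub>H\<^esub> v)))\<^sup>2 = (hnorm H (u \<oplus>\<^bsub>H\<^esub> v))\<^sup>2" using that v x
      by (simp add: rep_norm)
    moreover have exp: "(hnorm H (a \<oplus>\<^bsub>H\<^esub> c))\<^sup>2 = (hnorm H a)\<^sup>2 + (hnorm H c)\<^sup>2 + 2 * Re (cinner H a c)"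
      if "a \<in> carrier H" "c \<in> carrier H" for a c
      using that hs.cinner_commute[OF that]
        by (simp add: hs.hnorm_sq hs.form.add_left hs.form.add_right)
    ultimately show ?thesis using that v x by (simp add: rep_add rep_norm)
  qed
  have "Re (\<i> * cinner H (\<sigma> x u) (\<sigma> x v)) = Re (\<i> * cinner H u v)"
    using Re[of "\<i> \<odot>\<^bsub>H\<^esub> u"] u v x by (simp add: rep_smult hs.form.smult_left)
  then show ?thesis using Re[OF u] by (simp add: complex_eq_iff)
qed

lemma rep_mult:
  assumes "x \<in> carrier G" "y \<in> carrier G" "v \<in> carrier H"
  shows "\<sigma> (x \<otimes> y) v = \<sigma> x (\<sigma> y v)"
proof -
  \<comment> \<open>Multiplication in \<open>BijGroup\<close> is restricted to \<open>Bij\<close>,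
    so membership is needed before it unfolds to \<open>compose\<close>.\<close>
  have Bij: "\<sigma> z \<in> Bij (carrier H)" if "z \<in> carrier G" for z
  proof -
    have "inj_on (\<sigma> z) (carrier H)"
    proof (rule inj_onI)
      fix u w assume uw: "u \<in> carrier H" "w \<in> carrier H" "\<sigma> z u = \<sigma> z w"
      have "hdist H (\<sigma> z u) (\<sigma> z w) = hdist H u w"
        using rep_unitary[OF that] uw(1,2) by (simp add: unitaries_def)
      moreover have "hdist H (\<sigma> z w) (\<sigma> z w) = 0"
        using Metric_space.zero[OF hs.Metric_space_hdist, of "\<sigma> z w" "\<sigma> z w"] that uw(2) by simp
      ultimately have "hdist H u w = 0" unfolding uw(3) by simp
      then show "u = w" using Metric_space.zero[OF hs.Metric_space_hdist, of u w] uw(1,2) by simp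
    qed
    then show ?thesis using rep_unitary[OF that] by (auto simp: Bij_def bij_betw_def unitaries_def)
  qed
  have "\<sigma> (x \<otimes> y) = compose (carrier H) (\<sigma> x) (\<sigma> y)"
    using irreducible assms Bij
    by (auto simp: irreducible_rep_def unitary_rep_def unitary_group_def hom_def BijGroup_def)
  then show ?thesis using assms(3) by (simp add: compose_def)
qed

text \<open>An idempotent surjective map is the identity.\<close>

lemma rep_one: 
  assumes v: "v \<in> carrier H"
  shows "\<sigma> \<one> v = v"
proof (rule hs.eq_by_cinner)
  fix w assume w: "w \<in> carrier H"
  obtain w' where w': "w' \<in> carrier H" "w = \<sigma> \<one> w'"
  proof -
    have "\<sigma> \<one> ` carrier H = carrier H" using rep_unitary[of \<one>] by (simp add: unitaries_def)
    then have "w \<in> \<sigma> \<one> ` carrier H" using w by simp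
    then show ?thesis using that by blast
  qed
  have "cinner H (\<sigma> \<one> v) (\<sigma> \<one> w') = cinner H (\<sigma> \<one> (\<sigma> \<one> v)) (\<sigma> \<one> w')"
    using rep_mult[of \<one> \<one> v] v by simp
  also have "\<dots> = cinner H (\<sigma> \<one> v) w'" using rep_cinner w' v by simp
  finally have 1: "cinner H (\<sigma> \<one> v) w = cinner H (\<sigma> \<one> v) w'" using w' by simp
  have "\<sigma> \<one> w = w" using w' rep_mult[of \<one> \<one> w'] by simp
  then show "cinner H (\<sigma> \<one> v) w = cinner H v w" using rep_cinner[of \<one> v w] v w by simp
qed (use v in auto)

lemma rep_adjoint:
  assumes "x \<in> carrier G" "u \<in> carrier H" "v \<in> carrier H"
  shows "cinner H u (\<sigma> x v) = cinner H (\<sigma> (inv x) u) v"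
  using rep_cinner[of "inv x" u "\<sigma> x v"] rep_mult[of "inv x" x v] rep_one[of v] assms by simp

lemma rep_continuous:
  assumes v: "v \<in> carrier H" and "e > 0"
  shows "\<exists>U. openin T U \<and> \<one> \<in> U \<and> (\<forall>u\<in>U. hnorm H (\<sigma> u v \<ominus>\<^bsub>H\<^esub> v) < e)"
proof -
  interpret Metric_space "carrier H" "hdist H" by (rule hs.Metric_space_hdist)
  have "continuous_map T (product_topology (\<lambda>_. htopology H) (carrier H)) \<sigma>"
    using irreducible
    by (simp add: irreducible_rep_def unitary_rep_def strong_operator_topology_def continuous_map_in_subtopology)
  then have cont: "continuous_map T (htopology H) (\<lambda>x. \<sigma> x v)"
    using v by (simp add: continuous_map_componentwise)
  define U where "U = {x \<in> topspace T. \<sigma> x v \<in> mball v e}"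
  have "openin T U" unfolding U_def by (rule openin_continuous_map_preimage[OF cont openin_mball])
  moreover have "\<one> \<in> U" using v \<open>e > 0\<close> by (simp add: U_def topspace_eq_carrier rep_one)
  moreover have "hnorm H (\<sigma> u v \<ominus>\<^bsub>H\<^esub> v) < e" if "u \<in> U" for u
  proof -
    have "\<sigma> u v \<in> carrier H" "hdist H v (\<sigma> u v) < e" using that v by (auto simp: U_def)
    then show ?thesis using v commute[of v "\<sigma> u v"] by (simp add: hs.hdist_eq)
  qed
  ultimately show ?thesis by blast
qed

text \<open>Right translation by \<open>y\<close> replaces the vector \<open>u\<close> by
  \<open>\<sigma> y u\<close>, and since \<open>\<sigma> x\<close> is isometric the resulting
  estimate does not depend on \<open>x\<close>.\<close>

lemma ucont_coefficient:
  assumes u: "u \<in> carrier H" and w: "w \<in> carrier H"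
  shows "ucont (\<lambda>x. cinner H (\<sigma> x u) w)"
proof (rule ucontI)
  show "bounded_fun (carrier G) (\<lambda>x. cinner H (\<sigma> x u) w)"
  proof (rule bounded_funI)
    fix x assume x: "x \<in> carrier G"
    show "cmod (cinner H (\<sigma> x u) w) \<le> hnorm H u * hnorm H w"
      using hs.cinner_bound[of "\<sigma> x u" w] u w x by (simp add: rep_norm)
  qed
  fix e :: real assume e: "e > 0"
  define e' where "e' = e / (hnorm H w + 1)"
  have nw: "hnorm H w \<ge> 0" by (rule hs.hnorm_nonneg[OF w])
  have e': "e' > 0" using e nw by (simp add: e'_def)
  obtain U where U: "openin T U" "\<one> \<in> U" "\<And>y. y \<in> U \<Longrightarrow> hnorm H (\<sigma> y u \<ominus>\<^bsub>H\<^esub> u) < e'"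
    using rep_continuous[OF u e'] by blast
  have "cmod (cinner H (\<sigma> (x \<otimes> y) u) w - cinner H (\<sigma> x u) w) \<le> e" if x: "x \<in> carrier G"
    and y: "y \<in> U" for x y
  proof -
    have yc: "y \<in> carrier G" using y openin_subset_carrier[OF U(1)] by blast
    have d: "\<sigma> y u \<ominus>\<^bsub>H\<^esub> u \<in> carrier H" using yc u by simp
    have "cinner H (\<sigma> (x \<otimes> y) u) w - cinner H (\<sigma> x u) w = cinner H (\<sigma> x (\<sigma> y u \<ominus>\<^bsub>H\<^esub> u)) w"
      using x yc u w by (simp add: rep_diff rep_mult hs.form.diff_left)
    also have "cmod \<dots> \<le> hnorm H (\<sigma> y u \<ominus>\<^bsub>H\<^esub> u) * hnorm H w"
      using hs.cinner_bound[of "\<sigma> x (\<sigma> y u \<ominus>\<^bsub>H\<^esub> u)" w] d x w by (simp add: rep_norm)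
    also have "\<dots> \<le> e' * (hnorm H w + 1)" using U(3)[OF y] nw e' by (intro mult_mono) auto
    also have "\<dots> = e" using nw by (simp add: e'_def)
    finally show ?thesis .
  qed
  then show "\<exists>U. openin T U \<and> \<one> \<in> U \<and>
      (\<forall>x\<in>carrier G. \<forall>u'\<in>U. cmod (cinner H (\<sigma> (x \<otimes> u') u) w - cinner H (\<sigma> x u) w) \<le> e)"
    using U by blast
qed

lemma ucont_coefficient_right:
  assumes u: "u \<in> carrier H" and w: "w \<in> carrier H"
  shows "ucont (\<lambda>x. cinner H w (\<sigma> x u))"
  by (rule ucont_cong[OF ucont_cnj[OF ucont_coefficient[OF u w]]])
    (use u w in \<open>simp add: hs.cinner_commute[of _ w]\<close>)

text \<open>The common kernel is closed and invariant, and \<open>u\<close> keeps it from being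
  trivial, so irreducibility leaves only the whole space. Every appeal to the absence of invariant
  subspaces passes through this fact.\<close>

lemma invariant_kernel:
  assumes lin: "\<And>l x y. l \<in> L \<Longrightarrow> x \<in> carrier H \<Longrightarrow> y \<in> carrier H \<Longrightarrow> l (x \<oplus>\<^bsub>H\<^esub> y) = l x + l y"
      "\<And>l x a. l \<in> L \<Longrightarrow> x \<in> carrier H \<Longrightarrow> l (a \<odot>\<^bsub>H\<^esub> x) = a * l x"
    and bd: "\<And>l. l \<in> L \<Longrightarrow> \<exists>c. \<forall>x\<in>carrier H. cmod (l x) \<le> c * hnorm H x"
    and inv: "\<And>g x l. g \<in> carrier G \<Longrightarrow> x \<in> carrier H \<Longrightarrow> (\<And>l. l \<in> L \<Longrightarrow> l x = 0) \<Longrightarrow> l \<in> L \<Longrightarrow> l (\<sigma> g x) = 0"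
    and u: "u \<in> carrier H" "u \<noteq> \<zero>\<^bsub>H\<^esub>" "\<And>l. l \<in> L \<Longrightarrow> l u = 0"
    and w: "w \<in> carrier H" and l: "l \<in> L"
  shows "l w = (0 :: complex)"
proof -
  define E where "E = {x \<in> carrier H. \<forall>l\<in>L. l x = 0}"
  have E: "submodule E complex_ring H" "closedin (htopology H) E"
    using hs.closed_submodule_kernel[OF lin bd] by (auto simp: E_def)
  have "\<zero>\<^bsub>H\<^esub> \<in> E" using submodule.axioms(1)[OF E(1)] subgroup.one_closed by fastforce
  then have "{\<zero>\<^bsub>H\<^esub>} \<subset> E" using u by (auto simp: E_def)
  moreover have "\<sigma> g ` E \<subseteq> E" if "g \<in> carrier G" for g
    using that inv by (auto simp: E_def)
  ultimately have "\<not> E \<subset> carrier H"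
    using irreducible E unfolding irreducible_rep_def by blast
  then have "E = carrier H" by (auto simp: E_def)
  then show ?thesis using w l by (auto simp: E_def)
qed

lemma nontrivial: "carrier H \<noteq> {\<zero>\<^bsub>H\<^esub>}"
  using irreducible by (simp add: irreducible_rep_def)

lemma ex_unit_vector: "\<exists>v\<in>carrier H. hnorm H v = 1"
proof -
  obtain w where w: "w \<in> carrier H" "w \<noteq> \<zero>\<^bsub>H\<^esub>" using nontrivial hs.M.zero_closed by blast
  then have "hnorm H ((1 / of_real (hnorm H w)) \<odot>\<^bsub>H\<^esub> w) = 1"
    using hs.hnorm_eq_0_iff[of w] hs.hnorm_nonneg[of w] by (simp add: hs.hnorm_smult norm_divide)
  then show ?thesis using w(1) by blast
qed

text \<open>The eigenspace of the largest eigenvalue is closed and invariant.\<close>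

lemma Schur_form:
  assumes "psd_form H b"
    and compact: "\<And>\<eta>. \<eta> > 0 \<Longrightarrow> \<exists>A K. finite A \<and> A \<subseteq> carrier H \<and>
      (\<forall>u\<in>carrier H. Re (b u u) \<le> K * (\<Sum>a\<in>A. (cmod (cinner H u a))\<^sup>2) + \<eta> * (hnorm H u)\<^sup>2)"
    and inv: "\<And>x u w. x \<in> carrier G \<Longrightarrow> u \<in> carrier H \<Longrightarrow> w \<in> carrier H \<Longrightarrow> b (\<sigma> x u) (\<sigma> x w) = b u w"
  shows "\<exists>c\<ge>0. \<forall>u\<in>carrier H. \<forall>w\<in>carrier H. b u w = of_real c * cinner H u w"
proof -
  interpret b: psd_form H b by fact
  obtain v where v: "v \<in> carrier H" "hnorm H v = 1"
    "\<And>w. w \<in> carrier H \<Longrightarrow> Re (b w w) \<le> Re (b v v) * (hnorm H w)\<^sup>2"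
    using hs.maximum_attained[OF assms(1) compact nontrivial] by blast
  define c where "c = Re (b v v)"
  have c: "c \<ge> 0" by (simp add: c_def b.nonneg v)
  interpret q: psd_form H "\<lambda>x y. of_real c * cinner H x y - b x y"
  proof
    fix x y assume "x \<in> carrier H" "y \<in> carrier H"
    then show "of_real c * cinner H y x - b y x = cnj (of_real c * cinner H x y - b x y)"
      using b.commute[of x y] hs.cinner_commute[of x y] by simp
  next
    fix x assume "x \<in> carrier H"
    then show "0 \<le> Re (of_real c * cinner H x x - b x x)"
      using v(3)[of x] by (simp add: hs.hnorm_sq c_def)
  qed (auto simp: hs.form.add_left b.add_left hs.form.smult_left b.smult_left algebra_simps)
  \<comment> \<open>The common kernel of these functionals is the radical of the form
    \<open>q\<close>, that is, the eigenspace.\<close>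
  define L where "L = (\<lambda>w u. of_real c * cinner H u w - b u w) ` carrier H"
  have zero: "l w = 0" if "w \<in> carrier H" "l \<in> L" for w l
  proof (rule invariant_kernel[of L v])
    fix l assume "l \<in> L"
    then obtain y where y: "y \<in> carrier H" "l = (\<lambda>u. of_real c * cinner H u y - b u y)"
      by (auto simp: L_def)
    have "cmod (l x) \<le> (2 * c * hnorm H y) * hnorm H x" if x: "x \<in> carrier H" for x
    proof -
      have "(cmod (b x y))\<^sup>2 \<le> Re (b x x) * Re (b y y)" by (rule b.Cauchy_Schwarz[OF x y(1)])
      also have "\<dots> \<le> (c * (hnorm H x)\<^sup>2) * (c * (hnorm H y)\<^sup>2)"
        using v(3)[OF x] v(3)[OF y(1)] b.nonneg[OF x] b.nonneg[OF y(1)] c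
          by (intro mult_mono) (auto simp: c_def)
      also have "\<dots> = (c * hnorm H x * hnorm H y)\<^sup>2" by (simp add: power2_eq_square algebra_simps)
      finally have "cmod (b x y) \<le> c * hnorm H x * hnorm H y"
        by (rule power2_le_imp_le) (use c x y in \<open>simp add: hs.hnorm_nonneg\<close>)
      moreover have "cmod (of_real c * cinner H x y) \<le> c * (hnorm H x * hnorm H y)"
        using hs.cinner_bound[OF x y(1)] c by (simp add: norm_mult mult_left_mono)
      ultimately show ?thesis
        using norm_triangle_ineq4[of "of_real c * cinner H x y" "b x y"] y(2)
          by (simp add: algebra_simps)
    qed
    then show "\<exists>c. \<forall>x\<in>carrier H. cmod (l x) \<le> c * hnorm H x" by blast
    \<comment> \<open>The form \<open>q\<close> vanishes at the maximizing vector \<open>v\<close>,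
      so by Cauchy-Schwarz \<open>v\<close> lies in its radical.\<close>
    have "(cmod (of_real c * cinner H v y - b v y))\<^sup>2 \<le> 0"
      using q.Cauchy_Schwarz[OF v(1) y(1)] v(1,2) hs.hnorm_sq[OF v(1)] by (simp add: c_def)
    then show "l v = 0" by (simp add: y)
  next
    fix l x y assume "l \<in> L" "x \<in> carrier H" "y \<in> carrier H"
    then show "l (x \<oplus>\<^bsub>H\<^esub> y) = l x + l y" by (auto simp: L_def q.add_left)
  next
    fix l x a assume "l \<in> L" "x \<in> carrier H"
    then show "l (a \<odot>\<^bsub>H\<^esub> x) = a * l x" by (auto simp: L_def q.smult_left)
  next
    fix g x l assume g: "g \<in> carrier G" and x: "x \<in> carrier H" and z: "\<And>l. l \<in> L \<Longrightarrow> l x = 0"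
      and l: "l \<in> L"
    then obtain y where y: "y \<in> carrier H" "l = (\<lambda>u. of_real c * cinner H u y - b u y)"
      by (auto simp: L_def)
    \<comment> \<open>Invariance moves \<open>g\<close> to the other argument, where
      \<open>\<sigma> (inv g) y\<close> is again a test vector.\<close>
    have eq: "\<sigma> g (\<sigma> (inv g) y) = y" using rep_mult[of g "inv g" y] g y by (simp add: rep_one)
    have "of_real c * cinner H x (\<sigma> (inv g) y) - b x (\<sigma> (inv g) y) = 0"
      using z[of "\<lambda>u. of_real c * cinner H u (\<sigma> (inv g) y) - b u (\<sigma> (inv g) y)"] g y
        by (auto simp: L_def)
    then show "l (\<sigma> g x) = 0"
      using inv[of g x "\<sigma> (inv g) y"] rep_cinner[of g x "\<sigma> (inv g) y"] g x y eq by simp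
  next
    show "v \<noteq> \<zero>\<^bsub>H\<^esub>" using v(2) hs.hnorm_eq_0_iff[OF v(1)] by auto
  qed (use that v in auto)
  have "b u w = of_real c * cinner H u w" if "u \<in> carrier H" "w \<in> carrier H" for u w
    using zero[of u "\<lambda>u. of_real c * cinner H u w - b u w"] that by (auto simp: L_def)
  then show ?thesis using c by blast
qed

end

section \<open>Finite dimensionality of irreducible representations\<close>

context irrep
begin

text \<open>The form of the averaged rank one operators
  \<open>u \<mapsto> (u, \<sigma> x v) \<sigma> x v\<close>. It is invariant because
  \<open>M\<close> is invariant under substituting \<open>inv y \<otimes> x\<close> for
  \<open>x\<close>.\<close>

lemma orbit_form:
  assumes v: "v \<in> carrier H"
  defines "b \<equiv> \<lambda>u w. M (\<lambda>x. cinner H u (\<sigma> x v) * cnj (cinner H w (\<sigma> x v)))"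
  shows "psd_form H b" "\<And>u. u \<in> carrier H \<Longrightarrow> Re (b u u) = Re (M (\<lambda>x. of_real ((cmod (cinner H u (\<sigma> x v)))\<^sup>2)))"
    "\<And>x u w. x \<in> carrier G \<Longrightarrow> u \<in> carrier H \<Longrightarrow> w \<in> carrier H \<Longrightarrow> b (\<sigma> x u) (\<sigma> x w) = b u w"
proof -
  have uc: "ucont (\<lambda>x. cinner H u (\<sigma> x v) * cnj (cinner H w (\<sigma> x v)))"
    if "u \<in> carrier H" "w \<in> carrier H" for u w
    using that v by (intro ucont_mult ucont_cnj ucont_coefficient_right)
  have sq: "(\<lambda>x. cinner H u (\<sigma> x v) * cnj (cinner H u (\<sigma> x v))) =
      (\<lambda>x. of_real ((cmod (cinner H u (\<sigma> x v)))\<^sup>2))" for u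
    by (simp only: complex_norm_square)
  show re: "Re (b u u) = Re (M (\<lambda>x. of_real ((cmod (cinner H u (\<sigma> x v)))\<^sup>2)))"
    if "u \<in> carrier H" for u
    unfolding b_def sq ..
  show "psd_form H b"
  proof
    fix x y z assume xyz: "x \<in> carrier H" "y \<in> carrier H" "z \<in> carrier H"
    have "b (x \<oplus>\<^bsub>H\<^esub> y) z = M (\<lambda>g. cinner H x (\<sigma> g v) * cnj (cinner H z (\<sigma> g v)) +
        cinner H y (\<sigma> g v) * cnj (cinner H z (\<sigma> g v)))"
      unfolding b_def
      by (rule mean.cong[OF ucont_bounded[OF uc]])
        (use xyz v in \<open>auto simp: hs.form.add_left algebra_simps\<close>)
    also have "\<dots> = b x z + b y z"
      unfolding b_def by (rule mean.add) (use xyz uc ucont_bounded in auto)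
    finally show "b (x \<oplus>\<^bsub>H\<^esub> y) z = b x z + b y z" .
  next
    fix x y a assume xy: "x \<in> carrier H" "y \<in> carrier H"
    have "b (a \<odot>\<^bsub>H\<^esub> x) y = M (\<lambda>g. a * (cinner H x (\<sigma> g v) * cnj (cinner H y (\<sigma> g v))))"
      unfolding b_def
      by (rule mean.cong[OF ucont_bounded[OF uc]])
        (use xy v in \<open>auto simp: hs.form.smult_left\<close>)
    also have "\<dots> = a * b x y"
      unfolding b_def by (rule mean.cmult) (use xy uc ucont_bounded in auto)
    finally show "b (a \<odot>\<^bsub>H\<^esub> x) y = a * b x y" .
  next
    fix x y assume xy: "x \<in> carrier H" "y \<in> carrier H"
    have "cnj (b x y) = M (\<lambda>g. cnj (cinner H x (\<sigma> g v) * cnj (cinner H y (\<sigma> g v))))"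
      unfolding b_def by (rule mean.cnj[symmetric]) (use xy uc ucont_bounded in auto)
    then show "b y x = cnj (b x y)" by (simp add: b_def mult.commute)
  next
    fix x assume x: "x \<in> carrier H"
    have "bounded_fun (carrier G) (\<lambda>g. of_real ((cmod (cinner H x (\<sigma> g v)))\<^sup>2))"
      using ucont_bounded[OF uc[OF x x]] unfolding sq .
    then show "0 \<le> Re (b x x)" unfolding re[OF x] by (rule mean.nonneg) simp_all
  qed
  fix y u w assume y: "y \<in> carrier G" and uw: "u \<in> carrier H" "w \<in> carrier H"
  let ?f = "\<lambda>x. cinner H u (\<sigma> x v) * cnj (cinner H w (\<sigma> x v))"
  have "b (\<sigma> y u) (\<sigma> y w) = M (\<lambda>x. ?f (inv y \<otimes> x))"
    unfolding b_def
  proof (rule mean.cong[OF ucont_bounded[OF uc]])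
    fix x assume x: "x \<in> carrier G"
    have "cinner H (\<sigma> y u) (\<sigma> x v) = cinner H u (\<sigma> (inv y \<otimes> x) v)" if "u \<in> carrier H" for u
      using that rep_adjoint[of "inv y" u "\<sigma> x v"] rep_mult[of "inv y" x v] x y v by simp
    then show "cinner H (\<sigma> y u) (\<sigma> x v) * cnj (cinner H (\<sigma> y w) (\<sigma> x v)) =
        cinner H u (\<sigma> (inv y \<otimes> x) v) * cnj (cinner H w (\<sigma> (inv y \<otimes> x) v))" using uw by simp
  qed (use y uw in auto)
  also have "\<dots> = b u w" unfolding b_def by (rule invariant[OF uc[OF uw]]) (use y in simp)
  finally show "b (\<sigma> y u) (\<sigma> y w) = b u w" .
qed

text \<open>The orbit of \<open>v\<close> is totally bounded: every \<open>\<sigma> x v\<close> is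
  within \<open>e\<close> of one of finitely many vectors \<open>\<sigma> b v\<close>. Squaring a
  sum of two terms costs a factor \<open>2\<close>, whence
  \<open>e\<^sup>2 = \<eta> / 2\<close>.\<close>

lemma orbit_form_compact:
  assumes v: "v \<in> carrier H" and \<eta>: "\<eta> > 0"
  shows "\<exists>A K. finite A \<and> A \<subseteq> carrier H \<and> (\<forall>u\<in>carrier H.
    Re (M (\<lambda>x. of_real ((cmod (cinner H u (\<sigma> x v)))\<^sup>2))) \<le>
      K * (\<Sum>a\<in>A. (cmod (cinner H u a))\<^sup>2) + \<eta> * (hnorm H u)\<^sup>2)"
proof -
  define e where "e = sqrt (\<eta> / 2)"
  have e: "e > 0" "e\<^sup>2 = \<eta> / 2" using \<eta> by (auto simp: e_def)
  obtain U where U: "openin T U" "\<one> \<in> U" "\<And>y. y \<in> U \<Longrightarrow> hnorm H (\<sigma> y v \<ominus>\<^bsub>H\<^esub> v) < e"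
    using rep_continuous[OF v e(1)] by blast
  obtain B where B: "finite B" "B \<subseteq> carrier G" "\<And>x. x \<in> carrier G \<Longrightarrow> \<exists>b\<in>B. inv b \<otimes> x \<in> U"
    using totally_bounded[OF U(1,2)] by auto
  define A where "A = (\<lambda>b. \<sigma> b v) ` B"
  have A: "finite A" "A \<subseteq> carrier H" using B v by (auto simp: A_def)
  have "Re (M (\<lambda>x. of_real ((cmod (cinner H u (\<sigma> x v)))\<^sup>2))) \<le>
      2 * (\<Sum>a\<in>A. (cmod (cinner H u a))\<^sup>2) + \<eta> * (hnorm H u)\<^sup>2" if u: "u \<in> carrier H" for u
  proof -
    define c where "c = 2 * (\<Sum>a\<in>A. (cmod (cinner H u a))\<^sup>2) + \<eta> * (hnorm H u)\<^sup>2"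
    have "(cmod (cinner H u (\<sigma> x v)))\<^sup>2 \<le> c" if x: "x \<in> carrier G" for x
    proof -
      obtain b where b: "b \<in> B" "inv b \<otimes> x \<in> U" using B(3)[OF x] by blast
      have bc: "b \<in> carrier G" using b B(2) by auto
      have xb: "\<sigma> x v = \<sigma> b (\<sigma> (inv b \<otimes> x) v)"
        using rep_mult[of b "inv b \<otimes> x" v] bc x v by (simp add: m_assoc[symmetric])
      define d where "d = \<sigma> (inv b \<otimes> x) v \<ominus>\<^bsub>H\<^esub> v"
      have d: "d \<in> carrier H" "hnorm H d < e" using bc x v U(3)[OF b(2)] by (auto simp: d_def)
      have "cinner H u (\<sigma> x v) - cinner H u (\<sigma> b v) = cinner H u (\<sigma> b d)"
        using bc x v u by (simp add: xb d_def rep_diff hs.form.diff_right)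
      then have "cmod (cinner H u (\<sigma> x v)) \<le> cmod (cinner H u (\<sigma> b v)) + cmod (cinner H u (\<sigma> b d))"
        by (metis add.commute diff_add_cancel norm_triangle_ineq)
      also have "cmod (cinner H u (\<sigma> b d)) \<le> hnorm H u * e"
      proof -
        have "cmod (cinner H u (\<sigma> b d)) \<le> hnorm H u * hnorm H d"
          using hs.cinner_bound[OF u, of "\<sigma> b d"] d bc by (simp add: rep_norm)
        also have "\<dots> \<le> hnorm H u * e" using d hs.hnorm_nonneg[OF u] by (intro mult_left_mono) auto
        finally show ?thesis .
      qed
      finally have "(cmod (cinner H u (\<sigma> x v)))\<^sup>2 \<le> (cmod (cinner H u (\<sigma> b v)) + hnorm H u * e)\<^sup>2"
        by (intro power_mono) auto
      also have "\<dots> \<le> 2 * (cmod (cinner H u (\<sigma> b v)))\<^sup>2 + 2 * (hnorm H u * e)\<^sup>2"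
        using sum_squares_bound[of "cmod (cinner H u (\<sigma> b v))" "hnorm H u * e"]
          by (simp add: power2_sum)
      also have "2 * (hnorm H u * e)\<^sup>2 = \<eta> * (hnorm H u)\<^sup>2" by (simp add: power_mult_distrib e)
      also have "(cmod (cinner H u (\<sigma> b v)))\<^sup>2 \<le> (\<Sum>a\<in>A. (cmod (cinner H u a))\<^sup>2)"
        using b A by (intro member_le_sum) (auto simp: A_def)
      finally show ?thesis by (simp add: c_def)
    qed
    then have "cmod (M (\<lambda>x. of_real ((cmod (cinner H u (\<sigma> x v)))\<^sup>2))) \<le> c"
      by (intro mean.norm_le) (simp del: of_real_power)
    then show ?thesis using complex_Re_le_cmod order_trans unfolding c_def by blast
  qed
  then show ?thesis using A by blast
qed

theorem finite_dimensional: "\<exists>e n. hs.basis e n"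
proof -
  obtain v where v: "v \<in> carrier H" "hnorm H v = 1" using ex_unit_vector by blast
  define b where "b = (\<lambda>u w. M (\<lambda>x. cinner H u (\<sigma> x v) * cnj (cinner H w (\<sigma> x v))))"
  have b: "psd_form H b"
    "\<And>u. u \<in> carrier H \<Longrightarrow> Re (b u u) = Re (M (\<lambda>x. of_real ((cmod (cinner H u (\<sigma> x v)))\<^sup>2)))"
    "\<And>x u w. x \<in> carrier G \<Longrightarrow> u \<in> carrier H \<Longrightarrow> w \<in> carrier H \<Longrightarrow> b (\<sigma> x u) (\<sigma> x w) = b u w"
    unfolding b_def by (rule orbit_form[OF v(1)]; assumption)+
  obtain c where c: "c \<ge> 0" "\<And>u w. u \<in> carrier H \<Longrightarrow> w \<in> carrier H \<Longrightarrow> b u w = of_real c * cinner H u w"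
  proof -
    have "\<exists>c\<ge>0. \<forall>u\<in>carrier H. \<forall>w\<in>carrier H. b u w = of_real c * cinner H u w"
      by (rule Schur_form[OF b(1) _ b(3)]) (use orbit_form_compact[OF v(1)] b(2) in auto)
    then show ?thesis using that by blast
  qed
  have ucv: "ucont (\<lambda>x. cinner H v (\<sigma> x v) * cnj (cinner H v (\<sigma> x v)))"
    using v by (intro ucont_mult ucont_cnj ucont_coefficient_right)
  \<comment> \<open>The averaged function has the value \<open>1\<close> at \<open>\<one>\<close>,
    so strict positivity of the mean excludes \<open>c = 0\<close>.\<close>
  have "Re (b v v) > 0"
    unfolding b_def
  proof (rule mean_pos[OF ucv])
    fix x
    show "0 \<le> Re (cinner H v (\<sigma> x v) * cnj (cinner H v (\<sigma> x v)))"
      unfolding complex_norm_square[symmetric] by simp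
  next
    show "0 < Re (cinner H v (\<sigma> \<one> v) * cnj (cinner H v (\<sigma> \<one> v)))"
      using v hs.cinner_self[OF v(1)] by (simp add: rep_one)
  qed
  moreover have "b v v = of_real c" using c(2)[OF v(1) v(1)] hs.cinner_self[OF v(1)] v(2) by simp
  ultimately have "c > 0" by simp
  obtain N :: nat where N: "1 / c \<le> N" using real_arch_simple by blast
  \<comment> \<open>A trace computation: Bessel's inequality for the unit vectors
    \<open>\<sigma> x v\<close>, averaged over \<open>x\<close>, gives
    \<open>n * c \<le> 1\<close>.\<close>
  have "n \<le> N" if e: "hs.orthonormal e n" for e n
  proof -
    have ec: "e i \<in> carrier H" "cinner H (e i) (e i) = 1" if "i < n" for i
      using e that by (auto simp: hs.orthonormal_def)
    define g :: "nat \<Rightarrow> 'a \<Rightarrow> complex"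
      where "g i x = of_real ((cmod (cinner H (e i) (\<sigma> x v)))\<^sup>2)" for i x
    have bd: "bounded_fun (carrier G) (g i)" if "i < n" for i
      using ucont_bounded[OF ucont_mult[OF ucont_coefficient_right[OF v(1) ec(1)[OF that]]
            ucont_cnj[OF ucont_coefficient_right[OF v(1) ec(1)[OF that]]]]]
      unfolding g_def[abs_def] complex_norm_square .
    have "real n * c = (\<Sum>i<n. Re (b (e i) (e i)))" using ec c(2) by simp
    also have "\<dots> = (\<Sum>i<n. Re (M (g i)))"
      using ec(1) b(2) by (simp add: g_def[abs_def] del: of_real_power)
    also have "\<dots> = Re (M (\<lambda>x. \<Sum>i<n. g i x))"
      using bd by (subst mean.sum) auto
    also have "\<dots> \<le> Re (M (\<lambda>x. 1))"
    proof (rule mean.mono)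
      fix x assume x: "x \<in> carrier G"
      have "(\<Sum>i<n. (cmod (cinner H (e i) (\<sigma> x v)))\<^sup>2) = (\<Sum>i<n. (cmod (cinner H (\<sigma> x v) (e i)))\<^sup>2)"
      proof (rule sum.cong[OF refl])
        fix i assume "i \<in> {..<n}"
        then have "cinner H (e i) (\<sigma> x v) = cnj (cinner H (\<sigma> x v) (e i))"
          using hs.cinner_commute[of "\<sigma> x v" "e i"] x v ec by simp
        then show "(cmod (cinner H (e i) (\<sigma> x v)))\<^sup>2 = (cmod (cinner H (\<sigma> x v) (e i)))\<^sup>2" by simp
      qed
      also have "\<dots> \<le> (hnorm H (\<sigma> x v))\<^sup>2" by (rule hs.Bessel[OF e]) (use x v in simp)
      finally show "Re (\<Sum>i<n. g i x) \<le> Re 1" using x v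
        by (simp add: g_def rep_norm del: of_real_power)
    qed (use bd in \<open>auto intro: bounded_fun_sum\<close>)
    finally have "real n \<le> 1 / c" using \<open>c > 0\<close> by (simp add: mean.const field_simps)
    then show ?thesis using N by linarith
  qed
  then show ?thesis by (rule hs.ex_basis)
qed

end

section \<open>Orthogonality of coefficients of inequivalent representations\<close>

locale two_irreps = \<sigma>: irrep G T M H \<sigma> + \<tau>: irrep G T M K \<tau>
  for G (structure) and T M and H :: "'h hilbert" and \<sigma> and K :: "'k hilbert" and \<tau>
begin

text \<open>The mean of the product of two coefficients is a form in \<open>v\<close> and \<open>v'\<close>. It is represented by an
  intertwining operator, which by Schur's lemma is a multiple of an isometry onto the second space.\<close>

lemma orthogonality:
  assumes u: "u \<in> carrier H" "u' \<in> carrier K" and inequivalent: "\<not> equivalent_reps G (H, \<sigma>) (K, \<tau>)"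
    and v: "v \<in> carrier H" "v' \<in> carrier K"
  shows "M (\<lambda>x. cinner H (\<sigma> x u) v * cnj (cinner K (\<tau> x u') v')) = 0"
proof -
  \<comment> \<open>Conjugated so as to be linear in \<open>w\<close> and conjugate linear in
    \<open>w'\<close>, as a form \<open>(A w, w')\<close> has to be.\<close>
  define F where "F w w' = M (\<lambda>x. cnj (cinner H (\<sigma> x u) w) * cinner K (\<tau> x u') w')" for w w'
  have uc: "\<sigma>.ucont (\<lambda>x. cnj (cinner H (\<sigma> x u) w) * cinner K (\<tau> x u') w')"
    if "w \<in> carrier H" "w' \<in> carrier K" for w w'
    using that u by (intro \<sigma>.ucont_mult \<sigma>.ucont_cnj \<sigma>.ucont_coefficient \<tau>.ucont_coefficient)
  note bd = \<sigma>.ucont_bounded[OF uc]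
  have F_add: "F (w \<oplus>\<^bsub>H\<^esub> z) w' = F w w' + F z w'"
    if "w \<in> carrier H" "z \<in> carrier H" "w' \<in> carrier K" for w z w'
  proof -
    have "F (w \<oplus>\<^bsub>H\<^esub> z) w' = M (\<lambda>x. cnj (cinner H (\<sigma> x u) w) * cinner K (\<tau> x u') w' +
        cnj (cinner H (\<sigma> x u) z) * cinner K (\<tau> x u') w')"
      unfolding F_def by (rule \<sigma>.mean.cong[OF bd])
        (use that u in \<open>auto simp: \<sigma>.hs.form.add_right algebra_simps\<close>)
    also have "\<dots> = F w w' + F z w'"
      unfolding F_def by (rule \<sigma>.mean.add) (use that bd in auto)
    finally show ?thesis .
  qed
  have F_smult: "F (a \<odot>\<^bsub>H\<^esub> w) w' = a * F w w'" if "w \<in> carrier H" "w' \<in> carrier K" for a w w'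
  proof -
    have "F (a \<odot>\<^bsub>H\<^esub> w) w' = M (\<lambda>x. a * (cnj (cinner H (\<sigma> x u) w) * cinner K (\<tau> x u') w'))"
      unfolding F_def by (rule \<sigma>.mean.cong[OF bd])
        (use that u in \<open>auto simp: \<sigma>.hs.form.smult_right algebra_simps\<close>)
    also have "\<dots> = a * F w w'"
      unfolding F_def by (rule \<sigma>.mean.cmult) (use that bd in auto)
    finally show ?thesis .
  qed
  have F_sum: "F w (\<tau>.hs.lincomb c e n) = (\<Sum>j<n. cnj (c j) * F w (e j))"
    if w: "w \<in> carrier H" and e: "\<And>i. i < n \<Longrightarrow> e i \<in> carrier K" for w c e n
  proof -
    have "F w (\<tau>.hs.lincomb c e n) =
        M (\<lambda>x. \<Sum>j<n. cnj (c j) * (cnj (cinner H (\<sigma> x u) w) * cinner K (\<tau> x u') (e j)))"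
      unfolding F_def
    proof (rule \<sigma>.mean.cong[OF bd])
      fix x assume x: "x \<in> carrier G"
      have "cinner K (\<tau> x u') (\<tau>.hs.lincomb c e n) = cnj (\<Sum>j<n. c j * cinner K (e j) (\<tau> x u'))"
        using \<tau>.hs.cinner_lincomb[of n e "\<tau> x u'" c] e x u
          \<tau>.hs.cinner_commute[of "\<tau>.hs.lincomb c e n" "\<tau> x u'"] by simp
      also have "\<dots> = (\<Sum>j<n. cnj (c j) * cinner K (\<tau> x u') (e j))"
        using e x u by (auto simp: \<tau>.hs.cinner_commute[of _ "\<tau> x u'"] intro!: sum.cong)
      finally show "cnj (cinner H (\<sigma> x u) w) * cinner K (\<tau> x u') (\<tau>.hs.lincomb c e n) =
          (\<Sum>j<n. cnj (c j) * (cnj (cinner H (\<sigma> x u) w) * cinner K (\<tau> x u') (e j)))"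
        by (simp add: sum_distrib_left mult_ac)
    qed (use w e in auto)
    also have "\<dots> = (\<Sum>j<n. M (\<lambda>x. cnj (c j) * (cnj (cinner H (\<sigma> x u) w) * cinner K (\<tau> x u') (e j))))"
      by (rule \<sigma>.mean.sum) (use bd w e in \<open>auto intro: bounded_fun_mult\<close>)
    also have "\<dots> = (\<Sum>j<n. cnj (c j) * F w (e j))"
      unfolding F_def using bd w e by (intro sum.cong[OF refl] \<sigma>.mean.cmult) auto
    finally show ?thesis .
  qed
  have F_inv: "F (\<sigma> y w) (\<tau> y w') = F w w'"
    if y: "y \<in> carrier G" and w: "w \<in> carrier H" "w' \<in> carrier K" for y w w'
  proof -
    let ?f = "\<lambda>x. cnj (cinner H (\<sigma> x u) w) * cinner K (\<tau> x u') w'"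
    have "F (\<sigma> y w) (\<tau> y w') = M (\<lambda>x. ?f (inv y \<otimes> x))"
      unfolding F_def
    proof (rule \<sigma>.mean.cong[OF bd])
      fix x assume x: "x \<in> carrier G"
      have "cinner H (\<sigma> x u) (\<sigma> y w) = cinner H (\<sigma> (inv y \<otimes> x) u) w"
        using \<sigma>.rep_adjoint[of y "\<sigma> x u" w] \<sigma>.rep_mult[of "inv y" x u] x y w u by simp
      moreover have "cinner K (\<tau> x u') (\<tau> y w') = cinner K (\<tau> (inv y \<otimes> x) u') w'"
        using \<tau>.rep_adjoint[of y "\<tau> x u'" w'] \<tau>.rep_mult[of "inv y" x u'] x y w u by simp
      ultimately show "cnj (cinner H (\<sigma> x u) (\<sigma> y w)) * cinner K (\<tau> x u') (\<tau> y w') =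
          cnj (cinner H (\<sigma> (inv y \<otimes> x) u) w) * cinner K (\<tau> (inv y \<otimes> x) u') w'" by simp
    qed (use y w in auto)
    also have "\<dots> = F w w'" unfolding F_def by (rule \<sigma>.invariant[OF uc[OF w]]) (use y in simp)
    finally show ?thesis .
  qed
  obtain e n where e: "\<sigma>.hs.basis e n" using \<sigma>.finite_dimensional by blast
  obtain f k where f: "\<tau>.hs.basis f k" using \<tau>.finite_dimensional by blast
  have ec: "\<And>i. i < n \<Longrightarrow> e i \<in> carrier H" using e by (rule \<sigma>.hs.basis_closed)
  have fc: "\<And>i. i < k \<Longrightarrow> f i \<in> carrier K" using f by (rule \<tau>.hs.basis_closed)
  \<comment> \<open>The representing operator, written out in the orthonormal basis
    \<open>f\<close>.\<close>
  define A where "A w = \<tau>.hs.lincomb (\<lambda>j. F w (f j)) f k" for w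
  have Ac: "A w \<in> carrier K" for w using fc by (simp add: A_def)
  have AF: "cinner K (A w) w' = F w w'" if w: "w \<in> carrier H" "w' \<in> carrier K" for w w'
  proof -
    have "cinner K (A w) w' = (\<Sum>j<k. F w (f j) * cinner K (f j) w')"
      unfolding A_def using fc w by (intro \<tau>.hs.cinner_lincomb) auto
    also have "\<dots> = (\<Sum>j<k. cnj (cinner K w' (f j)) * F w (f j))"
      using fc w by (intro sum.cong) (auto simp: \<tau>.hs.cinner_commute[OF w(2)])
    also have "\<dots> = F w (\<tau>.hs.lincomb (\<lambda>j. cinner K w' (f j)) f k)"
      using F_sum[OF w(1) fc] by simp
    also have "\<tau>.hs.lincomb (\<lambda>j. cinner K w' (f j)) f k = w'"
      using f w by (metis \<tau>.hs.basis_def)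
    finally show ?thesis .
  qed
  have A_add: "A (w \<oplus>\<^bsub>H\<^esub> z) = A w \<oplus>\<^bsub>K\<^esub> A z" if "w \<in> carrier H" "z \<in> carrier H" for w z
    by (rule \<tau>.hs.eq_by_cinner) (use that Ac in \<open>auto simp: AF F_add \<tau>.hs.form.add_left\<close>)
  have A_smult: "A (a \<odot>\<^bsub>H\<^esub> w) = a \<odot>\<^bsub>K\<^esub> A w" if "w \<in> carrier H" for a w
    by (rule \<tau>.hs.eq_by_cinner) (use that Ac in \<open>auto simp: AF F_smult \<tau>.hs.form.smult_left\<close>)
  have A_rep: "A (\<sigma> y w) = \<tau> y (A w)" if y: "y \<in> carrier G" and w: "w \<in> carrier H" for y w
  proof (rule \<tau>.hs.eq_by_cinner)
    fix z assume z: "z \<in> carrier K"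
    have "\<tau> y (\<tau> (inv y) z) = z" using \<tau>.rep_mult[of y "inv y" z] y z by (simp add: \<tau>.rep_one)
    then have "cinner K (A (\<sigma> y w)) z = F w (\<tau> (inv y) z)"
      using AF[of "\<sigma> y w" z] F_inv[of y w "\<tau> (inv y) z"] y w z by simp
    also have "\<dots> = cinner K (\<tau> y (A w)) z"
      using AF[of w "\<tau> (inv y) z"] \<tau>.rep_adjoint[of "inv y" "A w" z] y w z Ac by simp
    finally show "cinner K (A (\<sigma> y w)) z = cinner K (\<tau> y (A w)) z" .
  qed (use y w Ac in auto)
  \<comment> \<open>The pulled back inner product is invariant since \<open>A\<close> intertwines
    and \<open>\<tau>\<close> is unitary, so \<open>Schur_form\<close> applies to it.\<close>
  define b where "b w z = cinner K (A w) (A z)" for w z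
  have form: "psd_form H b"
  proof
    fix x y assume "x \<in> carrier H" "y \<in> carrier H"
    show "b y x = cnj (b x y)" unfolding b_def by (rule \<tau>.hs.cinner_commute[OF Ac Ac])
  next
    fix x assume "x \<in> carrier H"
    show "0 \<le> Re (b x x)" unfolding b_def by (rule \<tau>.hs.form.nonneg[OF Ac])
  qed (auto simp: b_def A_add A_smult \<tau>.hs.form.add_left \<tau>.hs.form.smult_left Ac)
  have "\<exists>c\<ge>0. \<forall>u\<in>carrier H. \<forall>w\<in>carrier H. b u w = of_real c * cinner H u w"
  proof (rule \<sigma>.Schur_form[OF form])
    fix \<eta> :: real assume "\<eta> > 0"
    define C where "C = n * (\<Sum>i<n. \<Sum>j<n. cmod (b (e i) (e j)))"
    have "inj_on e {..<n}"
    proof (rule inj_onI)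
      fix i j assume ij: "i \<in> {..<n}" "j \<in> {..<n}" "e i = e j"
      show "i = j"
      proof (rule ccontr)
        assume "i \<noteq> j"
        then have "cinner H (e i) (e j) = 0" "cinner H (e i) (e i) = 1"
          using e ij(1,2) by (auto simp: \<sigma>.hs.basis_def \<sigma>.hs.orthonormal_def)
        then show False using ij(3) by simp
      qed
    qed
    then have "Re (b u u) \<le> C * (\<Sum>a\<in>e ` {..<n}. (cmod (cinner H u a))\<^sup>2) + \<eta> * (hnorm H u)\<^sup>2"
      if "u \<in> carrier H" for u
      using \<sigma>.hs.form_bound_basis[OF form e that] \<open>\<eta> > 0\<close>
      by (simp add: C_def sum.reindex add_increasing2)
    then show "\<exists>A K. finite A \<and> A \<subseteq> carrier H \<and> (\<forall>u\<in>carrier H.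
        Re (b u u) \<le> K * (\<Sum>a\<in>A. (cmod (cinner H u a))\<^sup>2) + \<eta> * (hnorm H u)\<^sup>2)"
      using ec by (intro exI[of _ "e ` {..<n}"] exI[of _ C]) auto
  next
    fix x w z assume "x \<in> carrier G" "w \<in> carrier H" "z \<in> carrier H"
    then show "b (\<sigma> x w) (\<sigma> x z) = b w z" by (simp add: b_def A_rep \<tau>.rep_cinner Ac)
  qed
  then obtain c where c: "c \<ge> 0"
    "\<And>w z. w \<in> carrier H \<Longrightarrow> z \<in> carrier H \<Longrightarrow> cinner K (A w) (A z) = of_real c * cinner H w z"
    unfolding b_def by blast
  have "c = 0"
  proof (rule ccontr)
    assume "c \<noteq> 0"
    then have cpos: "c > 0" using c(1) by simp
    \<comment> \<open>For positive \<open>c\<close> the rescaled operator is an isometric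
      intertwiner; once it is onto, it contradicts inequivalence.\<close>
    define N where "N w = (1 / of_real (sqrt c)) \<odot>\<^bsub>K\<^esub> A w" for w
    have Nc: "N w \<in> carrier K" for w using Ac by (simp add: N_def)
    have N_iso: "cinner K (N w) (N z) = cinner H w z" if "w \<in> carrier H" "z \<in> carrier H" for w z
    proof -
      have "of_real (sqrt c) * of_real (sqrt c) = (of_real c :: complex)"
        using cpos by (simp flip: of_real_mult)
      then show ?thesis using c(2)[OF that] cpos Ac
        by (simp add: N_def \<tau>.hs.form.smult_left \<tau>.hs.form.smult_right field_simps)
    qed
    have N_lin: "linear_map H K N"
      unfolding linear_map_def
    proof (intro conjI ballI allI Pi_I)
      fix w z assume "w \<in> carrier H" "z \<in> carrier H"
      then show "N (w \<oplus>\<^bsub>H\<^esub> z) = N w \<oplus>\<^bsub>K\<^esub> N z"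
        using Ac by (simp add: N_def A_add \<tau>.hs.smult_r_distr)
    next
      fix a w assume w: "w \<in> carrier H"
      show "N (a \<odot>\<^bsub>H\<^esub> w) = a \<odot>\<^bsub>K\<^esub> N w"
        by (rule \<tau>.hs.eq_by_cinner) (use w Ac in \<open>auto simp: N_def A_smult \<tau>.hs.form.smult_left\<close>)
    qed (rule Nc)
    have N_rep: "N (\<sigma> y w) = \<tau> y (N w)" if "y \<in> carrier G" "w \<in> carrier H" for y w
      using that Ac by (simp add: N_def A_rep \<tau>.rep_smult)
    have N_lincomb: "N (\<sigma>.hs.lincomb d e n) = \<tau>.hs.lincomb d (\<lambda>i. N (e i)) n" for d
    proof (rule \<tau>.hs.eq_by_cinner)
      fix z assume z: "z \<in> carrier K"
      have "i \<le> n \<Longrightarrow> cinner K (N (\<sigma>.hs.lincomb d e i)) z = (\<Sum>j<i. d j * cinner K (N (e j)) z)" for i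
      proof (induction i)
        case 0
        have "N \<zero>\<^bsub>H\<^esub> = 0 \<odot>\<^bsub>K\<^esub> N \<zero>\<^bsub>H\<^esub>"
          using N_lin \<sigma>.hs.smult_l_null[of "\<zero>\<^bsub>H\<^esub>"] unfolding linear_map_def
          by (metis \<sigma>.hs.M.zero_closed complex_ring_simps(5))
        then have "cinner K (N \<zero>\<^bsub>H\<^esub>) z = cinner K (0 \<odot>\<^bsub>K\<^esub> N \<zero>\<^bsub>H\<^esub>) z" by (rule arg_cong)
        then show ?case using \<tau>.hs.form.smult_left[OF Nc z, of 0] by simp
      next
        case (Suc i)
        then show ?case using N_lin ec z Nc
          by (simp add: linear_map_def \<tau>.hs.form.add_left \<tau>.hs.form.smult_left)
      qed
      then show "cinner K (N (\<sigma>.hs.lincomb d e n)) z = cinner K (\<tau>.hs.lincomb d (\<lambda>i. N (e i)) n) z"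
        using Nc z by (simp add: \<tau>.hs.cinner_lincomb)
    qed (use Nc in auto)
    have N_expand: "N w = \<tau>.hs.lincomb (\<lambda>i. cinner H w (e i)) (\<lambda>i. N (e i)) n"
      if "w \<in> carrier H" for w
      using N_lincomb[of "\<lambda>i. cinner H w (e i)"] e that by (metis \<sigma>.hs.basis_def)
    obtain v0 where v0: "v0 \<in> carrier H" "hnorm H v0 = 1" using \<sigma>.ex_unit_vector by blast
    define L where "L = (\<lambda>w z. cinner K z (N w)) ` carrier H"
    \<comment> \<open>The orthogonal complement of the range of \<open>N\<close> is invariant and
      does not contain \<open>N v0\<close>, so irreducibility of \<open>\<tau>\<close> makes it
      zero.\<close>
    have orth: "z = \<zero>\<^bsub>K\<^esub>" if z: "z \<in> carrier K" "\<And>w. w \<in> carrier H \<Longrightarrow> cinner K z (N w) = 0" for z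
    proof (rule ccontr)
      assume "z \<noteq> \<zero>\<^bsub>K\<^esub>"
      have "(\<lambda>z. cinner K z (N v0)) (N v0) = 0"
      proof (rule \<tau>.invariant_kernel[where L = L and u = z and l = "\<lambda>z. cinner K z (N v0)"])
        fix l assume "l \<in> L"
        then obtain w where w: "w \<in> carrier H" "l = (\<lambda>z. cinner K z (N w))" by (auto simp: L_def)
        have "cmod (l x) \<le> hnorm K (N w) * hnorm K x" if "x \<in> carrier K" for x
          using \<tau>.hs.cinner_bound[OF that Nc[of w]] w(2) by (simp add: mult.commute)
        then show "\<exists>c. \<forall>x\<in>carrier K. cmod (l x) \<le> c * hnorm K x" by blast
      next
        fix g x l assume g: "g \<in> carrier G" and x: "x \<in> carrier K" and 0: "\<And>l. l \<in> L \<Longrightarrow> l x = 0"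
          and "l \<in> L"
        then obtain w where w: "w \<in> carrier H" "l = (\<lambda>z. cinner K z (N w))" by (auto simp: L_def)
        have "cinner K x (N (\<sigma> (inv g) w)) = 0"
          using 0[of "\<lambda>z. cinner K z (N (\<sigma> (inv g) w))"] w g by (auto simp: L_def)
        then show "l (\<tau> g x) = 0"
          using \<tau>.rep_adjoint[of "inv g" x "N w"] N_rep[of "inv g" w] g x w Nc by simp
      qed (use z \<open>z \<noteq> \<zero>\<^bsub>K\<^esub>\<close> Nc v0 in \<open>auto simp: L_def \<tau>.hs.form.add_left \<tau>.hs.form.smult_left\<close>)
      then show False using N_iso[OF v0(1) v0(1)] \<sigma>.hs.cinner_self[OF v0(1)] v0(2) by simp
    qed
    have surj: "\<exists>w\<in>carrier H. N w = z" if z: "z \<in> carrier K" for z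
    proof -
      \<comment> \<open>The orthogonal projection of \<open>z\<close> to the range of
        \<open>N\<close>.\<close>
      define y where "y = \<tau>.hs.lincomb (\<lambda>i. cinner K z (N (e i))) (\<lambda>i. N (e i)) n"
      have y: "y \<in> carrier K" using Nc by (simp add: y_def)
      have "z \<ominus>\<^bsub>K\<^esub> y = \<zero>\<^bsub>K\<^esub>"
      proof (rule orth)
        fix w assume w: "w \<in> carrier H"
        have "cinner K z (N w) = cnj (cinner K (N w) z)" by (rule \<tau>.hs.cinner_commute[OF Nc z])
        also have "\<dots> = (\<Sum>i<n. cnj (cinner H w (e i)) * cinner K z (N (e i)))"
          unfolding N_expand[OF w]
          using Nc z by (subst \<tau>.hs.cinner_lincomb) (auto simp: \<tau>.hs.cinner_commute[OF z Nc])
        also have "\<dots> = (\<Sum>i<n. cinner K z (N (e i)) * cinner K (N (e i)) (N w))"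
          using ec w by (intro sum.cong) (auto simp: N_iso \<sigma>.hs.cinner_commute[OF w])
        also have "\<dots> = cinner K y (N w)"
          unfolding y_def using Nc by (simp add: \<tau>.hs.cinner_lincomb)
        finally show "cinner K (z \<ominus>\<^bsub>K\<^esub> y) (N w) = 0" using z y Nc by (simp add: \<tau>.hs.form.diff_left)
      qed (use z y in auto)
      then have "z = y" by (rule \<tau>.hs.diff_eq_zero[OF z y])
      also have "y = N (\<sigma>.hs.lincomb (\<lambda>i. cinner K z (N (e i))) e n)" by (simp add: y_def N_lincomb)
      finally show ?thesis using ec
        by (intro bexI[of _ "\<sigma>.hs.lincomb (\<lambda>i. cinner K z (N (e i))) e n"]) auto
    qed
    have "inj_on N (carrier H)"
    proof (rule inj_onI)
      fix w z assume wz: "w \<in> carrier H" "z \<in> carrier H" "N w = N z"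
      show "w = z"
        by (rule \<sigma>.hs.eq_by_cinner[OF wz(1,2)]) (metis N_iso wz)
    qed
    then have "bij_betw N (carrier H) (carrier K)"
      using surj Nc unfolding bij_betw_def by blast
    then have "hilbert_iso H K N" using N_lin N_iso by (simp add: hilbert_iso_def)
    then have "equivalent_reps G (H, \<sigma>) (K, \<tau>)"
      using equivalent_reps_iff[OF \<sigma>.irreducible \<tau>.irreducible] N_rep by blast
    then show False using inequivalent by simp
  qed
  then have "cinner K (A v) (A v) = 0" using c(2)[OF v(1) v(1)] by simp
  then have "A v = \<zero>\<^bsub>K\<^esub>" using \<tau>.hs.hnorm_eq_0_iff[OF Ac[of v]] by (simp add: hnorm_def)
  then have "F v v' = 0" using AF[OF v] \<tau>.hs.form.zero_left[OF v(2)] by simp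
  moreover have "cnj (F v v') = M (\<lambda>x. cinner H (\<sigma> x u) v * cnj (cinner K (\<tau> x u') v'))"
    unfolding F_def using \<sigma>.mean.cnj[OF bd[OF v]] by simp
  ultimately show ?thesis by simp
qed

end

section \<open>Cones of positive definite functions\<close>

lemma compact_imp_closed_fun:
  fixes S :: "('a \<Rightarrow> complex) set"
  assumes "compact S"
  shows "closed S"
proof -
  have "Hausdorff_space (product_topology (\<lambda>_ :: 'a. euclidean :: complex topology) UNIV)"
    by (simp add: Hausdorff_space_product_topology Hausdorff_space_euclidean)
  then have "closedin (euclidean :: ('a \<Rightarrow> complex) topology) S"
    using assms by (intro compactin_imp_closedin) (simp_all add: euclidean_product_topology)
  then show ?thesis by simp
qed

context totally_bounded_group
begin

lemma ucont_open_less: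
  assumes d: "ucont d"
  shows "openin T {x \<in> carrier G. cmod (d x) < \<epsilon>}"
proof (subst openin_subopen, intro ballI)
  fix x assume "x \<in> {x \<in> carrier G. cmod (d x) < \<epsilon>}"
  then have x: "x \<in> carrier G" "cmod (d x) < \<epsilon>" by auto
  define \<eta> where "\<eta> = (\<epsilon> - cmod (d x)) / 2"
  have \<eta>: "\<eta> > 0" using x by (simp add: \<eta>_def)
  obtain U where U: "openin T U" "\<one> \<in> U" "\<And>x u. x \<in> carrier G \<Longrightarrow> u \<in> U \<Longrightarrow> cmod (d (x \<otimes> u) - d x) \<le> \<eta>"
    using ucontE1[OF d \<eta>] by blast
  define V where "V = {y \<in> carrier G. inv x \<otimes> y \<otimes> \<one> \<in> U}"
  have "openin T V" unfolding V_def by (rule open_translate[OF U(1)]) (use x in auto)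
  moreover have "x \<in> V" using x U(2) by (simp add: V_def)
  moreover have "cmod (d y) < \<epsilon>" if "y \<in> V" for y
  proof -
    have y: "y \<in> carrier G" "inv x \<otimes> y \<in> U" using that x by (auto simp: V_def)
    then have "cmod (d y - d x) \<le> \<eta>"
      using U(3)[OF x(1) y(2)] x by (simp add: m_assoc[symmetric])
    then show ?thesis using norm_triangle_ineq[of "d y - d x" "d x"] \<eta> by (simp add: \<eta>_def)
  qed
  ultimately show "\<exists>V. openin T V \<and> x \<in> V \<and> V \<subseteq> {x \<in> carrier G. cmod (d x) < \<epsilon>}"
    by (intro exI[of _ V]) (auto simp: V_def)
qed

end

context irrep
begin

text \<open>The linear span of the matrix coefficients, up to values outside the group. Indices are
  pairs because they arise as positions in a matrix.\<close>

definition trigonometric :: "('a \<Rightarrow> complex) \<Rightarrow> bool"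
  where "trigonometric f \<longleftrightarrow> (\<exists>(I :: (nat \<times> nat) set) c u w. finite I \<and>
    (\<forall>k\<in>I. u k \<in> carrier H \<and> w k \<in> carrier H) \<and>
    (\<forall>x\<in>carrier G. f x = (\<Sum>k\<in>I. c k * cinner H (\<sigma> x (u k)) (w k))))"

lemma trigonometricE:
  assumes "trigonometric f"
  obtains I :: "(nat \<times> nat) set" and c u w where "finite I"
    "\<And>k. k \<in> I \<Longrightarrow> u k \<in> carrier H \<and> w k \<in> carrier H"
    "\<And>x. x \<in> carrier G \<Longrightarrow> f x = (\<Sum>k\<in>I. c k * cinner H (\<sigma> x (u k)) (w k))"
proof -
  obtain I :: "(nat \<times> nat) set" and c u w where *: "finite I \<and>
    (\<forall>k\<in>I. u k \<in> carrier H \<and> w k \<in> carrier H) \<and>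
    (\<forall>x\<in>carrier G. f x = (\<Sum>k\<in>I. c k * cinner H (\<sigma> x (u k)) (w k)))"
    using assms unfolding trigonometric_def by (elim exE)
  show ?thesis by (rule that[of I u w c]) (simp_all add: *)
qed

lemma trigonometric_ucont:
  assumes "trigonometric f"
  shows "ucont f"
proof -
  obtain I :: "(nat \<times> nat) set" and c u w where "finite I"
    and uw: "\<And>k. k \<in> I \<Longrightarrow> u k \<in> carrier H \<and> w k \<in> carrier H"
    and f: "\<And>x. x \<in> carrier G \<Longrightarrow> f x = (\<Sum>k\<in>I. c k * cinner H (\<sigma> x (u k)) (w k))"
    by (rule trigonometricE[OF assms(1)]) blast
  have "ucont (\<lambda>x. \<Sum>k\<in>I. c k * cinner H (\<sigma> x (u k)) (w k))"
    using uw by (intro ucont_sum ucont_mult ucont_const ucont_coefficient) auto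
  then show ?thesis by (rule ucont_cong) (simp add: f)
qed

lemma trigonometric_left_translate:
  assumes "trigonometric f" and a: "a \<in> carrier G"
  shows "trigonometric (\<lambda>x. f (a \<otimes> x))"
proof -
  obtain I :: "(nat \<times> nat) set" and c u w where "finite I"
    and uw: "\<And>k. k \<in> I \<Longrightarrow> u k \<in> carrier H \<and> w k \<in> carrier H"
    and f: "\<And>x. x \<in> carrier G \<Longrightarrow> f x = (\<Sum>k\<in>I. c k * cinner H (\<sigma> x (u k)) (w k))"
    by (rule trigonometricE[OF assms(1)]) blast
  have "f (a \<otimes> x) = (\<Sum>k\<in>I. c k * cinner H (\<sigma> x (u k)) (\<sigma> (inv a) (w k)))"
    if x: "x \<in> carrier G" for x
  proof -
    have "f (a \<otimes> x) = (\<Sum>k\<in>I. c k * cinner H (\<sigma> (a \<otimes> x) (u k)) (w k))" using f a x by simp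
    also have "\<dots> = (\<Sum>k\<in>I. c k * cinner H (\<sigma> x (u k)) (\<sigma> (inv a) (w k)))"
      using uw a x by (intro sum.cong) (auto simp: rep_adjoint rep_mult)
    finally show ?thesis .
  qed
  then show ?thesis unfolding trigonometric_def
    using \<open>finite I\<close> uw a
      by (intro exI[of _ I] exI[of _ c] exI[of _ u] exI[of _ "\<lambda>k. \<sigma> (inv a) (w k)"]) auto
qed

lemma coefficient_cone_repr:
  assumes "h \<in> coefficient_cone G (H, \<sigma>)"
  obtains n :: nat and v where "\<And>i. i < n \<Longrightarrow> v i \<in> carrier H"
    "h = (\<lambda>x\<in>carrier G. \<Sum>i<n. cinner H (\<sigma> x (v i)) (v i))"
proof -
  obtain n :: nat and p where p: "\<forall>i<n. p i \<in> coefficients G (H, \<sigma>)"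
      "h = (\<lambda>g\<in>carrier G. \<Sum>i<n. p i g)"
    using assms by (auto simp: coefficient_cone_def)
  then have "\<forall>i<n. \<exists>v\<in>carrier H. p i = (\<lambda>x\<in>carrier G. cinner H (\<sigma> x v) v)"
    by (auto simp: coefficients_def)
  then obtain v where v: "\<And>i. i < n \<Longrightarrow> v i \<in> carrier H \<and> p i = (\<lambda>x\<in>carrier G. cinner H (\<sigma> x (v i)) (v i))"
    by metis
  have "h = (\<lambda>x\<in>carrier G. \<Sum>i<n. cinner H (\<sigma> x (v i)) (v i))"
    unfolding p(2) using v by (auto simp: restrict_def fun_eq_iff)
  then show ?thesis using that v by blast
qed

text \<open>The values of a positive definite function are bounded by its value at
  \<open>\<one>\<close>. For fixed \<open>x\<close> this is a closed condition in the topology of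
  pointwise convergence, to which \<open>closure\<close> refers.\<close>

lemma closure_cone_le:
  assumes "g \<in> closure (coefficient_cone G (H, \<sigma>))" and x: "x \<in> carrier G"
  shows "cmod (g x) \<le> Re (g \<one>)"
proof -
  have "closed {g :: 'a \<Rightarrow> complex. cmod (g x) \<le> Re (g \<one>)}"
    by (intro closed_Collect_le continuous_on_norm continuous_on_Re continuous_on_product_coordinates)
  moreover have "coefficient_cone G (H, \<sigma>) \<subseteq> {g. cmod (g x) \<le> Re (g \<one>)}"
  proof
    fix h assume "h \<in> coefficient_cone G (H, \<sigma>)"
    then obtain n :: nat and v where v: "\<And>i. i < n \<Longrightarrow> v i \<in> carrier H"
      and h: "h = (\<lambda>x\<in>carrier G. \<Sum>i<n. cinner H (\<sigma> x (v i)) (v i))"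
      using coefficient_cone_repr by blast
    have "cmod (h x) \<le> (\<Sum>i<n. cmod (cinner H (\<sigma> x (v i)) (v i)))" using x by (simp add: h norm_sum)
    also have "\<dots> \<le> (\<Sum>i<n. Re (cinner H (v i) (v i)))"
    proof (rule sum_mono)
      fix i assume "i \<in> {..<n}"
      then have i: "v i \<in> carrier H" using v by simp
      have "cmod (cinner H (\<sigma> x (v i)) (v i)) \<le> hnorm H (v i) * hnorm H (v i)"
        using hs.cinner_bound[OF rep_closed[OF x i] i] rep_norm[OF x i] by simp
      then show "cmod (cinner H (\<sigma> x (v i)) (v i)) \<le> Re (cinner H (v i) (v i))"
        using hs.hnorm_sq[OF i] by (simp add: power2_eq_square)
    qed
    also have "\<dots> = Re (h \<one>)" using v by (simp add: h rep_one)
    finally show "h \<in> {g. cmod (g x) \<le> Re (g \<one>)}" by simp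
  qed
  ultimately have "closure (coefficient_cone G (H, \<sigma>)) \<subseteq> {g. cmod (g x) \<le> Re (g \<one>)}"
    by (rule closure_minimal[rotated])
  then show ?thesis using assms by blast
qed

text \<open>Fixes the coordinates outside the group, so that bounded parts of the closure fit into a
  compact box.\<close>

lemma closure_cone_outside:
  assumes "g \<in> closure (coefficient_cone G (H, \<sigma>))" and "x \<notin> carrier G"
  shows "g x = undefined"
proof -
  have "closed {g :: 'a \<Rightarrow> complex. g x = undefined}"
    by (intro closed_Collect_eq continuous_on_product_coordinates continuous_on_const)
  moreover have "coefficient_cone G (H, \<sigma>) \<subseteq> {g. g x = undefined}"
    using assms(2) by (auto simp: coefficient_cone_def)
  ultimately have "closure (coefficient_cone G (H, \<sigma>)) \<subseteq> {g. g x = undefined}"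
    by (rule closure_minimal[rotated])
  then show ?thesis using assms by blast
qed

text \<open>Since the space is finite dimensional, the elements of the cone with bounded value at \<open>\<one>\<close> lie
  in the image of a compact set of coefficient matrices.\<close>

lemma closure_cone_trigonometric:
  assumes g: "g \<in> closure (coefficient_cone G (H, \<sigma>))" and g1: "Re (g \<one>) \<le> 2"
  shows "trigonometric g"
proof -
  obtain e n where e: "hs.basis e n" using finite_dimensional by blast
  have ec: "\<And>i. i < n \<Longrightarrow> e i \<in> carrier H" using e by (rule hs.basis_closed)
  have en: "hnorm H (e i) = 1" if "i < n" for i
    using e that by (simp add: hs.basis_def hs.orthonormal_def hnorm_def)
  define I where "I = {..<n} \<times> {..<n}"
  define \<Psi> where "\<Psi> A x = (if x \<in> carrier G
      then \<Sum>k\<in>I. A k * cinner H (\<sigma> x (e (fst k))) (e (snd k)) else undefined)"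
    for A :: "nat \<times> nat \<Rightarrow> complex" and x
  \<comment> \<open>The entries of the coefficient matrix of an element of the cone are bounded by
    its value at \<open>\<one>\<close>, which is less than \<open>3\<close> on
    \<open>V\<close>.\<close>
  define B where "B = {A :: nat \<times> nat \<Rightarrow> complex. \<forall>k. A k \<in> cball 0 3}"
  have "continuous_on UNIV (\<lambda>A. \<Psi> A x)" for x
    unfolding \<Psi>_def
    by (cases "x \<in> carrier G")
      (auto intro!: continuous_on_sum continuous_on_mult continuous_on_product_coordinates continuous_on_const)
  then have "continuous_on UNIV \<Psi>" by (rule continuous_on_coordinatewise_then_product)
  then have "continuous_on B \<Psi>" by (rule continuous_on_subset) simp
  moreover have "compact B" unfolding B_def by (rule compact_box) simp
  ultimately have Z: "closed (\<Psi> ` B)" by (intro compact_imp_closed_fun compact_continuous_image)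
  \<comment> \<open>An open condition implied by \<open>Re (g \<one>) \<le> 2\<close>; openness
    makes \<open>g\<close> a limit of elements of the cone that satisfy it as well.\<close>
  define V where "V = {g :: 'a \<Rightarrow> complex. Re (g \<one>) < 3}"
  have "open V" unfolding V_def
    by (intro open_Collect_less continuous_on_Re continuous_on_product_coordinates continuous_on_const)
  have "V \<inter> coefficient_cone G (H, \<sigma>) \<subseteq> \<Psi> ` B"
  proof
    fix h assume hV: "h \<in> V \<inter> coefficient_cone G (H, \<sigma>)"
    then obtain m :: nat and v where v: "\<And>i. i < m \<Longrightarrow> v i \<in> carrier H"
      and h: "h = (\<lambda>x\<in>carrier G. \<Sum>i<m. cinner H (\<sigma> x (v i)) (v i))"
      using coefficient_cone_repr by blast
    have "(\<Sum>l<m. (hnorm H (v l))\<^sup>2) = Re (h \<one>)" using v by (simp add: h rep_one hs.hnorm_sq)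
    also have "\<dots> \<le> 3" using hV by (simp add: V_def)
    finally have sum3: "(\<Sum>l<m. (hnorm H (v l))\<^sup>2) \<le> 3" .
    \<comment> \<open>Obtained by expanding both occurrences of each \<open>v l\<close> in the
      basis.\<close>
    define A where "A k = (if k \<in> I then \<Sum>l<m. cinner H (v l) (e (fst k)) * cinner H (e (snd k)) (v l) else 0)" for k
    have "cmod (A k) \<le> 3" for k
    proof (cases "k \<in> I")
      case True
      then have k: "fst k < n" "snd k < n" by (auto simp: I_def)
      have "cmod (A k) \<le> (\<Sum>l<m. cmod (cinner H (v l) (e (fst k)) * cinner H (e (snd k)) (v l)))"
        using True by (simp add: A_def norm_sum)
      also have "\<dots> \<le> (\<Sum>l<m. (hnorm H (v l))\<^sup>2)"
      proof (rule sum_mono)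
        fix l assume "l \<in> {..<m}"
        then have l: "v l \<in> carrier H" using v by simp
        have "cmod (cinner H (v l) (e (fst k))) \<le> hnorm H (v l)" "cmod (cinner H (e (snd k)) (v l)) \<le> hnorm H (v l)"
          using hs.cinner_bound[OF l ec[OF k(1)]] hs.cinner_bound[OF ec[OF k(2)] l] en k by auto
        then show "cmod (cinner H (v l) (e (fst k)) * cinner H (e (snd k)) (v l)) \<le> (hnorm H (v l))\<^sup>2"
          by (simp add: norm_mult power2_eq_square mult_mono hs.hnorm_nonneg[OF l])
      qed
      finally show ?thesis using sum3 by simp
    qed (simp add: A_def)
    then have "A \<in> B" by (simp add: B_def)
    moreover have "h = \<Psi> A"
    proof
      fix x show "h x = \<Psi> A x"
      proof (cases "x \<in> carrier G")
        case x: True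
        have "cinner H (\<sigma> x (v l)) (v l) =
            (\<Sum>i<n. \<Sum>j<n. cinner H (v l) (e i) * cinner H (e j) (v l) * cinner H (\<sigma> x (e i)) (e j))"
          if "l < m" for l
        proof -
          have vl: "v l \<in> carrier H" using v that .
          have adj: "cinner H (\<sigma> x w) (v l) = cinner H w (\<sigma> (inv x) (v l))" if "w \<in> carrier H" for w
            using rep_adjoint[of "inv x" w "v l"] x vl that by simp
          have "cinner H (\<sigma> x (v l)) (v l) = (\<Sum>i<n. cinner H (v l) (e i) * cinner H (\<sigma> x (e i)) (v l))"
            using hs.Parseval[OF e vl, of "\<sigma> (inv x) (v l)"] x vl ec by (simp add: adj)
          also have "\<dots> = (\<Sum>i<n. cinner H (v l) (e i) * (\<Sum>j<n. cinner H (\<sigma> x (e i)) (e j) * cinner H (e j) (v l)))"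
            using hs.Parseval[OF e _ vl] x ec by (intro sum.cong[OF refl]) simp
          finally show ?thesis by (simp add: sum_distrib_left mult_ac)
        qed
        then have "h x = (\<Sum>l<m. \<Sum>i<n. \<Sum>j<n. cinner H (v l) (e i) * cinner H (e j) (v l) * cinner H (\<sigma> x (e i)) (e j))"
          using x by (simp add: h)
        also have "\<dots> = (\<Sum>i<n. \<Sum>j<n. \<Sum>l<m. cinner H (v l) (e i) * cinner H (e j) (v l) * cinner H (\<sigma> x (e i)) (e j))"
          by (subst sum.swap, rule sum.cong[OF refl], rule sum.swap)
        also have "\<dots> = (\<Sum>i<n. \<Sum>j<n. A (i, j) * cinner H (\<sigma> x (e i)) (e j))"
          by (intro sum.cong[OF refl]) (simp add: A_def I_def sum_distrib_right)
        also have "\<dots> = \<Psi> A x" using x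
          by (simp add: \<Psi>_def I_def sum.cartesian_product case_prod_beta)
        finally show ?thesis .
      qed (simp add: h \<Psi>_def)
    qed
    ultimately show "h \<in> \<Psi> ` B" by blast
  qed
  then have "closure (V \<inter> coefficient_cone G (H, \<sigma>)) \<subseteq> \<Psi> ` B" using Z by (rule closure_minimal)
  moreover have "g \<in> closure (V \<inter> coefficient_cone G (H, \<sigma>))"
  proof -
    have "g \<in> V \<inter> closure (coefficient_cone G (H, \<sigma>))" using g g1 by (simp add: V_def)
    then show ?thesis using open_Int_closure_subset[OF \<open>open V\<close>] by blast
  qed
  ultimately obtain A where A: "g = \<Psi> A" by blast
  then have "\<forall>x\<in>carrier G. g x = (\<Sum>k\<in>I. A k * cinner H (\<sigma> x (e (fst k))) (e (snd k)))"
    by (simp add: \<Psi>_def)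
  then show ?thesis unfolding trigonometric_def
    using ec by (intro exI[of _ I] exI[of _ A] exI[of _ "\<lambda>k. e (fst k)"] exI[of _ "\<lambda>k. e (snd k)"]) (auto simp: I_def)
qed

end

context two_irreps
begin

lemma trigonometric_orthogonal:
  assumes ne: "\<not> equivalent_reps G (H, \<sigma>) (K, \<tau>)"
    and f: "\<sigma>.trigonometric f" and g: "\<tau>.trigonometric g"
  shows "M (\<lambda>x. f x * cnj (g x)) = 0"
proof -
  obtain I :: "(nat \<times> nat) set" and c u w where "finite I"
    and uw: "\<And>k. k \<in> I \<Longrightarrow> u k \<in> carrier H \<and> w k \<in> carrier H"
    and f_eq: "\<And>x. x \<in> carrier G \<Longrightarrow> f x = (\<Sum>k\<in>I. c k * cinner H (\<sigma> x (u k)) (w k))"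
    by (rule \<sigma>.trigonometricE[OF f]) blast
  obtain J :: "(nat \<times> nat) set" and d u' w' where "finite J"
    and uw': "\<And>k. k \<in> J \<Longrightarrow> u' k \<in> carrier K \<and> w' k \<in> carrier K"
    and g_eq: "\<And>x. x \<in> carrier G \<Longrightarrow> g x = (\<Sum>k\<in>J. d k * cinner K (\<tau> x (u' k)) (w' k))"
    by (rule \<tau>.trigonometricE[OF g]) blast
  define F where "F k l x = cinner H (\<sigma> x (u k)) (w k) * cnj (cinner K (\<tau> x (u' l)) (w' l))" for k l x
  have bd: "bounded_fun (carrier G) (F k l)" if "k \<in> I" "l \<in> J" for k l
    unfolding F_def[abs_def] using uw[OF that(1)] uw'[OF that(2)]
    by (intro \<sigma>.ucont_bounded \<sigma>.ucont_mult \<sigma>.ucont_cnj \<sigma>.ucont_coefficient \<tau>.ucont_coefficient) auto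
  have "M (\<lambda>x. f x * cnj (g x)) = M (\<lambda>x. \<Sum>k\<in>I. \<Sum>l\<in>J. c k * cnj (d l) * F k l x)"
  proof (rule \<sigma>.mean.cong)
    show "bounded_fun (carrier G) (\<lambda>x. f x * cnj (g x))"
      using \<sigma>.trigonometric_ucont[OF f] \<tau>.trigonometric_ucont[OF g]
      by (intro \<sigma>.ucont_bounded \<sigma>.ucont_mult \<sigma>.ucont_cnj)
    fix x assume x: "x \<in> carrier G"
    show "f x * cnj (g x) = (\<Sum>k\<in>I. \<Sum>l\<in>J. c k * cnj (d l) * F k l x)"
      by (simp add: f_eq[OF x] g_eq[OF x] F_def sum_product mult_ac)
  qed
  also have "\<dots> = (\<Sum>k\<in>I. M (\<lambda>x. \<Sum>l\<in>J. c k * cnj (d l) * F k l x))"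
    using bd by (intro \<sigma>.mean.sum bounded_fun_sum bounded_fun_mult[OF bounded_fun_const])
  also have "\<dots> = (\<Sum>k\<in>I. \<Sum>l\<in>J. M (\<lambda>x. c k * cnj (d l) * F k l x))"
    using bd by (intro sum.cong[OF refl] \<sigma>.mean.sum bounded_fun_mult[OF bounded_fun_const])
  also have "\<dots> = (\<Sum>k\<in>I. \<Sum>l\<in>J. c k * cnj (d l) * M (F k l))"
    using bd by (intro sum.cong[OF refl] \<sigma>.mean.cmult)
  also have "\<dots> = 0"
    using orthogonality[OF _ _ ne] uw uw' by (simp add: F_def[abs_def])
  finally show ?thesis .
qed

end

section \<open>Compactness of cones and finiteness of the set of classes\<close>

context invariant_mean_group
begin

lemma irrepI: "irreducible_rep G T (H, \<sigma>) \<Longrightarrow> irrep G T M H \<sigma>"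
  by (intro irrep.intro irrep_axioms.intro invariant_mean_group_axioms)

text \<open>Left translation keeps both functions trigonometric for their representations. The
  translate is needed because \<open>translate_positive_mass\<close> only controls some translate of
  a neighborhood of \<open>\<one>\<close>.\<close>

lemma orthogonal_closure_cones:
  assumes r: "irreducible_rep G T r" and s: "irreducible_rep G T s"
    and ne: "\<not> equivalent_reps G r s"
    and f: "f \<in> closure (coefficient_cone G r)" "Re (f \<one>) \<le> 2"
    and g: "g \<in> closure (coefficient_cone G s)" "Re (g \<one>) \<le> 2"
    and a: "a \<in> carrier G"
  shows "M (\<lambda>x. f (a \<otimes> x) * cnj (g (a \<otimes> x))) = 0"
proof -
  obtain H \<sigma> K \<tau> where eq: "r = (H, \<sigma>)" "s = (K, \<tau>)" by (cases r, cases s) auto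
  interpret two_irreps G T M H \<sigma> K \<tau>
    using r s unfolding eq by (intro two_irreps.intro irrepI)
  show ?thesis
    using \<sigma>.closure_cone_trigonometric[of f] \<tau>.closure_cone_trigonometric[of g] f g ne a unfolding eq
    by (intro trigonometric_orthogonal \<sigma>.trigonometric_left_translate \<tau>.trigonometric_left_translate) auto
qed

lemma closure_cone_ucont:
  assumes "irreducible_rep G T r" "g \<in> closure (coefficient_cone G r)" "Re (g \<one>) \<le> 2"
  shows "ucont g"
proof -
  obtain H \<sigma> where eq: "r = (H, \<sigma>)" by (cases r)
  interpret irrep G T M H \<sigma> using assms unfolding eq by (intro irrepI)
  show ?thesis using closure_cone_trigonometric trigonometric_ucont assms unfolding eq by blast
qed

lemma closure_cone_bound:
  assumes "irreducible_rep G T r" "g \<in> closure (coefficient_cone G r)" "x \<in> carrier G"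
  shows "cmod (g x) \<le> Re (g \<one>)"
proof -
  obtain H \<sigma> where eq: "r = (H, \<sigma>)" by (cases r)
  interpret irrep G T M H \<sigma> using assms unfolding eq by (intro irrepI)
  show ?thesis using closure_cone_le assms unfolding eq by blast
qed

text \<open>By \<open>closure_cone_le\<close> the values on the group lie in the disc of radius
  \<open>2\<close>, and outside the group only one value is possible, so this is a closed subset of
  a compact box.\<close>

lemma compact_closure_cone:
  assumes r: "irreducible_rep G T r"
  shows "compact {g \<in> closure (coefficient_cone G r). Re (g \<one>) \<le> 2}"
proof -
  define K where "K x = (if x \<in> carrier G then cball 0 2 else {undefined :: complex})" for x
  have "compact {g. \<forall>x. g x \<in> K x}" by (rule compact_box) (simp add: K_def)
  moreover have "closed (closure (coefficient_cone G r) \<inter> {g. Re (g \<one>) \<le> 2})"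
    by (intro closed_Int closed_closure closed_Collect_le continuous_on_Re continuous_on_product_coordinates
        continuous_on_const)
  ultimately have "compact ({g. \<forall>x. g x \<in> K x} \<inter> (closure (coefficient_cone G r) \<inter> {g. Re (g \<one>) \<le> 2}))"
    by (rule compact_Int_closed)
  moreover have "{g. \<forall>x. g x \<in> K x} \<inter> (closure (coefficient_cone G r) \<inter> {g. Re (g \<one>) \<le> 2}) =
      {g \<in> closure (coefficient_cone G r). Re (g \<one>) \<le> 2}"
  proof -
    obtain H \<sigma> where eq: "r = (H, \<sigma>)" by (cases r)
    interpret irrep G T M H \<sigma> using assms unfolding eq by (intro irrepI)
    have "g x \<in> K x" if "g \<in> closure (coefficient_cone G r)" "Re (g \<one>) \<le> 2" for g x
      using closure_cone_le[of g x] closure_cone_outside[of g x] that by (auto simp: K_def eq)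
    then show ?thesis by blast
  qed
  ultimately show ?thesis by simp
qed

text \<open>The bound comes from Bessel's inequality for the indicator function of a translate of \<open>U\<close>, which pairs with each of
  the orthogonal functions \<open>g\<close> to at least half its mass.\<close>

lemma card_inequivalent_le:
  assumes U: "openin T U" "\<one> \<in> U"
  obtains N :: nat where "\<And>R :: ('a, 'h) rep set. \<lbrakk>finite R; \<And>r. r \<in> R \<Longrightarrow> irreducible_rep G T r;
      \<And>r s. \<lbrakk>r \<in> R; s \<in> R; r \<noteq> s\<rbrakk> \<Longrightarrow> \<not> equivalent_reps G r s;
      \<And>r. r \<in> R \<Longrightarrow> \<exists>g\<in>closure (coefficient_cone G r). Re (g \<one>) \<le> 2 \<and> (\<forall>x\<in>U. 1 / 2 \<le> Re (g x))\<rbrakk>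
    \<Longrightarrow> card R \<le> N"
proof -
  obtain a where a: "a \<in> carrier G" "0 < Re (M (\<lambda>x. if inv a \<otimes> x \<in> U then 1 else 0))"
    using translate_positive_mass[OF U] by blast
  define J where "J x = (if inv a \<otimes> x \<in> U then 1 else 0 :: complex)" for x
  define \<mu> where "\<mu> = Re (M J)"
  have \<mu>: "\<mu> > 0" using a(2) by (simp add: \<mu>_def J_def[abs_def])
  have bJ: "bounded_fun (carrier G) J" by (rule bounded_funI[of _ _ 1]) (simp add: J_def)
  obtain N :: nat where N: "16 / \<mu> \<le> N" using real_arch_simple by blast
  have "card R \<le> N"
    if R: "finite R" "\<And>r. r \<in> R \<Longrightarrow> irreducible_rep G T r"
      "\<And>r s. \<lbrakk>r \<in> R; s \<in> R; r \<noteq> s\<rbrakk> \<Longrightarrow> \<not> equivalent_reps G r s"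
      "\<And>r. r \<in> R \<Longrightarrow> \<exists>g\<in>closure (coefficient_cone G r). Re (g \<one>) \<le> 2 \<and> (\<forall>x\<in>U. 1 / 2 \<le> Re (g x))"
    for R :: "('a, 'h) rep set"
  proof -
    obtain g where g: "\<And>r. r \<in> R \<Longrightarrow> g r \<in> closure (coefficient_cone G r)" "\<And>r. r \<in> R \<Longrightarrow> Re (g r \<one>) \<le> 2"
      "\<And>r x. r \<in> R \<Longrightarrow> x \<in> U \<Longrightarrow> 1 / 2 \<le> Re (g r x)" using R(4) by metis
    define h where "h r x = g r (inv a \<otimes> x)" for r x
    have uh: "ucont (h r)" if "r \<in> R" for r
      unfolding h_def[abs_def]
      using closure_cone_ucont[OF R(2) g(1) g(2)] that a by (intro ucont_left_translate) auto
    have bh: "bounded_fun (carrier G) (\<lambda>x. h r x * cnj (h s x))" if "r \<in> R" "s \<in> R" for r s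
      using uh that by (intro ucont_bounded ucont_mult ucont_cnj)
    have hh: "M (\<lambda>x. h r x * cnj (h s x)) = 0" if "r \<in> R" "s \<in> R" "r \<noteq> s" for r s
      unfolding h_def using that g a R(2,3) by (intro orthogonal_closure_cones[of r s]) auto
    have h2: "Re (M (\<lambda>x. h r x * cnj (h r x))) \<le> 4" if r: "r \<in> R" for r
    proof -
      have "cmod (M (\<lambda>x. h r x * cnj (h r x))) \<le> 4"
      proof (rule mean.norm_le)
        fix x assume x: "x \<in> carrier G"
        have "cmod (h r x) \<le> Re (g r \<one>)"
          unfolding h_def using closure_cone_bound[OF R(2)[OF r] g(1)[OF r]] a x by simp
        then have "cmod (h r x) \<le> 2" using g(2)[OF r] by linarith
        then have "cmod (h r x) * cmod (h r x) \<le> 2 * 2" by (intro mult_mono) auto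
        then show "cmod (h r x * cnj (h r x)) \<le> 4" by (simp add: norm_mult)
      qed
      then show ?thesis using complex_Re_le_cmod order_trans by blast
    qed
    define S where "S x = (\<Sum>r\<in>R. h r x)" for x
    \<comment> \<open>Minimizes the final bound
      \<open>(1 - t * n) * \<mu> + t\<^sup>2 * (4 * n)\<close>, in which \<open>4\<close> bounds the
      mean square of each \<open>h r\<close>.\<close>
    define t where "t = \<mu> / 8"
    define n where "n = real (card R)"
    have bS: "bounded_fun (carrier G) (\<lambda>x. S x * cnj (S x))"
      unfolding S_def using uh by (intro ucont_bounded ucont_mult ucont_cnj ucont_sum)
    have SS: "Re (M (\<lambda>x. S x * cnj (S x))) \<le> 4 * n"
    proof -
      have "M (\<lambda>x. S x * cnj (S x)) = M (\<lambda>x. \<Sum>r\<in>R. \<Sum>s\<in>R. h r x * cnj (h s x))"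
        by (simp add: S_def sum_product)
      also have "\<dots> = (\<Sum>r\<in>R. M (\<lambda>x. \<Sum>s\<in>R. h r x * cnj (h s x)))"
        using bh by (intro mean.sum bounded_fun_sum)
      also have "\<dots> = (\<Sum>r\<in>R. \<Sum>s\<in>R. M (\<lambda>x. h r x * cnj (h s x)))"
        using bh by (intro sum.cong[OF refl] mean.sum)
      also have "\<dots> = (\<Sum>r\<in>R. \<Sum>s\<in>R. if r = s then M (\<lambda>x. h r x * cnj (h r x)) else 0)"
        using hh by (intro sum.cong[OF refl]) auto
      also have "\<dots> = (\<Sum>r\<in>R. M (\<lambda>x. h r x * cnj (h r x)))" using R(1) by simp
      also have "Re \<dots> \<le> (\<Sum>r\<in>R. 4)" unfolding Re_sum using h2 by (intro sum_mono)
      finally show ?thesis by (simp add: n_def)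
    qed
    \<comment> \<open>On the translate of \<open>U\<close> the modulus of \<open>S x\<close> is at
      least \<open>n / 2\<close>, so the function dominates \<open>(1 - t * n / 2)\<^sup>2\<close>;
      elsewhere only the square of the modulus remains.\<close>
    have "Re (M (\<lambda>x. 0)) \<le> Re (M (\<lambda>x. of_real (1 - t * n) * J x + of_real (t\<^sup>2) * (S x * cnj (S x))))"
    proof (rule mean.mono)
      fix x assume "x \<in> carrier G"
      show "Re 0 \<le> Re (of_real (1 - t * n) * J x + of_real (t\<^sup>2) * (S x * cnj (S x)))"
      proof (cases "inv a \<otimes> x \<in> U")
        case False
        then show ?thesis by (simp add: J_def)
      next
        case True
        have "(\<Sum>r\<in>R. 1 / 2) \<le> (\<Sum>r\<in>R. Re (h r x))"
          unfolding h_def using g(3) True by (intro sum_mono)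
        then have "n / 2 \<le> Re (S x)" by (simp add: S_def n_def)
        then have "n / 2 \<le> cmod (S x)" using complex_Re_le_cmod[of "S x"] by linarith
        then have "(n / 2)\<^sup>2 \<le> (cmod (S x))\<^sup>2" by (rule power_mono) (simp add: n_def)
        then have "t\<^sup>2 * (n / 2)\<^sup>2 \<le> t\<^sup>2 * (cmod (S x))\<^sup>2" by (rule mult_left_mono) simp
        moreover have "0 \<le> (1 - t * n / 2)\<^sup>2" by simp
        then have "0 \<le> 1 - t * n + t\<^sup>2 * (n / 2)\<^sup>2" by (simp add: power2_eq_square algebra_simps)
        moreover have "Re (of_real (1 - t * n) * J x + of_real (t\<^sup>2) * (S x * cnj (S x))) =
            1 - t * n + t\<^sup>2 * (cmod (S x))\<^sup>2"
          using True unfolding complex_norm_square[symmetric] J_def by (simp flip: of_real_power)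
        ultimately show ?thesis by simp
      qed
    qed (intro bounded_fun_add bounded_fun_mult bounded_fun_const bJ bS)+
    also have "M (\<lambda>x. of_real (1 - t * n) * J x + of_real (t\<^sup>2) * (S x * cnj (S x))) =
        of_real (1 - t * n) * M J + of_real (t\<^sup>2) * M (\<lambda>x. S x * cnj (S x))"
      using bJ bS by (simp only: mean.add mean.cmult bounded_fun_mult bounded_fun_const)
    finally have "0 \<le> (1 - t * n) * \<mu> + t\<^sup>2 * Re (M (\<lambda>x. S x * cnj (S x)))"
      by (simp add: mean.const \<mu>_def del: of_real_diff of_real_power)
    also have "\<dots> \<le> (1 - t * n) * \<mu> + t\<^sup>2 * (4 * n)"
      using SS by (intro add_left_mono mult_left_mono) auto
    also have "\<dots> = \<mu> * (1 - \<mu> * n / 16)" by (simp add: t_def power2_eq_square field_simps)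
    finally have "n \<le> 16 / \<mu>" using \<mu> by (simp add: zero_le_mult_iff field_simps)
    then show ?thesis using N by (simp add: n_def)
  qed
  then show ?thesis by (rule that)
qed

text \<open>Families of pairwise inequivalent representations with the property in question are
  bounded in size, so there is one of maximal size, and a further class would enlarge it.\<close>

lemma finitely_many_classes:
  assumes U: "openin T U" "\<one> \<in> U"
  shows "\<exists>R :: ('a, 'h) rep set. finite R \<and> (\<forall>r. irreducible_rep G T r \<longrightarrow>
    (\<exists>g\<in>closure (coefficient_cone G r). Re (g \<one>) \<le> 2 \<and> (\<forall>x\<in>U. 1 / 2 \<le> Re (g x))) \<longrightarrow>
    (\<exists>s\<in>R. (r, s) \<in> rep_equivalence G T))"
proof -
  define good where "good r \<longleftrightarrow> irreducible_rep G T r \<and>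
      (\<exists>g\<in>closure (coefficient_cone G r). Re (g \<one>) \<le> 2 \<and> (\<forall>x\<in>U. 1 / 2 \<le> Re (g x)))"
    for r :: "('a, 'h) rep"
  define indep where "indep R \<longleftrightarrow> finite R \<and> (\<forall>r\<in>R. good r) \<and>
      (\<forall>r\<in>R. \<forall>s\<in>R. r \<noteq> s \<longrightarrow> \<not> equivalent_reps G r s)" for R :: "('a, 'h) rep set"
  obtain N where N: "\<And>R. indep R \<Longrightarrow> card R \<le> N"
    using card_inequivalent_le[OF U, where ?'h = 'h] unfolding indep_def good_def
      by (metis (no_types, lifting))
  define C where "C = card ` {R. indep R}"
  have "finite C" using N by (auto simp: C_def intro: finite_subset[of _ "{..N}"])
  moreover have "indep {}" by (simp add: indep_def)
  then have "C \<noteq> {}" by (auto simp: C_def)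
  ultimately have "Max C \<in> C" and max: "\<And>k. k \<in> C \<Longrightarrow> k \<le> Max C" by auto
  then obtain R where R: "indep R" "card R = Max C" by (auto simp: C_def)
  have eqv: "equiv {r :: ('a, 'h) rep. irreducible_rep G T r} (rep_equivalence G T)"
    by (rule equiv_rep_equivalence)
  have "\<exists>s\<in>R. (r, s) \<in> rep_equivalence G T" if r: "good r" for r
  proof (rule ccontr)
    assume *: "\<not> (\<exists>s\<in>R. (r, s) \<in> rep_equivalence G T)"
    have ir: "irreducible_rep G T s" if "s \<in> insert r R" for s using that r R(1)
      by (auto simp: indep_def good_def)
    have "refl_on {r :: ('a, 'h) rep. irreducible_rep G T r} (rep_equivalence G T)"
      using eqv by (simp add: equiv_def)
    then have "(r, r) \<in> rep_equivalence G T" by (rule refl_onD) (use ir in simp)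
    then have "r \<notin> R" using * by blast
    have "\<not> equivalent_reps G r s" "\<not> equivalent_reps G s r" if "s \<in> R" for s
    proof -
      have "(r, s) \<notin> rep_equivalence G T" using * that by blast
      moreover then have "(s, r) \<notin> rep_equivalence G T" using eqv by (meson equiv_def symE)
      ultimately show "\<not> equivalent_reps G r s" "\<not> equivalent_reps G s r"
        using ir that by (auto simp: rep_equivalence_def)
    qed
    then have "indep (insert r R)" using R(1) r by (auto simp: indep_def)
    then have "card (insert r R) \<le> Max C" using max by (auto simp: C_def)
    then show False using \<open>r \<notin> R\<close> R by (simp add: indep_def)
  qed
  then show ?thesis using R(1) by (intro exI[of _ R]) (auto simp: indep_def good_def)
qed

end

section \<open>The compact set isolating a class\<close>

context invariant_mean_group
begin

text \<open>The closure and the weak inequality make the conditions on \<open>g\<close> closed, as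
  the finite intersection argument requires.\<close>

definition spurious :: "('a, 'h) rep \<Rightarrow> ('a \<Rightarrow> complex) \<Rightarrow> real \<Rightarrow> 'a set \<Rightarrow> ('a, 'h) rep \<Rightarrow> ('a \<Rightarrow> complex) \<Rightarrow> bool"
  where "spurious \<rho> f \<epsilon> X r g \<longleftrightarrow> irreducible_rep G T r \<and> (r, \<rho>) \<notin> rep_equivalence G T \<and>
    g \<in> closure (coefficient_cone G r) \<and> (\<forall>x\<in>X. cmod (f x - g x) \<le> \<epsilon>)"

text \<open>An inductive choice of finite sets in the style of the Banach-Dieudonne theorem. In the
  inductive step the condition on \<open>U (Suc n)\<close> leaves only finitely many classes, whose cones are
  locally compact.\<close>

lemma extend_finite_set:
  fixes \<rho> :: "('a, 'h) rep"
  assumes f: "ucont f" "f \<one> = 1" and \<epsilon>: "\<epsilon> \<le> 1 / 8"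
    and V: "openin T V" "\<one> \<in> V"
    and C: "\<one> \<in> C \<union> U" and no: "\<And>r g. \<not> spurious \<rho> f \<epsilon> (C \<union> U) r g"
  shows "\<exists>F. finite F \<and> F \<subseteq> U \<and> (\<forall>r g. \<not> spurious \<rho> f \<epsilon> ((C \<union> F) \<union> V) r g)"
proof (rule ccontr)
  assume "\<not> ?thesis"
  then have ex: "\<exists>r g. spurious \<rho> f \<epsilon> ((C \<union> F) \<union> V) r g" if "finite F" "F \<subseteq> U" for F
    using that by blast
  obtain W where W: "openin T W" "\<one> \<in> W" "\<And>x u. x \<in> carrier G \<Longrightarrow> u \<in> W \<Longrightarrow> cmod (f (x \<otimes> u) - f x) \<le> 1 / 8"
    using ucontE1[OF f(1), of "1 / 8"] by auto
  \<comment> \<open>On \<open>W\<close> the function \<open>f\<close> is within \<open>1 / 8\<close>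
    of \<open>1\<close>, and on \<open>V\<close> a spurious \<open>g\<close> is within
    \<open>\<epsilon> \<le> 1 / 8\<close> of \<open>f\<close>. So \<open>Re (g x)\<close> lies
    between \<open>3 / 4\<close> and \<open>5 / 4\<close> on \<open>V \<inter> W\<close>, which
    gives both bounds demanded by \<open>finitely_many_classes\<close>.\<close>
  have fW: "cmod (f x - 1) \<le> 1 / 8" if "x \<in> W" for x
    using W(3)[OF one_closed that] openin_subset_carrier[OF W(1)] that f(2)
      by (auto simp: subset_iff)
  have VW: "openin T (V \<inter> W)" "\<one> \<in> V \<inter> W" using V W by auto
  from finitely_many_classes[OF VW, where ?'h = 'h]
  obtain R :: "('a, 'h) rep set" where R: "finite R" and "\<forall>r. irreducible_rep G T r \<longrightarrow>
    (\<exists>g\<in>closure (coefficient_cone G r). Re (g \<one>) \<le> 2 \<and> (\<forall>x\<in>V \<inter> W. 1 / 2 \<le> Re (g x))) \<longrightarrow>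
    (\<exists>s\<in>R. (r, s) \<in> rep_equivalence G T)" by (elim exE conjE)
  note R_rep = this(2)[THEN spec, THEN mp, THEN mp]
  have eqv: "equiv {r :: ('a, 'h) rep. irreducible_rep G T r} (rep_equivalence G T)"
    by (rule equiv_rep_equivalence)
  \<comment> \<open>Equivalent representations have the same cone, so functions may be moved to the
    representatives; those equivalent to \<open>\<rho>\<close> cannot receive a spurious
    function.\<close>
  define R' where "R' = {s \<in> R. irreducible_rep G T s \<and> (s, \<rho>) \<notin> rep_equivalence G T}"
  define Z where "Z = (\<Union>s\<in>R'. {g \<in> closure (coefficient_cone G s). Re (g \<one>) \<le> 2})"
  have "compact Z"
    unfolding Z_def using R by (intro compact_UN compact_closure_cone) (auto simp: R'_def)
  have "Z \<inter> (\<Inter>x\<in>C \<union> U. {g. cmod (f x - g x) \<le> \<epsilon>}) \<noteq> {}"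
  proof (rule compact_imp_fip_image[OF \<open>compact Z\<close>])
    fix x show "closed {g :: 'a \<Rightarrow> complex. cmod (f x - g x) \<le> \<epsilon>}"
      by (intro closed_Collect_le continuous_on_norm continuous_on_diff continuous_on_const
          continuous_on_product_coordinates)
  next
    fix J assume J: "finite J" "J \<subseteq> C \<union> U"
    \<comment> \<open>Finitely many conditions involve only the finite part
      \<open>J \<inter> U\<close> of \<open>U\<close>, which is admissible as \<open>F\<close>; the
      rest of \<open>J\<close> lies in \<open>C\<close>.\<close>
    obtain r g where rg: "spurious \<rho> f \<epsilon> ((C \<union> (J \<inter> U)) \<union> V) r g"
      using ex[of "J \<inter> U"] J(1) by auto
    have near: "cmod (f x - g x) \<le> \<epsilon>" if "x \<in> C \<union> (J \<inter> U) \<union> V" for x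
      using rg that by (auto simp: spurious_def)
    have "cmod (1 - g x) \<le> 1 / 4" if "x \<in> V \<inter> W" for x
      using near[of x] fW[of x] that \<epsilon> norm_triangle_ineq4[of "f x - g x" "f x - 1"] by auto
    then have Re_g: "3 / 4 \<le> Re (g x) \<and> Re (g x) \<le> 5 / 4" if "x \<in> V \<inter> W" for x
      using abs_Re_le_cmod[of "1 - g x"] that by fastforce
    have "\<exists>s\<in>R. (r, s) \<in> rep_equivalence G T"
    proof (rule R_rep)
      have "\<forall>x\<in>V \<inter> W. 1 / 2 \<le> Re (g x)" using Re_g by fastforce
      moreover have "Re (g \<one>) \<le> 2" using Re_g[OF VW(2)] by simp
      ultimately show "\<exists>g\<in>closure (coefficient_cone G r). Re (g \<one>) \<le> 2 \<and> (\<forall>x\<in>V \<inter> W. 1 / 2 \<le> Re (g x))"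
        using rg by (auto simp: spurious_def)
    qed (use rg in \<open>simp add: spurious_def\<close>)
    then obtain s where s: "s \<in> R" "(r, s) \<in> rep_equivalence G T" by blast
    have "(s, \<rho>) \<notin> rep_equivalence G T"
    proof
      assume "(s, \<rho>) \<in> rep_equivalence G T"
      then have "(r, \<rho>) \<in> rep_equivalence G T"
        using eqv s(2) unfolding equiv_def by (blast dest: transD)
      then show False using rg by (simp add: spurious_def)
    qed
    then have "s \<in> R'" using s by (auto simp: R'_def rep_equivalence_def)
    moreover have "g \<in> closure (coefficient_cone G s)"
      using rg coefficient_cone_cong[OF s(2)] by (simp add: spurious_def)
    ultimately have "g \<in> Z" using Re_g[OF VW(2)] by (auto simp: Z_def)
    moreover have "cmod (f x - g x) \<le> \<epsilon>" if "x \<in> J" for x using near[of x] that J(2) by blast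
    ultimately show "Z \<inter> (\<Inter>x\<in>J. {g. cmod (f x - g x) \<le> \<epsilon>}) \<noteq> {}" by blast
  qed
  \<comment> \<open>A common point of all the conditions is spurious on \<open>C \<union> U\<close>
    itself.\<close>
  then obtain g s where "s \<in> R'" "g \<in> closure (coefficient_cone G s)"
    "\<forall>x\<in>C \<union> U. cmod (f x - g x) \<le> \<epsilon>" by (auto simp: Z_def)
  then have "spurious \<rho> f \<epsilon> (C \<union> U) s g" by (auto simp: spurious_def R'_def)
  then show False using no by blast
qed

text \<open>By orthogonality the mean square of \<open>f - g\<close> is at least that of
  \<open>f\<close>, which is positive because \<open>f \<one> = 1\<close>.\<close>

lemma separated_on_group:
  assumes \<rho>: "irreducible_rep G T \<rho>" and f: "f \<in> closure (coefficient_cone G \<rho>)" "f \<one> = 1"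
  shows "\<exists>\<epsilon>>0. \<epsilon> \<le> 1 / 8 \<and> (\<forall>r g. irreducible_rep G T r \<longrightarrow> \<not> equivalent_reps G \<rho> r \<longrightarrow>
    g \<in> closure (coefficient_cone G r) \<longrightarrow> \<not> (\<forall>x\<in>carrier G. cmod (f x - g x) \<le> \<epsilon>))"
proof -
  have uf: "ucont f" using closure_cone_ucont[OF \<rho> f(1)] f(2) by simp
  define \<delta> where "\<delta> = Re (M (\<lambda>x. f x * cnj (f x)))"
  have "0 \<le> Re (f x * cnj (f x))" for x unfolding complex_norm_square[symmetric] by simp
  then have \<delta>: "\<delta> > 0"
    unfolding \<delta>_def using uf f(2) by (intro mean_pos ucont_mult ucont_cnj) auto
  \<comment> \<open>The root of \<open>\<delta> / 2\<close> makes
    \<open>\<epsilon>\<^sup>2 < \<delta>\<close> strict; \<open>1 / 8\<close> ensures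
    \<open>Re (g \<one>) \<le> 2\<close> and is what \<open>extend_finite_set\<close>
    expects.\<close>
  define \<epsilon> where "\<epsilon> = min (1 / 8) (sqrt (\<delta> / 2))"
  have \<epsilon>: "0 < \<epsilon>" "\<epsilon> \<le> 1 / 8" "\<epsilon> \<le> sqrt (\<delta> / 2)" using \<delta> by (auto simp: \<epsilon>_def)
  have "\<epsilon>\<^sup>2 \<le> (sqrt (\<delta> / 2))\<^sup>2" using \<epsilon> by (intro power_mono) auto
  then have \<epsilon>2: "\<epsilon>\<^sup>2 < \<delta>" using \<delta> by simp
  have "\<not> (\<forall>x\<in>carrier G. cmod (f x - g x) \<le> \<epsilon>)"
    if r: "irreducible_rep G T r" "\<not> equivalent_reps G \<rho> r" "g \<in> closure (coefficient_cone G r)" for r g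
  proof
    assume near: "\<forall>x\<in>carrier G. cmod (f x - g x) \<le> \<epsilon>"
    then have "cmod (1 - g \<one>) \<le> \<epsilon>" using f(2) by force
    then have g1: "Re (g \<one>) \<le> 2" using abs_Re_le_cmod[of "1 - g \<one>"] \<epsilon>(2) by simp
    have ug: "ucont g" by (rule closure_cone_ucont[OF r(1,3) g1])
    have "M (\<lambda>x. f (\<one> \<otimes> x) * cnj (g (\<one> \<otimes> x))) = 0"
      by (rule orthogonal_closure_cones[OF \<rho> r(1,2) f(1) _ r(3) g1]) (simp_all add: f(2))
    moreover have bfg: "bounded_fun (carrier G) (\<lambda>x. f x * cnj (g x))"
      using uf ug by (intro ucont_bounded ucont_mult ucont_cnj)
    then have "M (\<lambda>x. f x * cnj (g x)) = M (\<lambda>x. f (\<one> \<otimes> x) * cnj (g (\<one> \<otimes> x)))"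
      by (rule mean.cong) simp
    ultimately have fg: "M (\<lambda>x. f x * cnj (g x)) = 0" by simp
    have bff: "bounded_fun (carrier G) (\<lambda>x. f x * cnj (f x))"
      using uf by (intro ucont_bounded ucont_mult ucont_cnj)
    \<comment> \<open>The square of \<open>cmod (g x)\<close> is dropped, and the mixed term has
      mean \<open>0\<close>.\<close>
    have "Re (M (\<lambda>x. f x * cnj (f x) - 2 * (f x * cnj (g x)))) \<le> Re (M (\<lambda>x. of_real (\<epsilon>\<^sup>2)))"
    proof (rule mean.mono)
      fix x assume "x \<in> carrier G"
      then have "(cmod (f x - g x))\<^sup>2 \<le> \<epsilon>\<^sup>2" using near by (intro power_mono) auto
      moreover have "(cmod (f x - g x))\<^sup>2 = (cmod (f x))\<^sup>2 - 2 * Re (f x * cnj (g x)) + (cmod (g x))\<^sup>2"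
        unfolding cmod_power2 by (simp add: power2_eq_square algebra_simps)
      moreover have "Re (f x * cnj (f x) - 2 * (f x * cnj (g x))) = (cmod (f x))\<^sup>2 - 2 * Re (f x * cnj (g x))"
        unfolding complex_norm_square[symmetric] by (simp flip: of_real_power)
      ultimately show "Re (f x * cnj (f x) - 2 * (f x * cnj (g x))) \<le> Re (of_real (\<epsilon>\<^sup>2))"
        using zero_le_power2[of "cmod (g x)"] by (simp only: Re_complex_of_real)
    qed (intro bounded_fun_diff bounded_fun_mult[OF bounded_fun_const] bounded_fun_const bff bfg)+
    also have "M (\<lambda>x. f x * cnj (f x) - 2 * (f x * cnj (g x))) = M (\<lambda>x. f x * cnj (f x))"
      using bff bfg
        by (simp only: mean.diff mean.cmult bounded_fun_mult bounded_fun_const fg mult_zero_right diff_zero)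
    finally show False using \<epsilon>2 by (simp add: \<delta>_def mean.const del: of_real_power)
  qed
  then show ?thesis using \<epsilon>(1,2) by blast
qed

theorem isolated_in_Fell_topology:
  fixes \<rho> :: "('a, 'h) rep" and U :: "nat \<Rightarrow> 'a set"
  assumes \<rho>: "irreducible_rep G T \<rho>"
    and K: "compactin T K" "\<one> \<in> K"
    and U: "\<And>n. openin T (U n)" "\<And>n. \<one> \<in> U n"
    and base: "\<And>V. openin T V \<Longrightarrow> K \<subseteq> V \<Longrightarrow> \<exists>N. \<forall>n\<ge>N. U n \<subseteq> V"
  shows "\<exists>f\<in>coefficient_cone G \<rho>. \<exists>C \<epsilon>. compactin T C \<and> \<epsilon> > 0 \<and>
    (\<forall>(r :: ('a, 'h) rep) g. irreducible_rep G T r \<longrightarrow> g \<in> coefficient_cone G r \<longrightarrow>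
      (\<forall>x\<in>C. cmod (f x - g x) < \<epsilon>) \<longrightarrow> (r, \<rho>) \<in> rep_equivalence G T)"
proof -
  have eqv: "equiv {r :: ('a, 'h) rep. irreducible_rep G T r} (rep_equivalence G T)"
    by (rule equiv_rep_equivalence)
  obtain f where f: "f \<in> coefficient_cone G \<rho>" "f \<one> = 1"
  proof -
    obtain H \<sigma> where eq: "\<rho> = (H, \<sigma>)" by (cases \<rho>)
    interpret irrep G T M H \<sigma> using \<rho> unfolding eq by (intro irrepI)
    obtain v where v: "v \<in> carrier H" "hnorm H v = 1" using ex_unit_vector by blast
    define p where "p = (\<lambda>g\<in>carrier G. cinner H (\<sigma> g v) v)"
    have "p \<in> coefficients G (H, \<sigma>)" using v by (auto simp: coefficients_def p_def)
    moreover have "p = (\<lambda>g\<in>carrier G. \<Sum>i<(1::nat). p g)"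
      by (auto simp: p_def restrict_def fun_eq_iff)
    ultimately have "p \<in> coefficient_cone G \<rho>"
      unfolding eq coefficient_cone_def by (intro CollectI exI[of _ 1] exI[of _ "\<lambda>_. p"]) auto
    moreover have "p \<one> = 1" using v hs.cinner_self[OF v(1)] by (simp add: p_def rep_one)
    ultimately show ?thesis by (rule that)
  qed
  have fc: "f \<in> closure (coefficient_cone G \<rho>)" using f(1) closure_subset by blast
  have uf: "ucont f" using closure_cone_ucont[OF \<rho> fc] f(2) by simp
  obtain \<epsilon> where \<epsilon>: "\<epsilon> > 0" "\<epsilon> \<le> 1 / 8"
    "\<And>(r :: ('a, 'h) rep) g. irreducible_rep G T r \<Longrightarrow> \<not> equivalent_reps G \<rho> r \<Longrightarrow>
      g \<in> closure (coefficient_cone G r) \<Longrightarrow> \<not> (\<forall>x\<in>carrier G. cmod (f x - g x) \<le> \<epsilon>)"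
    using separated_on_group[OF \<rho> fc f(2)] by blast
  \<comment> \<open>Shifted by one so that the induction starts with the whole group, where
    \<open>separated_on_group\<close> applies and from which the first finite set is taken.\<close>
  define V where "V n = (case n of 0 \<Rightarrow> carrier G | Suc n \<Rightarrow> U n)" for n
  have V: "openin T (V n)" "\<one> \<in> V n" for n
    using U openin_topspace[of T] by (auto simp: V_def topspace_eq_carrier split: nat.split)
  \<comment> \<open>\<open>C n\<close> collects the finite sets chosen before stage
    \<open>n\<close>, starting from the empty set; the points added at stage \<open>n\<close> lie in
    \<open>V n\<close>.\<close>
  have "\<exists>C. \<forall>n. (finite (C n) \<and> C n \<subseteq> carrier G \<and> (\<forall>r g. \<not> spurious \<rho> f \<epsilon> (C n \<union> V n) r g)) \<and>
      (C n \<subseteq> C (Suc n) \<and> C (Suc n) \<subseteq> C n \<union> V n)"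
  proof (rule dependent_nat_choice)
    have "\<not> spurious \<rho> f \<epsilon> ({} \<union> V 0) r g" for r g
    proof
      assume b: "spurious \<rho> f \<epsilon> ({} \<union> V 0) r g"
      have "sym (rep_equivalence G T :: (('a, 'h) rep \<times> ('a, 'h) rep) set)"
        using eqv by (simp add: equiv_def)
      then have "(\<rho>, r) \<notin> rep_equivalence G T" using b by (auto simp: spurious_def dest: symD)
      then have "\<not> equivalent_reps G \<rho> r" using \<rho> b by (simp add: spurious_def rep_equivalence_def)
      then show False using b \<epsilon>(3)[of r g] by (auto simp: spurious_def V_def)
    qed
    then show "\<exists>C. finite C \<and> C \<subseteq> carrier G \<and> (\<forall>r g. \<not> spurious \<rho> f \<epsilon> (C \<union> V 0) r g)" by blast
  next
    fix C n assume C: "finite C \<and> C \<subseteq> carrier G \<and> (\<forall>r g. \<not> spurious \<rho> f \<epsilon> (C \<union> V n) r g)"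
    have "\<exists>F. finite F \<and> F \<subseteq> V n \<and> (\<forall>r g. \<not> spurious \<rho> f \<epsilon> ((C \<union> F) \<union> V (Suc n)) r g)"
      by (rule extend_finite_set[OF uf f(2) \<epsilon>(2) V]) (use C V in auto)
    then obtain F where F: "finite F" "F \<subseteq> V n" "\<forall>r g. \<not> spurious \<rho> f \<epsilon> ((C \<union> F) \<union> V (Suc n)) r g" by blast
    have "F \<subseteq> carrier G" using F(2) openin_subset_carrier[OF V(1)] by blast
    then show "\<exists>C'. (finite C' \<and> C' \<subseteq> carrier G \<and> (\<forall>r g. \<not> spurious \<rho> f \<epsilon> (C' \<union> V (Suc n)) r g)) \<and>
        (C \<subseteq> C' \<and> C' \<subseteq> C \<union> V n)"
      using C F by (intro exI[of _ "C \<union> F"]) auto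
  qed
  then obtain C where *: "\<forall>n. (finite (C n) \<and> C n \<subseteq> carrier G \<and> (\<forall>r g. \<not> spurious \<rho> f \<epsilon> (C n \<union> V n) r g)) \<and>
      (C n \<subseteq> C (Suc n) \<and> C (Suc n) \<subseteq> C n \<union> V n)" by (elim exE)
  have C: "finite (C n)" "C n \<subseteq> carrier G" "\<not> spurious \<rho> f \<epsilon> (C n \<union> V n) r g"
    "C n \<subseteq> C (Suc n)" "C (Suc n) \<subseteq> C n \<union> V n" for n r g
    using spec[OF *, of n] by (simp_all only: simp_thms)
  define D where "D = K \<union> (\<Union>n. C n)"
  \<comment> \<open>All points added from stage \<open>N\<close> on lie in sets \<open>V m\<close>
    with \<open>m \<ge> N\<close>.\<close>
  have tail: "C n \<subseteq> C N \<union> W" if "\<And>m. m \<ge> N \<Longrightarrow> V m \<subseteq> W" for n N W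
  proof (cases "n \<ge> N")
    case True
    then show ?thesis using C(5) that
      by (induction n rule: dec_induct) fast+
  next
    case False
    then show ?thesis using lift_Suc_mono_le[of C n N] C(4) by auto
  qed
  have base_V: "\<exists>N. \<forall>n\<ge>N. V n \<subseteq> W" if W: "openin T W" "K \<subseteq> W" for W
  proof -
    obtain N where "\<forall>n\<ge>N. U n \<subseteq> W" using base[OF W] by blast
    then have "\<forall>n\<ge>Suc N. V n \<subseteq> W" by (auto simp: V_def split: nat.split)
    then show ?thesis by blast
  qed
  \<comment> \<open>A finite subfamily that covers \<open>K\<close> has an open union, which
    contains \<open>V m\<close> for all large \<open>m\<close> and hence everything in
    \<open>D\<close> outside a finite set \<open>C N\<close>.\<close>
  have "compactin T D"
    unfolding compactin_def
  proof (intro conjI allI impI)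
    show "D \<subseteq> topspace T"
      using compactin_subset_topspace[OF K(1)] C(2) by (auto simp: D_def topspace_eq_carrier)
    fix \<U> assume \<U>: "(\<forall>W\<in>\<U>. openin T W) \<and> D \<subseteq> \<Union>\<U>"
    then obtain \<F> where \<F>: "finite \<F>" "\<F> \<subseteq> \<U>" "K \<subseteq> \<Union>\<F>"
      using K(1) unfolding compactin_def D_def by (metis le_sup_iff)
    have "openin T (\<Union>\<F>)" using \<F>(2) \<U> by (intro openin_Union) blast
    then obtain N where N: "\<And>m. m \<ge> N \<Longrightarrow> V m \<subseteq> \<Union>\<F>" using base_V \<F>(3) by blast
    have "C N \<subseteq> D" by (auto simp: D_def)
    then have "C N \<subseteq> \<Union>\<U>" using \<U> by (meson order_trans)
    then have "\<forall>x\<in>C N. \<exists>W\<in>\<U>. x \<in> W" by blast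
    then obtain w where w: "\<And>x. x \<in> C N \<Longrightarrow> w x \<in> \<U> \<and> x \<in> w x" by metis
    have "C N \<subseteq> \<Union>(w ` C N)" using w by blast
    moreover have "C n \<subseteq> C N \<union> \<Union>\<F>" for n by (rule tail) (rule N)
    ultimately have "C n \<subseteq> \<Union>(\<F> \<union> w ` C N)" for n
      unfolding Union_Un_distrib by (meson Un_least order_trans sup_ge1 sup_ge2)
    then have "D \<subseteq> \<Union>(\<F> \<union> w ` C N)" using \<F>(3) by (auto simp: D_def)
    then show "\<exists>\<F>. finite \<F> \<and> \<F> \<subseteq> \<U> \<and> D \<subseteq> \<Union>\<F>"
      using \<F> w C(1) by (intro exI[of _ "\<F> \<union> w ` C N"]) auto
  qed
  moreover have "(r, \<rho>) \<in> rep_equivalence G T"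
    if r: "irreducible_rep G T r" "g \<in> coefficient_cone G r" "\<And>x. x \<in> D \<Longrightarrow> cmod (f x - g x) < \<epsilon>"
    for r :: "('a, 'h) rep" and g
  proof (rule ccontr)
    assume ne: "(r, \<rho>) \<notin> rep_equivalence G T"
    have gc: "g \<in> closure (coefficient_cone G r)" using r(2) closure_subset by blast
    have "cmod (1 - g \<one>) < \<epsilon>" using r(3)[of \<one>] K(2) f(2) by (simp add: D_def)
    then have g1: "Re (g \<one>) \<le> 2" using abs_Re_le_cmod[of "1 - g \<one>"] \<epsilon>(2) by simp
    have ug: "ucont g" by (rule closure_cone_ucont[OF r(1) gc g1])
    \<comment> \<open>Closeness on \<open>K\<close> extends to an open set around \<open>K\<close>
      and so to some \<open>V N\<close>. Together with closeness on \<open>C N\<close> this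
      contradicts the choice of \<open>C N\<close>.\<close>
    have "ucont (\<lambda>x. f x + (-1) * g x)" using uf ug by (intro ucont_add ucont_mult ucont_const)
    from ucont_open_less[OF this, of \<epsilon>] have "openin T {x \<in> carrier G. cmod (f x - g x) < \<epsilon>}" by simp
    moreover have "K \<subseteq> {x \<in> carrier G. cmod (f x - g x) < \<epsilon>}"
      using r(3) compactin_subset_topspace[OF K(1)] by (auto simp: D_def topspace_eq_carrier)
    ultimately have "\<exists>N. \<forall>n\<ge>N. V n \<subseteq> {x \<in> carrier G. cmod (f x - g x) < \<epsilon>}" by (rule base_V)
    then obtain N where *: "\<forall>n\<ge>N. V n \<subseteq> {x \<in> carrier G. cmod (f x - g x) < \<epsilon>}" by (elim exE)
    have "V N \<subseteq> {x \<in> carrier G. cmod (f x - g x) < \<epsilon>}" using spec[OF *, of N] by simp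
    then have "cmod (f x - g x) \<le> \<epsilon>" if "x \<in> C N \<union> V N" for x
      using that r(3)[of x] by (auto simp: D_def subset_iff intro: less_imp_le)
    then have "spurious \<rho> f \<epsilon> (C N \<union> V N) r g"
      unfolding spurious_def using r(1) ne gc by blast
    then show False using C(3) by blast
  qed
  ultimately show ?thesis using f(1) \<epsilon>(1) by blast
qed

end

section \<open>Consequences of precompactness and of almost metrizability\<close>

lemma precompact_imp_totally_bounded:
  fixes G :: "('g, 'm) monoid_scheme"
  assumes G: "topological_group G T" and pre: "precompact_group TYPE('k) G T"
  shows "totally_bounded_group G T"
proof -
  interpret G: topological_group G T by fact
  obtain K :: "'k monoid"
    and TK S \<phi> where K: "topological_group K TK" "compact_space TK" "subgroup S K"
      "\<phi> \<in> iso G (K\<lparr>carrier := S\<rparr>)" "homeomorphic_map T (subtopology TK S) \<phi>"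
    using pre unfolding precompact_group_def by blast
  interpret K: topological_group K TK by fact
  have S: "S \<subseteq> carrier K" using K(3) by (rule subgroup.subset)
  have hom: "\<phi> (x \<otimes>\<^bsub>G\<^esub> y) = \<phi> x \<otimes>\<^bsub>K\<^esub> \<phi> y" if "x \<in> carrier G" "y \<in> carrier G" for x y
    using K(4) that by (auto simp: iso_def hom_def)
  have img: "\<phi> ` carrier G = S" and inj: "inj_on \<phi> (carrier G)"
    using K(4) by (auto simp: iso_def bij_betw_def)
  have \<phi>c: "\<phi> x \<in> carrier K" if "x \<in> carrier G" for x using img S that by blast
  have \<phi>1: "\<phi> \<one>\<^bsub>G\<^esub> = \<one>\<^bsub>K\<^esub>"
    using hom[of "\<one>\<^bsub>G\<^esub>" "\<one>\<^bsub>G\<^esub>"] \<phi>c[of "\<one>\<^bsub>G\<^esub>"] K.l_cancel_one'[of "\<phi> \<one>\<^bsub>G\<^esub>" "\<phi> \<one>\<^bsub>G\<^esub>"] by simp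
  have \<phi>inv: "\<phi> (inv\<^bsub>G\<^esub> x) = inv\<^bsub>K\<^esub> \<phi> x" if "x \<in> carrier G" for x
    using hom[of "inv\<^bsub>G\<^esub> x" x] that \<phi>c \<phi>1 by (intro K.inv_equality[symmetric]) auto
  show ?thesis
  proof (unfold_locales)
    fix U assume U: "openin T U" "\<one>\<^bsub>G\<^esub> \<in> U"
    have Uc: "U \<subseteq> carrier G" using openin_subset[OF U(1)] G.topspace_eq_carrier by simp
    have "openin (subtopology TK S) (\<phi> ` U)"
      using K(5) U(1) Uc by (simp add: homeomorphic_map_openness G.topspace_eq_carrier)
    then obtain W where W: "openin TK W" "\<phi> ` U = W \<inter> S" by (auto simp: openin_subtopology)
    have "\<one>\<^bsub>K\<^esub> \<in> W" using W(2) U(2) \<phi>1 by (metis IntD1 imageI)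
    define d where "d = (\<lambda>p. inv\<^bsub>K\<^esub> fst p \<otimes>\<^bsub>K\<^esub> snd p)"
    have "continuous_map (prod_topology TK TK) TK d"
    proof -
      have "continuous_map (prod_topology TK TK) (prod_topology TK TK) (\<lambda>p. (inv\<^bsub>K\<^esub> (fst p), snd p))"
        using continuous_map_compose[OF continuous_map_fst K.continuous_inv]
        by (intro continuous_map_pairedI) (auto simp: o_def continuous_map_snd)
      from continuous_map_compose[OF this K.continuous_mult] show ?thesis
        by (simp add: o_def d_def case_prod_beta)
    qed
    then have o: "openin (prod_topology TK TK) {p \<in> topspace (prod_topology TK TK). d p \<in> W}"
      using W(1) by (rule openin_continuous_map_preimage)
    have "(\<one>\<^bsub>K\<^esub>, \<one>\<^bsub>K\<^esub>) \<in> {p \<in> topspace (prod_topology TK TK). d p \<in> W}"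
      using \<open>\<one>\<^bsub>K\<^esub> \<in> W\<close> by (simp add: d_def K.topspace_eq_carrier)
    from o[unfolded openin_prod_topology_alt, rule_format, OF this]
    obtain V1 V2 where V12: "openin TK V1" "openin TK V2" "\<one>\<^bsub>K\<^esub> \<in> V1" "\<one>\<^bsub>K\<^esub> \<in> V2"
        "V1 \<times> V2 \<subseteq> {p \<in> topspace (prod_topology TK TK). d p \<in> W}"
      by (elim exE conjE)
    \<comment> \<open>Two points of one translate \<open>k V\<close> differ by an element of
      \<open>W\<close>.\<close>
    define V where "V = V1 \<inter> V2"
    have V: "openin TK V" "\<one>\<^bsub>K\<^esub> \<in> V" "\<And>x y. x \<in> V \<Longrightarrow> y \<in> V \<Longrightarrow> inv\<^bsub>K\<^esub> x \<otimes>\<^bsub>K\<^esub> y \<in> W"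
      using V12 by (auto simp: V_def d_def)
    define N where "N k = {x \<in> carrier K. inv\<^bsub>K\<^esub> k \<otimes>\<^bsub>K\<^esub> x \<in> V}" for k
    have N: "openin TK (N k)" "k \<in> N k" if k: "k \<in> carrier K" for k
    proof -
      have "continuous_map TK TK (\<lambda>x. inv\<^bsub>K\<^esub> k \<otimes>\<^bsub>K\<^esub> x)"
        using continuous_map_compose[of TK "prod_topology TK TK" "\<lambda>x. (inv\<^bsub>K\<^esub> k, x)" TK, OF _ K.continuous_mult] k
        by (simp add: o_def continuous_map_pairedI K.topspace_eq_carrier)
      from openin_continuous_map_preimage[OF this V(1)] show "openin TK (N k)"
        by (simp add: N_def K.topspace_eq_carrier)
      show "k \<in> N k" using k V(2) by (simp add: N_def)
    qed
    have "\<exists>\<F>. finite \<F> \<and> \<F> \<subseteq> N ` carrier K \<and> topspace TK \<subseteq> \<Union>\<F>"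
    proof (rule compactinD)
      show "compactin TK (topspace TK)" using K(2) by (simp add: compact_space_def)
      show "topspace TK \<subseteq> \<Union>(N ` carrier K)" using N(2) by (auto simp: K.topspace_eq_carrier)
    qed (use N(1) in blast)
    then obtain B where B: "finite B" "B \<subseteq> carrier K" "carrier K \<subseteq> (\<Union>k\<in>B. N k)"
      by (metis finite_subset_image K.topspace_eq_carrier)
    \<comment> \<open>The centers \<open>k\<close> need not lie in the image of \<open>G\<close>;
      each is replaced by the image of a point \<open>s k\<close> in the same translate.\<close>
    define B' where "B' = {k \<in> B. \<exists>x\<in>carrier G. \<phi> x \<in> N k}"
    have "\<forall>k\<in>B'. \<exists>a. a \<in> carrier G \<and> \<phi> a \<in> N k" by (auto simp: B'_def)
    from bchoice[OF this] obtain s where s: "\<And>k. k \<in> B' \<Longrightarrow> s k \<in> carrier G \<and> \<phi> (s k) \<in> N k" by blast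
    have "\<exists>a\<in>s ` B'. inv\<^bsub>G\<^esub> a \<otimes>\<^bsub>G\<^esub> x \<in> U" if x: "x \<in> carrier G" for x
    proof -
      obtain k where k: "k \<in> B" "\<phi> x \<in> N k" using B(3) \<phi>c[OF x] by blast
      then have k': "k \<in> B'" using x by (auto simp: B'_def)
      have kc: "k \<in> carrier K" using k B(2) by blast
      let ?a = "s k"
      have a: "?a \<in> carrier G" "\<phi> ?a \<in> N k" using s[OF k'] by auto
      have inW: "inv\<^bsub>K\<^esub> (inv\<^bsub>K\<^esub> k \<otimes>\<^bsub>K\<^esub> \<phi> ?a) \<otimes>\<^bsub>K\<^esub> (inv\<^bsub>K\<^esub> k \<otimes>\<^bsub>K\<^esub> \<phi> x) \<in> W"
        using V(3) a(2) k(2) by (auto simp: N_def)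
      have cancel: "k \<otimes>\<^bsub>K\<^esub> (inv\<^bsub>K\<^esub> k \<otimes>\<^bsub>K\<^esub> \<phi> x) = \<phi> x"
        using kc \<phi>c[OF x] by (simp add: K.m_assoc[symmetric])
      have eq: "inv\<^bsub>K\<^esub> (inv\<^bsub>K\<^esub> k \<otimes>\<^bsub>K\<^esub> \<phi> ?a) \<otimes>\<^bsub>K\<^esub> (inv\<^bsub>K\<^esub> k \<otimes>\<^bsub>K\<^esub> \<phi> x) = inv\<^bsub>K\<^esub> \<phi> ?a \<otimes>\<^bsub>K\<^esub> \<phi> x"
        using \<phi>c[OF a(1)] \<phi>c[OF x] kc by (simp add: K.inv_mult_group K.m_assoc cancel)
      also have "\<dots> = \<phi> (inv\<^bsub>G\<^esub> ?a \<otimes>\<^bsub>G\<^esub> x)" using a x by (simp add: hom \<phi>inv)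
      finally have "\<phi> (inv\<^bsub>G\<^esub> ?a \<otimes>\<^bsub>G\<^esub> x) \<in> W" using inW by simp
      then have "\<phi> (inv\<^bsub>G\<^esub> ?a \<otimes>\<^bsub>G\<^esub> x) \<in> \<phi> ` U" using W(2) img a x by auto
      then have "inv\<^bsub>G\<^esub> ?a \<otimes>\<^bsub>G\<^esub> x \<in> U" using inj Uc a x by (auto dest: inj_onD)
      then show ?thesis using k' by blast
    qed
    then show "\<exists>A. finite A \<and> A \<subseteq> carrier G \<and> (\<forall>x\<in>carrier G. \<exists>a\<in>A. inv\<^bsub>G\<^esub> a \<otimes>\<^bsub>G\<^esub> x \<in> U)"
      using s B(1) by (intro exI[of _ "s ` B'"]) (auto simp: B'_def)
  qed
qed

context topological_group
begin

text \<open>The sets \<open>U n\<close> are preimages of balls around the coset \<open>K\<close> in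
  the quotient. They form a base at \<open>K\<close> because compactness of \<open>K\<close> makes
  every open set around \<open>K\<close> contain a saturated open one.\<close>

lemma almost_metrizable_base:
  assumes "almost_metrizable_group G T"
  obtains K U where "compactin T K" "\<one> \<in> K" "\<And>n :: nat. openin T (U n)" "\<And>n. \<one> \<in> U n"
    "\<And>V. openin T V \<Longrightarrow> K \<subseteq> V \<Longrightarrow> \<exists>N. \<forall>n\<ge>N. U n \<subseteq> V"
proof -
  obtain K Q where K: "subgroup K G" "compactin T K" and q: "quotient_map T Q (\<lambda>x. x <# K)"
    and "metrizable_space Q"
    using assms unfolding almost_metrizable_group_def by blast
  then obtain D d where D: "Metric_space D d" "Q = Metric_space.mtopology D d"
    unfolding metrizable_space_def by blast
  interpret Metric_space D d by fact
  interpret K: subgroup K G by fact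
  define \<pi> where "\<pi> x = x <# K" for x
  have q: "quotient_map T mtopology \<pi>" using q D(2) by (simp add: \<pi>_def[abs_def])
  have coset: "x \<in> \<pi> x" if "x \<in> carrier G" for x
    using that by (auto simp: \<pi>_def l_coset_def intro!: bexI[of _ \<one>])
  have \<pi>1: "\<pi> \<one> = K" using K.subset by (auto simp: \<pi>_def l_coset_def subset_iff)
  have \<pi>D: "\<pi> x \<in> D" if "x \<in> carrier G" for x
    using q that by (auto simp: quotient_map_def topspace_eq_carrier)
  define U where "U n = {x \<in> carrier G. \<pi> x \<in> mball K (1 / Suc n)}" for n :: nat
  show ?thesis
  proof
    show "compactin T K" by fact
    show "\<one> \<in> K" by simp
    show "openin T (U n)" for n
      using openin_continuous_map_preimage[OF quotient_imp_continuous_map[OF q] openin_mball]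
      by (simp add: U_def topspace_eq_carrier)
    show "\<one> \<in> U n" for n using \<pi>D[of \<one>] by (simp add: U_def \<pi>1)
    fix V assume V: "openin T V" "K \<subseteq> V"
    \<comment> \<open>The union of the cosets inside \<open>V\<close>. It is open by the tube lemma,
      and it is saturated, so its image in the quotient is open.\<close>
    define W where "W = {x \<in> carrier G. \<pi> x \<subseteq> V}"
    have "openin T W"
    proof (subst openin_subopen, intro ballI)
      fix x assume "x \<in> W"
      then have x: "x \<in> carrier G" "\<pi> x \<subseteq> V" by (auto simp: W_def)
      let ?P = "{p \<in> topspace (prod_topology T T). (case p of (x, y) \<Rightarrow> x \<otimes> y) \<in> V}"
      have P: "openin (prod_topology T T) ?P"
        using continuous_mult V(1) by (rule openin_continuous_map_preimage)
      have "{x} \<times> K \<subseteq> ?P" using x K.subset by (auto simp: topspace_eq_carrier \<pi>_def l_coset_def)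
      then obtain A B where AB: "openin T A" "openin T B" "x \<in> A" "K \<subseteq> B" "A \<times> B \<subseteq> ?P"
        using tube_lemma_right[OF P K(2), of x] x by (auto simp: topspace_eq_carrier)
      have "A \<subseteq> W"
      proof
        fix y assume y: "y \<in> A"
        then have "y \<in> carrier G" using openin_subset[OF AB(1)] by (auto simp: topspace_eq_carrier)
        moreover have "y \<otimes> h \<in> V" if "h \<in> K" for h
        proof -
          have "(y, h) \<in> ?P" using AB(4,5) y that by blast
          then show ?thesis by simp
        qed
        then have "\<pi> y \<subseteq> V" by (auto simp: \<pi>_def l_coset_def)
        ultimately show "y \<in> W" by (simp add: W_def)
      qed
      then show "\<exists>A. openin T A \<and> x \<in> A \<and> A \<subseteq> W" using AB by blast
    qed
    moreover have "{x \<in> topspace T. \<pi> x \<in> \<pi> ` W} = W" by (auto simp: W_def topspace_eq_carrier)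
    moreover have "\<pi> ` W \<subseteq> D" using \<pi>D by (auto simp: W_def)
    then have "openin T {x \<in> topspace T. \<pi> x \<in> \<pi> ` W} \<longleftrightarrow> openin mtopology (\<pi> ` W)"
      using q unfolding quotient_map_def by simp
    ultimately have "openin mtopology (\<pi> ` W)" by simp
    moreover have "K \<in> \<pi> ` W" using V(2) \<pi>1 by (auto simp: W_def intro!: image_eqI[of _ _ \<one>])
    ultimately obtain r where r: "r > 0" "mball K r \<subseteq> \<pi> ` W" unfolding openin_mtopology by blast
    obtain N where N: "1 / Suc N < r" using nat_approx_posE[OF r(1)] by blast
    have "U n \<subseteq> V" if "n \<ge> N" for n
    proof
      fix x assume x: "x \<in> U n"
      have "1 / Suc n \<le> 1 / Suc N" using that by (simp add: frac_le)
      then have "\<pi> x \<in> mball K r" using x N by (auto simp: U_def)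
      then have "\<pi> x \<in> \<pi> ` W" using r by blast
      then have "\<pi> x \<subseteq> V" by (auto simp: W_def)
      then show "x \<in> V" using coset[of x] x by (auto simp: U_def)
    qed
    then show "\<exists>N. \<forall>n\<ge>N. U n \<subseteq> V" by blast
  qed
qed

end

theorem theorem4p1:
  fixes G :: "('g, 'm) monoid_scheme" and T :: "'g topology"
  assumes "topological_group G T"
    and "precompact_group TYPE('k) G T"
    and "almost_metrizable_group G T"
  shows "(fell_topology G T :: ('g, 'h) rep set topology) = discrete_topology (dual_object G T)"
proof -
  interpret totally_bounded_group G T using assms(1,2) by (rule precompact_imp_totally_bounded)
  obtain M where "mean (carrier G) M" "\<forall>f y. ucont f \<longrightarrow> y \<in> carrier G \<longrightarrow> M (\<lambda>x. f (y \<otimes>\<^bsub>G\<^esub> x)) = M f"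
    using ex_invariant_mean by blast
  then interpret invariant_mean_group G T M by unfold_locales auto
  obtain K U where K: "compactin T K" "\<one>\<^bsub>G\<^esub> \<in> K" and U: "\<And>n :: nat. openin T (U n)" "\<And>n. \<one>\<^bsub>G\<^esub> \<in> U n"
    "\<And>V. openin T V \<Longrightarrow> K \<subseteq> V \<Longrightarrow> \<exists>N. \<forall>n\<ge>N. U n \<subseteq> V"
    using almost_metrizable_base[OF assms(3)] by blast
  have eqv: "equiv {r :: ('g, 'h) rep. irreducible_rep G T r} (rep_equivalence G T)"
    by (rule equiv_rep_equivalence)
  have irr: "irreducible_rep G T r" if "c \<in> dual_object G T" "r \<in> c" for c and r :: "('g, 'h) rep"
    using that eqv unfolding dual_object_def by (metis Union_iff Union_quotient mem_Collect_eq)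
  have "fell_open G T X" if X: "X \<subseteq> dual_object G T" for X :: "('g, 'h) rep set set"
    unfolding fell_open_def
  proof (intro conjI ballI X)
    fix c and \<rho> :: "('g, 'h) rep" assume c: "c \<in> X" "\<rho> \<in> c"
    have cd: "c \<in> dual_object G T" using c X by blast
    have \<rho>: "irreducible_rep G T \<rho>" by (rule irr[OF cd c(2)])
    obtain f C \<epsilon> where f: "f \<in> coefficient_cone G \<rho>" "compactin T C" "\<epsilon> > 0"
      "\<And>(r :: ('g, 'h) rep) g. \<lbrakk>irreducible_rep G T r; g \<in> coefficient_cone G r;
        \<forall>x\<in>C. cmod (f x - g x) < \<epsilon>\<rbrakk> \<Longrightarrow> (r, \<rho>) \<in> rep_equivalence G T"
      using isolated_in_Fell_topology[OF \<rho> K U] by blast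
    \<comment> \<open>One function is enough to isolate a class: a class in this neighborhood has a
      representative equivalent to \<open>\<rho>\<close> and therefore equals
      \<open>c\<close>.\<close>
    have "fell_nbhd G T 1 (\<lambda>_. f) C \<epsilon> \<subseteq> X"
    proof
      fix c' :: "('g, 'h) rep set" assume "c' \<in> fell_nbhd G T 1 (\<lambda>_. f) C \<epsilon>"
      then obtain s h where c': "c' \<in> dual_object G T" and s: "s \<in> c'" "h 0 \<in> coefficient_cone G s"
        "\<forall>x\<in>C. cmod (f x - h 0 x) < \<epsilon>" unfolding fell_nbhd_def by auto
      then have "(s, \<rho>) \<in> rep_equivalence G T" using f(4)[OF irr[OF c' s(1)]] by blast
      then have "c' = c"
        using quotient_eq_iff[OF eqv] c' cd s(1) c(2) unfolding dual_object_def by blast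
      then show "c' \<in> X" using c by simp
    qed
    then show "\<exists>n f C \<epsilon>. (\<forall>i<n. f i \<in> coefficient_cone G \<rho>) \<and> compactin T C \<and> \<epsilon> > 0 \<and>
        fell_nbhd G T n f C \<epsilon> \<subseteq> X"
      using f(1-3) by (intro exI[of _ "1::nat"] exI[of _ "\<lambda>_. f"] exI[of _ C] exI[of _ \<epsilon>]) auto
  qed
  then have "openin (fell_topology G T) X \<longleftrightarrow> X \<subseteq> dual_object G T" for X :: "('g, 'h) rep set set"
    by (auto simp: openin_fell_topology fell_open_def)
  then show ?thesis by (simp add: topology_eq)
qed

end
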